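(* For every integer $\ell\geq 4$, the problem \textsc{$(\ell-1)$-Colored $P_\ell$ Deletion} is NP-hard, even when restricted to input graphs of maximum degree $16$.
   Context: A $c$-colored (edge-colored) graph is a simple graph $G=(V,E)$ whose edge set is partitioned into $c$ pairwise disjoint non-empty sets $E=E_1\sqcup\dots\sqcup E_c$; an edge in $E_i$ has color $i$. A path is $c$-colored if its edge set contains edges of exactly $c$ distinct colors. $P_\ell$ denotes a path on $\ell$ vertices. \textsc{$c$-Colored $P_\ell$ Deletion}: given a $c$-colored graph $G$ and an integer $k$, decide whether there is a set $S$ of at most $k$ edges such that $G-S$ contains no $c$-colored $P_\ell$ as an induced subgraph. Here $c=\ell-1$. *)

theory Defs
  imports Complex_Main "HOL-Computational_Algebra.Polynomial"
begin

section \<open>Multi-tape Turing machines, polynomial time and NP\<close>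

text \<open>
  States are the numbers below \<open>states\<close>, with start state 0 and accepting state 1; tape symbols are
  the numbers below \<open>symbols\<close>, where 0 is the blank and 1, 2 stand for the bits False, True.
  Tapes are two-way infinite. A machine halts when no transition applies.
\<close>

datatype move = Left | Stay | Right

record tm =
  tapes :: nat
  states :: nat
  symbols :: nat
  delta :: "nat \<Rightarrow> nat list \<Rightarrow> (nat \<times> (nat \<times> move) list) set"

definition reads :: "tm \<Rightarrow> nat list set" where
  "reads M = {ss. length ss = tapes M \<and> (\<forall>s\<in>set ss. s < symbols M)}"

definition turing_machine :: "tm \<Rightarrow> bool" where
  "turing_machine M \<longleftrightarrow> tapes M \<ge> 1 \<and> states M \<ge> 2 \<and> symbols M \<ge> 3 \<and>
     (\<forall>q<states M. \<forall>ss\<in>reads M. \<forall>(q', as)\<in>delta M q ss.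
        q' < states M \<and> length as = tapes M \<and> (\<forall>(s, m)\<in>set as. s < symbols M))"

definition deterministic :: "tm \<Rightarrow> bool" where
  "deterministic M \<longleftrightarrow>
     (\<forall>q<states M. \<forall>ss\<in>reads M. \<forall>a\<in>delta M q ss. \<forall>b\<in>delta M q ss. a = b)"

type_synonym tape = "(int \<Rightarrow> nat) \<times> int"
type_synonym config = "nat \<times> tape list"

fun offset :: "move \<Rightarrow> int" where
  "offset Left = - 1"
| "offset Stay = 0"
| "offset Right = 1"

definition read :: "tape \<Rightarrow> nat" where
  "read t = (fst t) (snd t)"

definition act :: "tape \<Rightarrow> nat \<times> move \<Rightarrow> tape" where
  "act t a = ((fst t)(snd t := fst a), snd t + offset (snd a))"

definition step :: "tm \<Rightarrow> config \<Rightarrow> config \<Rightarrow> bool" where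
  "step M C C' \<longleftrightarrow>
     (\<exists>(q', as)\<in>delta M (fst C) (map read (snd C)). C' = (q', map2 act (snd C) as))"

definition halted :: "tm \<Rightarrow> config \<Rightarrow> bool" where
  "halted M C \<longleftrightarrow> (\<nexists>C'. step M C C')"

definition contents :: "bool list \<Rightarrow> int \<Rightarrow> nat" where
  "contents w i =
     (if 0 \<le> i \<and> i < int (length w) then (if w ! nat i then 2 else 1) else 0)"

definition initial :: "tm \<Rightarrow> bool list \<Rightarrow> config" where
  "initial M x = (0, (contents x, 0) # replicate (tapes M - 1) (contents [], 0))"

text \<open>The output of a computation is the content of the last tape.\<close>

definition polytime :: "(bool list \<Rightarrow> bool list) \<Rightarrow> bool" where
  "polytime f \<longleftrightarrow> (\<exists>M p. turing_machine M \<and> deterministic M \<and>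
     (\<forall>x. \<exists>t C. t \<le> poly p (length x) \<and> (step M ^^ t) (initial M x) C \<and>
        halted M C \<and> fst (last (snd C)) = contents (f x)))"

definition NP :: "bool list set set" where
  "NP = {L. \<exists>M p. turing_machine M \<and>
     (\<forall>x t C. (step M ^^ t) (initial M x) C \<longrightarrow> t \<le> poly p (length x)) \<and>
     (\<forall>x. x \<in> L \<longleftrightarrow>
        (\<exists>t C. (step M ^^ t) (initial M x) C \<and> halted M C \<and> fst C = 1))}"

text \<open>
  NP-hardness, under polynomial-time many-one reductions, of the decision problem with yes-instances
  \<open>Y\<close> restricted to the instances in \<open>D\<close>; instances are presented to machines by means of \<open>enc\<close>.
\<close>

definition NP_hard :: "('i \<Rightarrow> bool list) \<Rightarrow> 'i set \<Rightarrow> 'i set \<Rightarrow> bool" where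
  "NP_hard enc D Y \<longleftrightarrow>
     (\<forall>L\<in>NP. \<exists>g. polytime (\<lambda>x. enc (g x)) \<and> (\<forall>x. g x \<in> D \<and> (x \<in> L \<longleftrightarrow> g x \<in> Y)))"


section \<open>Edge-colored graphs\<close>

text \<open>The list \<open>classes G\<close> consists of the color classes; its \<open>i\<close>-th entry is the set of edges of color \<open>i\<close>.\<close>

record 'a ecgraph =
  verts :: "'a set"
  classes :: "'a set set list"

definition edges :: "'a ecgraph \<Rightarrow> 'a set set" where
  "edges G = \<Union> (set (classes G))"

definition colored_graph :: "nat \<Rightarrow> 'a ecgraph \<Rightarrow> bool" where
  "colored_graph c G \<longleftrightarrow> finite (verts G) \<and>
     (\<forall>e\<in>edges G. e \<subseteq> verts G \<and> card e = 2) \<and>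
     length (classes G) = c \<and>
     (\<forall>i<c. classes G ! i \<noteq> {}) \<and>
     (\<forall>i<c. \<forall>j<c. i \<noteq> j \<longrightarrow> classes G ! i \<inter> classes G ! j = {})"

definition degree :: "'a ecgraph \<Rightarrow> 'a \<Rightarrow> nat" where
  "degree G v = card {e \<in> edges G. v \<in> e}"

definition max_degree :: "'a ecgraph \<Rightarrow> nat" where
  "max_degree G = Max (degree G ` verts G)"

definition delete_edges :: "'a ecgraph \<Rightarrow> 'a set set \<Rightarrow> 'a ecgraph" where
  "delete_edges G S = G\<lparr>classes := map (\<lambda>E. E - S) (classes G)\<rparr>"

definition induced_path :: "'a ecgraph \<Rightarrow> nat \<Rightarrow> 'a list \<Rightarrow> bool" where
  "induced_path G l vs \<longleftrightarrow> length vs = l \<and> distinct vs \<and> set vs \<subseteq> verts G \<and>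
     (\<forall>i j. i < j \<and> j < l \<longrightarrow> ({vs ! i, vs ! j} \<in> edges G \<longleftrightarrow> j = Suc i))"

definition path_edges :: "'a list \<Rightarrow> 'a set set" where
  "path_edges vs = {{vs ! i, vs ! Suc i} | i. Suc i < length vs}"

definition colors_of :: "'a ecgraph \<Rightarrow> 'a set set \<Rightarrow> nat set" where
  "colors_of G F = {i. i < length (classes G) \<and> classes G ! i \<inter> F \<noteq> {}}"

definition has_colored_induced_path :: "nat \<Rightarrow> nat \<Rightarrow> 'a ecgraph \<Rightarrow> bool" where
  "has_colored_induced_path c l G \<longleftrightarrow>
     (\<exists>vs. induced_path G l vs \<and> card (colors_of G (path_edges vs)) = c)"

definition deletable :: "nat \<Rightarrow> nat \<Rightarrow> 'a ecgraph \<Rightarrow> nat \<Rightarrow> bool" where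
  "deletable c l G k \<longleftrightarrow>
     (\<exists>S\<subseteq>edges G. card S \<le> k \<and> \<not> has_colored_induced_path c l (delete_edges G S))"


section \<open>Problem instances and their encoding as bit strings\<close>

text \<open>
  An instance consists of a list of the vertices, a list of the edges of each color, and the
  number \<open>k\<close>. Order, repetition and orientation in these lists are immaterial.
\<close>

type_synonym inst = "nat list \<times> (nat \<times> nat) list list \<times> nat"

definition inst_graph :: "inst \<Rightarrow> nat ecgraph" where
  "inst_graph = (\<lambda>(vs, ess, k).
     \<lparr>verts = set vs, classes = map (\<lambda>es. (\<lambda>(u, v). {u, v}) ` set es) ess\<rparr>)"

definition inst_bound :: "inst \<Rightarrow> nat" where
  "inst_bound = (\<lambda>(vs, ess, k). k)"

definition path_deletion_instances :: "nat \<Rightarrow> inst set" where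
  "path_deletion_instances c = {I. colored_graph c (inst_graph I)}"

definition colored_path_deletion :: "nat \<Rightarrow> nat \<Rightarrow> inst set" where
  "colored_path_deletion c l =
     {I \<in> path_deletion_instances c. deletable c l (inst_graph I) (inst_bound I)}"

text \<open>Binary representation, least significant bit first.\<close>

fun binary :: "nat \<Rightarrow> bool list" where
  "binary n = (if n = 0 then [] else odd n # binary (n div 2))"

declare binary.simps [simp del]

fun enc_list :: "('b \<Rightarrow> bool list) \<Rightarrow> 'b list \<Rightarrow> bool list" where
  "enc_list e [] = [False]"
| "enc_list e (x # xs) = True # e x @ enc_list e xs"

definition enc_nat :: "nat \<Rightarrow> bool list" where
  "enc_nat n = enc_list (\<lambda>b. [b]) (binary n)"

definition enc_edge :: "nat \<times> nat \<Rightarrow> bool list" where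
  "enc_edge = (\<lambda>(u, v). enc_nat u @ enc_nat v)"

definition enc_inst :: "inst \<Rightarrow> bool list" where
  "enc_inst = (\<lambda>(vs, ess, k).
     enc_list enc_nat vs @ enc_list (enc_list enc_edge) ess @ enc_nat k)"

definition prefix_free :: "('b \<Rightarrow> bool list) \<Rightarrow> bool" where
  "prefix_free e \<longleftrightarrow> (\<forall>x y r s. e x @ r = e y @ s \<longrightarrow> x = y \<and> r = s)"

lemma prefix_freeD: "prefix_free e \<Longrightarrow> e x @ r = e y @ s \<Longrightarrow> x = y \<and> r = s"
  unfolding prefix_free_def by blast

lemma prefix_free_enc_list:
  assumes "prefix_free e"
  shows "prefix_free (enc_list e)"
proof -
  have "xs = ys \<and> r = s" if "enc_list e xs @ r = enc_list e ys @ s" for xs ys r s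
    using that
  proof (induction xs arbitrary: ys)
    case Nil
    then show ?case by (cases ys) auto
  next
    case (Cons x xs)
    then obtain y ys' where ys: "ys = y # ys'"
      by (cases ys) auto
    with Cons.prems have "e x @ (enc_list e xs @ r) = e y @ (enc_list e ys' @ s)"
      by simp
    from prefix_freeD [OF assms this] Cons.IH [of ys'] ys show ?case by simp
  qed
  then show ?thesis unfolding prefix_free_def by blast
qed

lemma binary_inject: "binary m = binary n \<Longrightarrow> m = n"
proof (induction m arbitrary: n rule: less_induct)
  case (less m)
  show ?case
  proof (cases "m = 0 \<or> n = 0")
    case True
    with less.prems show ?thesis
      by (auto simp: binary.simps [of m] binary.simps [of n] split: if_splits)
  next
    case False
    with less.prems have *: "odd m = odd n" "binary (m div 2) = binary (n div 2)"
      by (simp_all add: binary.simps [of m] binary.simps [of n])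
    with False less.IH [of "m div 2" "n div 2"] have "m div 2 = n div 2" by simp
    with *(1) show ?thesis by presburger
  qed
qed

lemma prefix_free_enc_nat: "prefix_free enc_nat"
proof -
  have "prefix_free (\<lambda>b::bool. [b])" by (simp add: prefix_free_def)
  then have "prefix_free (enc_list (\<lambda>b::bool. [b]))" by (rule prefix_free_enc_list)
  then show ?thesis
    unfolding prefix_free_def enc_nat_def using binary_inject by metis
qed

lemma prefix_free_enc_edge: "prefix_free enc_edge"
  unfolding prefix_free_def enc_edge_def
  by (auto dest!: prefix_freeD [OF prefix_free_enc_nat])

lemma inj_enc_inst: "inj enc_inst"
proof (rule injI)
  fix I J assume "enc_inst I = enc_inst J"
  then show "I = J"
    using prefix_freeD [OF prefix_free_enc_nat, where r = "[]" and s = "[]"]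
    by (cases I; cases J)
      (auto simp: enc_inst_def
        dest!: prefix_freeD [OF prefix_free_enc_list [OF prefix_free_enc_nat]]
          prefix_freeD [OF prefix_free_enc_list [OF prefix_free_enc_list [OF prefix_free_enc_edge]]])
qed

end

theory Submission
  imports Defs "HOL-Library.Nat_Bijection"
begin

text \<open>
  Write the tableau of a nondeterministic machine in coordinates relative to the heads: the cell in row
  \<open>t\<close> and column \<open>c\<close> holds the symbols at offset \<open>c - N\<close> from all heads at time \<open>t\<close> together with the
  transition applied at time \<open>t\<close>. Then all tapes fit into one row and acceptance is a binary constraint
  problem between neighbouring cells over a constant domain. A pair of a cell and a value becomes a
  vertex, conflicting pairs become edges, and a solution is a small vertex cover. To bound the degree
  each such vertex is replaced by a path with an odd number of vertices on whose even positions the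
  conflict edges end: a cover is cheapest on a path if it uses only odd positions, which means that
  the value is selected.

  These paths are colored with three colors such that every edge has an end all of whose neighbours
  have the same color. A vertex \<open>u\<close> of the cover problem becomes a vertex with a pendant edge of the
  color of \<open>u\<close>, extended by a tail in the remaining \<open>l - 4\<close> colors, and an edge \<open>uv\<close> becomes an edge of
  the third color. The rainbow paths on \<open>l\<close> vertices then run from the end of the tail of \<open>u\<close> through \<open>v\<close>
  to the end of its pendant edge; for \<open>l = 4\<close> the coloring excludes rainbow paths of three connecting
  edges. Deleting the pendant edges of a cover is an optimal way to destroy all of them. A star with
  16 leaves in a single color sets the maximum degree.

  Vertex names are bit strings with unary coordinates, so that a machine with stacks as tapes prints
  the instance by nested loops over unary counters.
\<close>

section \<open>A stack language and its compilation to Turing machines\<close>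

text \<open>In relative coordinates all heads stay in the middle column, so a constant-size cell
  describes one column of all tapes although the heads move independently. The price is that a head
  movement shifts the whole row of its tape: every cell of a row must know the current transition,
  and the symbols of the next row come from the same column or from either neighbouring one. Border
  symbols of later rows are undetermined; a wrong one advances one column per row, so with
  \<open>N\<close> columns on each side the middle column stays correct up to row \<open>N\<close>.
  The coloring of the value paths is shaped by the case \<open>l = 4\<close>. For
  \<open>l \<ge> 5\<close> the last color occurs only at the ends of tails, so every rainbow path
  visits such an end; for \<open>l = 4\<close> three connecting edges could be rainbow by
  themselves. Since a connecting edge has the color missing at its ends, a vertex whose neighbours
  share one color has connecting edges of one color only, which excludes this. Apart from the star
  all degrees are far below 16; the star is added because hardness is shown for instances whose
  maximum degree is exactly 16.\<close>

datatype com =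
    Skip
  | Push nat bool
  | Pop nat
  | Out bool
  | Seq com com (infixr ";;" 60)
  | Cond nat "nat \<Rightarrow> bool" com com
  | While nat "nat \<Rightarrow> bool" com

definition sym :: "bool \<Rightarrow> nat" where
  "sym b = (if b then 2 else 1)"

fun top_sym :: "bool list \<Rightarrow> nat" where
  "top_sym [] = 0"
| "top_sym (b # bs) = sym b"

type_synonym state = "bool list list \<times> bool list"

text \<open>The step counts are exact for the compiled code: a push moves the head and then writes,
  and the first branch of a conditional ends with a jump over the second one.\<close>

inductive exec :: "com \<Rightarrow> state \<Rightarrow> nat \<Rightarrow> state \<Rightarrow> bool" where
  exec_Skip: "exec Skip s 0 s"
| exec_Push: "exec (Push r b) (s, out) 2 (s[r := b # s ! r], out)"
| exec_Pop: "exec (Pop r) (s, out) 1 (s[r := tl (s ! r)], out)"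
| exec_Out: "exec (Out b) (s, out) 1 (s, out @ [b])"
| exec_Seq: "exec c1 s t1 s' \<Longrightarrow> exec c2 s' t2 s'' \<Longrightarrow> exec (c1 ;; c2) s (t1 + t2) s''"
| exec_CondT: "P (top_sym (fst s ! r)) \<Longrightarrow> exec c1 s t s' \<Longrightarrow> exec (Cond r P c1 c2) s (t + 2) s'"
| exec_CondF: "\<not> P (top_sym (fst s ! r)) \<Longrightarrow> exec c2 s t s' \<Longrightarrow> exec (Cond r P c1 c2) s (t + 1) s'"
| exec_WhileT: "P (top_sym (fst s ! r)) \<Longrightarrow> exec c s t1 s' \<Longrightarrow> exec (While r P c) s' t2 s'' \<Longrightarrow>
     exec (While r P c) s (t1 + t2 + 2) s''"
| exec_WhileF: "\<not> P (top_sym (fst s ! r)) \<Longrightarrow> exec (While r P c) s 1 s"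

fun uses :: "nat \<Rightarrow> com \<Rightarrow> bool" where
  "uses n Skip = True"
| "uses n (Push r b) = (r < n)"
| "uses n (Pop r) = (r < n)"
| "uses n (Out b) = True"
| "uses n (c1 ;; c2) = (uses n c1 \<and> uses n c2)"
| "uses n (Cond r P c1 c2) = (r < n \<and> uses n c1 \<and> uses n c2)"
| "uses n (While r P c) = (r < n \<and> uses n c)"


subsection \<open>Compilation\<close>

text \<open>
  An instruction acts on a single tape: it maps the scanned symbol to the symbol to be written, a head
  movement and the next instruction address. Stacks grow to the left, so that the input tape is
  initially a stack with the head on its top; tape \<open>n\<close> is the output tape.
\<close>

type_synonym instr = "nat \<times> (nat \<Rightarrow> nat \<times> move \<times> nat)"

fun csize :: "com \<Rightarrow> nat" where
  "csize Skip = 0"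
| "csize (Push r b) = 2"
| "csize (Pop r) = 1"
| "csize (Out b) = 1"
| "csize (c1 ;; c2) = csize c1 + csize c2"
| "csize (Cond r P c1 c2) = csize c1 + csize c2 + 2"
| "csize (While r P c) = csize c + 2"

fun compile :: "nat \<Rightarrow> com \<Rightarrow> nat \<Rightarrow> instr list" where
  "compile n Skip p = []"
| "compile n (Push r b) p = [(r, \<lambda>s. (s, Left, p + 1)), (r, \<lambda>s. (sym b, Stay, p + 2))]"
| "compile n (Pop r) p = [(r, \<lambda>s. (0, Right, p + 1))]"
| "compile n (Out b) p = [(n, \<lambda>s. (sym b, Right, p + 1))]"
| "compile n (c1 ;; c2) p = compile n c1 p @ compile n c2 (p + csize c1)"
| "compile n (Cond r P c1 c2) p =
     (r, \<lambda>s. (s, Stay, if P s then p + 1 else p + csize c1 + 2)) # compile n c1 (p + 1) @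
     (r, \<lambda>s. (s, Stay, p + csize c1 + csize c2 + 2)) # compile n c2 (p + csize c1 + 2)"
| "compile n (While r P c) p =
     (r, \<lambda>s. (s, Stay, if P s then p + 1 else p + csize c + 2)) # compile n c (p + 1) @
     [(r, \<lambda>s. (s, Stay, p))]"

lemma length_compile [simp]: "length (compile n c p) = csize c"
  by (induction c arbitrary: p) auto

text \<open>Jumps stay inside the code or lead to the address right behind it; that address carries
  no instruction, so the machine halts there.\<close>

lemma compile_wf:
  "uses n c \<Longrightarrow> i < csize c \<Longrightarrow> s < 3 \<Longrightarrow> compile n c p ! i = (r, g) \<Longrightarrow>
     r \<le> n \<and> fst (g s) < 3 \<and> snd (snd (g s)) \<le> p + csize c"
proof (induction c arbitrary: p i)
  case (Seq c1 c2)
  show ?case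
  proof (cases "i < csize c1")
    case True
    with Seq.IH(1)[of i p] Seq.prems show ?thesis by (auto simp: nth_append)
  next
    case False
    with Seq.IH(2)[of "i - csize c1" "p + csize c1"] Seq.prems show ?thesis
      by (auto simp: nth_append add.assoc)
  qed
next
  case (Cond r P c1 c2)
  consider "i = 0" | "0 < i" "i \<le> csize c1" | "i = csize c1 + 1" | "i > csize c1 + 1" by linarith
  then show ?case
  proof cases
    case 2
    then obtain j where j: "i = Suc j" "j < csize c1" by (cases i) auto
    with Cond.IH(1)[of j "p + 1"] Cond.prems show ?thesis by (auto simp: nth_append)
  next
    case 4
    then have j: "i = Suc (csize c1 + Suc (i - csize c1 - 2))" by simp
    then obtain j where j: "i = Suc (csize c1 + Suc j)" by blast
    with Cond.IH(2)[of j "p + csize c1 + 2"] Cond.prems show ?thesis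
      by (auto simp: nth_append)
  qed (use Cond.prems in \<open>auto simp: nth_append nth_Cons'\<close>)
next
  case (While r P c)
  consider "i = 0" | "0 < i" "i \<le> csize c" | "i = csize c + 1" using While.prems by force
  then show ?case
  proof cases
    case 2
    then obtain j where j: "i = Suc j" "j < csize c" by (cases i) auto
    with While.IH[of j "p + 1"] While.prems show ?thesis by (auto simp: nth_append)
  qed (use While.prems in \<open>auto simp: nth_append nth_Cons'\<close>)
qed (auto simp: nth_Cons' sym_def split: if_splits)

text \<open>Instruction addresses serve as states. The two extra states provide the halting address
  behind the code and ensure the required minimum of two states.\<close>

definition machine :: "nat \<Rightarrow> instr list \<Rightarrow> tm" where
  "machine n code = \<lparr>tapes = n + 1, states = length code + 2, symbols = 3,
     delta = \<lambda>q ss. if q < length code then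
       {case code ! q of (r, g) \<Rightarrow> (case g (ss ! r) of (s, m, q') \<Rightarrow>
          (q', map (\<lambda>j. if j = r then (s, m) else (ss ! j, Stay)) [0..<n + 1]))} else {}\<rparr>"

lemma machine_wf:
  assumes "uses n c"
  shows "turing_machine (machine n (compile n c 0))" "deterministic (machine n (compile n c 0))"
proof -
  let ?M = "machine n (compile n c 0)"
  show "turing_machine ?M"
    unfolding turing_machine_def
  proof (intro conjI allI impI ballI)
    fix q ss assume q: "q < states ?M" and ss: "ss \<in> reads ?M"
    have len: "length ss = n + 1" and bd: "\<And>j. j \<le> n \<Longrightarrow> ss ! j < 3"
      using ss by (auto simp: reads_def machine_def)
    show "case tr of (q', as) \<Rightarrow> q' < states ?M \<and>
        length as = tapes ?M \<and>
        (\<forall>(s, m)\<in>set as. s < symbols ?M)"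
      if tr: "tr \<in> delta ?M q ss" for tr
    proof (cases "q < csize c")
      case True
      obtain r g where rg: "compile n c 0 ! q = (r, g)" by force
      obtain s m q' where g: "g (ss ! r) = (s, m, q')" by (metis prod_cases3)
      have r: "r \<le> n" using compile_wf[OF assms True, of 0] rg by fastforce
      have "s < 3 \<and> q' \<le> csize c" using compile_wf[OF assms True bd[OF r] rg] g by auto
      then show ?thesis using tr True rg g bd by (auto simp: machine_def)
    qed (use tr in \<open>auto simp: machine_def\<close>)
  qed (auto simp: machine_def)
  show "deterministic ?M"
    unfolding deterministic_def by (auto simp: machine_def)
qed

text \<open>Cells to the left of the head are left unconstrained, since a push overwrites the cell
  that it moves to.\<close>

definition rep_stack :: "tape \<Rightarrow> bool list \<Rightarrow> bool" where
  "rep_stack t w \<longleftrightarrow> (\<forall>i\<ge>0. fst t (snd t + i) = contents w i)"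

definition rep :: "nat \<Rightarrow> tape list \<Rightarrow> state \<Rightarrow> bool" where
  "rep n ts s \<longleftrightarrow> length ts = n + 1 \<and> length (fst s) = n \<and>
     (\<forall>j<n. rep_stack (ts ! j) (fst s ! j)) \<and> ts ! n = (contents (snd s), int (length (snd s)))"

lemma read_rep_stack: "rep_stack t w \<Longrightarrow> read t = top_sym w"
  by (cases w) (auto simp: rep_stack_def read_def contents_def sym_def dest: spec[of _ 0])

lemma rep_stack_pop:
  assumes "rep_stack t w"
  shows "rep_stack (act t (0, Right)) (tl w)"
  unfolding rep_stack_def
proof (intro allI impI)
  fix i :: int assume i: "0 \<le> i"
  have "fst t (snd t + (i + 1)) = contents w (i + 1)"
    using assms i unfolding rep_stack_def by auto
  moreover have "contents w (i + 1) = contents (tl w) i"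
    using i by (cases w) (auto simp: contents_def nat_add_distrib)
  ultimately show "fst (act t (0, Right)) (snd (act t (0, Right)) + i) = contents (tl w) i"
    using i by (simp add: act_def algebra_simps)
qed

lemma rep_stack_push:
  assumes "rep_stack t w" "s = read t"
  shows "rep_stack (act (act t (s, Left)) (sym b, Stay)) (b # w)"
  unfolding rep_stack_def
proof (intro allI impI)
  fix i :: int assume i: "0 \<le> i"
  show "fst (act (act t (s, Left)) (sym b, Stay)) (snd (act (act t (s, Left)) (sym b, Stay)) + i)
      = contents (b # w) i"
  proof (cases "i = 0")
    case True
    then show ?thesis by (simp add: act_def contents_def sym_def)
  next
    case False
    then have "fst t (snd t + (i - 1)) = contents w (i - 1)"
      using assms i unfolding rep_stack_def by auto
    moreover have "contents w (i - 1) = contents (b # w) i"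
      using i False by (auto simp: contents_def nth_Cons' nat_diff_distrib)
    ultimately show ?thesis
      using False assms(2) by (auto simp: act_def read_def algebra_simps)
  qed
qed

lemma contents_snoc: "(contents w)(int (length w) := sym b) = contents (w @ [b])"
  by (auto simp: contents_def fun_eq_iff nth_append sym_def)

lemma act_read [simp]: "act t (read t, Stay) = t"
  by (cases t) (simp add: act_def read_def)

section \<open>Simulation of programs by machines\<close>

lemma machine_step:
  assumes "p < length code" "code ! p = (r, g)" "g (read (ts ! r)) = (s, m, p')"
    "length ts = n + 1" "r \<le> n"
  shows "step (machine n code) (p, ts) (p', ts[r := act (ts ! r) (s, m)])"
proof -
  have "ts[r := act (ts ! r) (s, m)] =
      map2 act ts (map (\<lambda>j. if j = r then (s, m) else (map read ts ! j, Stay)) [0..<n + 1])"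
    using assms(4) by (intro nth_equalityI) (auto simp del: upt_Suc simp: nth_list_update)
  then show ?thesis
    using assms by (auto simp: step_def machine_def)
qed

lemma relpowp_1:
  fixes R :: "'a \<Rightarrow> 'a \<Rightarrow> bool"
  shows "R x y \<Longrightarrow> (R ^^ 1) x y"
  by (simp add: eq_OO)

lemma relpowp_2:
  fixes R :: "'a \<Rightarrow> 'a \<Rightarrow> bool"
  shows "R x y \<Longrightarrow> R y z \<Longrightarrow> (R ^^ 2) x z"
  by (auto simp: numeral_2_eq_2 eq_OO)

lemma relpowp_trans:
  fixes R :: "'a \<Rightarrow> 'a \<Rightarrow> bool"
  shows "(R ^^ m) x y \<Longrightarrow> (R ^^ n) y z \<Longrightarrow> (R ^^ (m + n)) x z"
  by (auto simp: relpowp_add)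

definition code_at :: "instr list \<Rightarrow> nat \<Rightarrow> instr list \<Rightarrow> bool" where
  "code_at code p xs \<longleftrightarrow> p + length xs \<le> length code \<and> (\<forall>i<length xs. code ! (p + i) = xs ! i)"

lemma code_at_append:
  "code_at code p (xs @ ys) \<longleftrightarrow> code_at code p xs \<and> code_at code (p + length xs) ys"
proof
  assume *: "code_at code p (xs @ ys)"
  have "code ! (p + length xs + i) = ys ! i" if "i < length ys" for i
    using * that unfolding code_at_def by (auto simp: nth_append dest!: spec[of _ "length xs + i"] simp: add.assoc)
  with * show "code_at code p xs \<and> code_at code (p + length xs) ys"
    unfolding code_at_def by (auto simp: nth_append)
next
  assume *: "code_at code p xs \<and> code_at code (p + length xs) ys"
  show "code_at code p (xs @ ys)"
    unfolding code_at_def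
  proof (intro conjI allI impI)
    fix i assume "i < length (xs @ ys)"
    then show "code ! (p + i) = (xs @ ys) ! i"
      using * unfolding code_at_def
      by (cases "i < length xs") (auto simp: nth_append dest!: spec[of _ "i - length xs"])
  qed (use * in \<open>auto simp: code_at_def\<close>)
qed

lemma code_at_Cons:
  "code_at code p (x # xs) \<longleftrightarrow> p < length code \<and> code ! p = x \<and> code_at code (Suc p) xs"
  using code_at_append[of code p "[x]" xs] by (auto simp: code_at_def)

abbreviation mstep :: "nat \<Rightarrow> instr list \<Rightarrow> config \<Rightarrow> config \<Rightarrow> bool" where
  "mstep n code \<equiv> step (machine n code)"

text \<open>Tests and jumps alike are instructions that write back the scanned symbol without
  moving; a constant \<open>f\<close> gives an unconditional jump.\<close>

lemma machine_test:
  assumes "p < length code" "code ! p = (r, \<lambda>s. (s, Stay, f s))" "rep n ts s" "r < n"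
  shows "mstep n code (p, ts) (f (top_sym (fst s ! r)), ts)"
proof -
  have "read (ts ! r) = top_sym (fst s ! r)"
    using assms(3,4) by (intro read_rep_stack) (auto simp: rep_def)
  moreover have "mstep n code (p, ts)
      (f (read (ts ! r)), ts[r := act (ts ! r) (read (ts ! r), Stay)])"
    by (rule machine_step[OF assms(1,2) refl]) (use assms(3,4) in \<open>auto simp: rep_def\<close>)
  ultimately show ?thesis by (metis act_read list_update_id)
qed

text \<open>Induction on the execution, for an arbitrary load address \<open>p\<close>. Because
  \<open>exec\<close> counts exactly the machine steps, the runs of the subprograms and the
  surrounding jumps compose without slack.\<close>

lemma exec_machine:
  "exec c s t s' \<Longrightarrow> uses n c \<Longrightarrow> code_at code p (compile n c p) \<Longrightarrow> rep n ts s \<Longrightarrow>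
     \<exists>ts'. (mstep n code ^^ t) (p, ts) (p + csize c, ts') \<and> rep n ts' s'"
proof (induction arbitrary: p ts rule: exec.induct)
  case (exec_Skip s)
  then show ?case by auto
next
  case (exec_Push r b s out)
  let ?s = "read (ts ! r)"
  let ?t = "act (ts ! r) (?s, Left)"
  let ?ts = "ts[r := ?t]"
  have code: "p < length code" "code ! p = (r, \<lambda>s. (s, Left, p + 1))"
    "p + 1 < length code" "code ! (p + 1) = (r, \<lambda>s. (sym b, Stay, p + 2))"
    using exec_Push by (auto simp: code_at_Cons)
  have len: "length ts = n + 1" "r < n" using exec_Push by (auto simp: rep_def)
  have "mstep n code (p, ts) (p + 1, ?ts)"
    by (rule machine_step[OF code(1,2)]) (use len in auto)
  moreover have "mstep n code (p + 1, ?ts) (p + 2, ?ts[r := act (?ts ! r) (sym b, Stay)])"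
    by (rule machine_step[OF code(3,4)]) (use len in auto)
  ultimately have "(mstep n code ^^ 2) (p, ts) (p + 2, ts[r := act ?t (sym b, Stay)])"
    using len by (auto dest: relpowp_2)
  moreover have "rep n (ts[r := act ?t (sym b, Stay)]) (s[r := b # s ! r], out)"
    using exec_Push len rep_stack_push[of "ts ! r" "s ! r" ?s b]
    by (auto simp: rep_def nth_list_update)
  ultimately show ?case by auto
next
  case (exec_Pop r s out)
  have len: "length ts = n + 1" "r < n" using exec_Pop by (auto simp: rep_def)
  have "mstep n code (p, ts) (p + 1, ts[r := act (ts ! r) (0, Right)])"
    by (rule machine_step) (use exec_Pop len in \<open>auto simp: code_at_Cons\<close>)
  moreover have "rep n (ts[r := act (ts ! r) (0, Right)]) (s[r := tl (s ! r)], out)"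
    using exec_Pop len rep_stack_pop[of "ts ! r" "s ! r"]
    by (auto simp: rep_def nth_list_update)
  ultimately show ?case by (intro exI conjI, simp only: csize.simps) (auto intro: relpowp_1)
next
  case (exec_Out b s out)
  have len: "length ts = n + 1" using exec_Out by (auto simp: rep_def)
  have "mstep n code (p, ts) (p + 1, ts[n := act (ts ! n) (sym b, Right)])"
    by (rule machine_step) (use exec_Out len in \<open>auto simp: code_at_Cons\<close>)
  moreover have "rep n (ts[n := act (ts ! n) (sym b, Right)]) (s, out @ [b])"
    using exec_Out len by (auto simp: rep_def nth_list_update act_def contents_snoc)
  ultimately show ?case by (intro exI conjI, simp only: csize.simps) (auto intro: relpowp_1)
next
  case (exec_Seq c1 s t1 s' c2 t2 s'')
  have "code_at code p (compile n c1 p)" "code_at code (p + csize c1) (compile n c2 (p + csize c1))"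
    using exec_Seq.prems by (auto simp: code_at_append)
  with exec_Seq obtain ts' ts'' where
    "(mstep n code ^^ t1) (p, ts) (p + csize c1, ts')" and "rep n ts' s'"
    "(mstep n code ^^ t2) (p + csize c1, ts') (p + csize c1 + csize c2, ts'')" "rep n ts'' s''"
    by (metis uses.simps(5))
  then show ?case by (auto intro: relpowp_trans simp: add.assoc)
next
  case (exec_CondT P s r c1 t s' c2)
  have *: "code_at code (p + 1) (compile n c1 (p + 1))" "p < length code"
    "code ! p = (r, \<lambda>s. (s, Stay, if P s then p + 1 else p + csize c1 + 2))"
    "p + 1 + csize c1 < length code"
    "code ! (p + 1 + csize c1) = (r, \<lambda>s. (s, Stay, p + csize c1 + csize c2 + 2))"
    "r < n" "uses n c1"
    using exec_CondT.prems by (auto simp: code_at_append code_at_Cons)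
  from exec_CondT.IH[OF *(7,1) exec_CondT.prems(3)] obtain ts' where
    ts': "(mstep n code ^^ t) (p + 1, ts) (p + 1 + csize c1, ts')" "rep n ts' s'"
    by auto
  have "mstep n code (p, ts) (p + 1, ts)"
    using machine_test[OF *(2,3) exec_CondT.prems(3) *(6)] exec_CondT.hyps by simp
  moreover have "mstep n code (p + 1 + csize c1, ts') (p + csize c1 + csize c2 + 2, ts')"
    using machine_test[OF *(4,5) ts'(2) *(6)] by simp
  ultimately have "(mstep n code ^^ (1 + t + 1)) (p, ts) (p + csize c1 + csize c2 + 2, ts')"
    using ts'(1) by (intro relpowp_trans[OF relpowp_trans] relpowp_1)
  with ts'(2) show ?case by (auto simp: add.assoc)
next
  case (exec_CondF P s r c2 t s' c1)
  have *: "code_at code (p + csize c1 + 2) (compile n c2 (p + csize c1 + 2))" "p < length code"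
    "code ! p = (r, \<lambda>s. (s, Stay, if P s then p + 1 else p + csize c1 + 2))"
    "r < n" "uses n c2"
    using exec_CondF.prems by (auto simp: code_at_append code_at_Cons)
  from exec_CondF.IH[OF *(5,1) exec_CondF.prems(3)] obtain ts' where
    ts': "(mstep n code ^^ t) (p + csize c1 + 2, ts) (p + csize c1 + 2 + csize c2, ts')" "rep n ts' s'"
    by auto
  have "mstep n code (p, ts) (p + csize c1 + 2, ts)"
    using machine_test[OF *(2,3) exec_CondF.prems(3) *(4)] exec_CondF.hyps by simp
  then have "(mstep n code ^^ (1 + t)) (p, ts) (p + csize c1 + 2 + csize c2, ts')"
    using ts'(1) by (intro relpowp_trans relpowp_1)
  with ts'(2) show ?case by (auto simp: add_ac)
next
  case (exec_WhileT P s r c t1 s' t2 s'')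
  have *: "code_at code (p + 1) (compile n c (p + 1))" "p < length code"
    "code ! p = (r, \<lambda>s. (s, Stay, if P s then p + 1 else p + csize c + 2))"
    "p + 1 + csize c < length code"
    "code ! (p + 1 + csize c) = (r, \<lambda>s. (s, Stay, p))"
    "r < n" "uses n c"
    using exec_WhileT.prems by (auto simp: code_at_append code_at_Cons)
  from exec_WhileT.IH(1)[OF *(7,1) exec_WhileT.prems(3)] obtain ts' where
    ts': "(mstep n code ^^ t1) (p + 1, ts) (p + 1 + csize c, ts')" "rep n ts' s'"
    by auto
  have "mstep n code (p, ts) (p + 1, ts)"
    using machine_test[OF *(2,3) exec_WhileT.prems(3) *(6)] exec_WhileT.hyps by simp
  moreover have "mstep n code (p + 1 + csize c, ts') (p, ts')"
    using machine_test[OF *(4,5) ts'(2) *(6)] by simp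
  ultimately have "(mstep n code ^^ (1 + t1 + 1)) (p, ts) (p, ts')"
    using ts'(1) by (intro relpowp_trans[OF relpowp_trans] relpowp_1)
  moreover from exec_WhileT.IH(2)[OF exec_WhileT.prems(1,2) ts'(2)] obtain ts'' where
    ts'': "(mstep n code ^^ t2) (p, ts') (p + csize (While r P c), ts'')" "rep n ts'' s''"
    by auto
  ultimately have "(mstep n code ^^ (1 + t1 + 1 + t2)) (p, ts) (p + csize (While r P c), ts'')"
    using relpowp_trans by metis
  moreover have "1 + t1 + 1 + t2 = t1 + t2 + 2" by simp
  ultimately show ?case using ts''(2) by metis
next
  case (exec_WhileF P s r c)
  have *: "p < length code" "code ! p = (r, \<lambda>s. (s, Stay, if P s then p + 1 else p + csize c + 2))" "r < n"
    using exec_WhileF.prems by (auto simp: code_at_append code_at_Cons)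
  have "mstep n code (p, ts) (p + csize c + 2, ts)"
    using machine_test[OF *(1,2) exec_WhileF.prems(3) *(3)] exec_WhileF.hyps by simp
  from relpowp_1[of "mstep n code", OF this] exec_WhileF.prems(3) show ?case
    by (intro exI[of _ ts]) (simp add: add.assoc del: relpowp.simps One_nat_def)
qed

text \<open>Upper bounds instead of exact times: branches and iterations of different length can
  then share one bound.\<close>

definition runs :: "com \<Rightarrow> state \<Rightarrow> nat \<Rightarrow> state \<Rightarrow> bool" where
  "runs c s t s' \<longleftrightarrow> (\<exists>t'\<le>t. exec c s t' s')"

theorem polytime_com:
  assumes "uses (Suc n) c"
    and "\<And>x. \<exists>t s'. t \<le> poly p (length x) \<and> runs c (x # replicate n [], []) t (s', f x)"
  shows "polytime f"
proof -
  let ?code = "compile (Suc n) c 0"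
  let ?M = "machine (Suc n) ?code"
  have "\<exists>t C. t \<le> poly p (length x) \<and> (step ?M ^^ t) (initial ?M x) C \<and>
        halted ?M C \<and> fst (last (snd C)) = contents (f x)" for x
  proof -
    from assms(2)[of x] obtain t s' where t: "t \<le> poly p (length x)" and
      ex: "exec c (x # replicate n [], []) t (s', f x)"
      unfolding runs_def by (meson le_trans)
    let ?ts = "(contents x, 0) # replicate (Suc n) (contents [], 0::int)"
    have rep0: "rep (Suc n) ?ts (x # replicate n [], [])"
      by (auto simp: rep_def rep_stack_def nth_Cons' nth_append simp del: replicate_Suc)
    have "code_at ?code 0 ?code" by (simp add: code_at_def)
    from exec_machine[OF ex assms(1) this rep0] obtain ts' where
      st: "(step ?M ^^ t) (0, ?ts) (csize c, ts')" and r: "rep (Suc n) ts' (s', f x)"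
      by auto
    have "initial ?M x = (0, ?ts)" by (simp add: initial_def machine_def)
    moreover have "halted ?M (csize c, ts')"
      by (auto simp: halted_def step_def machine_def)
    moreover have "fst (last ts') = contents (f x)"
    proof -
      have "length ts' = Suc (Suc n)" "ts' ! Suc n = (contents (f x), int (length (f x)))"
        using r by (auto simp: rep_def)
      then show ?thesis by (metis diff_Suc_1 fst_conv last_conv_nth length_0_conv nat.distinct(1))
    qed
    ultimately show ?thesis
      using t st by (intro exI[of _ t] exI[of _ "(csize c, ts')"]) auto
  qed
  with machine_wf[OF assms(1)] show ?thesis unfolding polytime_def by blast
qed


section \<open>Vertex cover as rainbow path deletion\<close>

text \<open>The degree 15 leaves room for the pendant edge. Surjectivity of \<open>\<chi>\<close>
  makes the first three color classes non-empty. \<open>mono\<close> says that one end of every edge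
  has neighbours of a single color. The star names need to avoid \<open>nm u r\<close> for
  \<open>u \<in> U\<close> only, so an index outside the range of \<open>U\<close> can supply
  them.\<close>

locale cover_graph =
  fixes U :: "'u set" and R :: "'u \<Rightarrow> 'u \<Rightarrow> bool" and \<chi> :: "'u \<Rightarrow> nat"
    and nm :: "'u \<Rightarrow> nat \<Rightarrow> nat" and st :: "nat \<Rightarrow> nat" and l :: nat
  assumes l: "l \<ge> 4"
    and fin_U: "finite U"
    and R_dom: "R u v \<Longrightarrow> u \<in> U \<and> v \<in> U"
    and R_sym: "R u v \<Longrightarrow> R v u"
    and \<chi>_less: "\<chi> u < 3"
    and \<chi>_proper: "R u v \<Longrightarrow> \<chi> u \<noteq> \<chi> v"
    and \<chi>_surj: "i < 3 \<Longrightarrow> \<exists>u\<in>U. \<chi> u = i"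
    and mono: "R u v \<Longrightarrow> (\<forall>w. R u w \<longrightarrow> \<chi> w = \<chi> v) \<or> (\<forall>w. R v w \<longrightarrow> \<chi> w = \<chi> u)"
    and deg: "card {v. R u v} \<le> 15"
    and nm_inj: "nm u r = nm v s \<longleftrightarrow> u = v \<and> r = s"
    and st_inj: "st i = st j \<longleftrightarrow> i = j"
    and st_nm: "u \<in> U \<Longrightarrow> st i \<noteq> nm u r"
begin

text \<open>
  \<open>nm u 0\<close> represents \<open>u\<close>, and \<open>nm u 1, nm u 2, \<dots>\<close> are the vertices of its pendant edge and tail;
  \<open>st 0\<close> is the center of the star. The third of three colors \<open>0, 1, 2\<close> is 3 minus the other two.
\<close>

definition scol :: "'u \<Rightarrow> nat \<Rightarrow> nat" where
  "scol u r = (if r = 0 then \<chi> u else r + 2)"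

definition cls :: "nat \<Rightarrow> nat set set" where
  "cls i = {{nm u r, nm u (Suc r)} | u r. u \<in> U \<and> r < l - 3 \<and> scol u r = i} \<union>
     {{nm u 0, nm v 0} | u v. R u v \<and> 3 - (\<chi> u + \<chi> v) = i} \<union>
     {{st 0, st (Suc j)} | j. i = 0 \<and> j < 16}"

definition graph :: "nat ecgraph" where
  "graph = \<lparr>verts = {nm u r | u r. u \<in> U \<and> r < l - 2} \<union> st ` {..16}, classes = map cls [0..<l - 1]\<rparr>"

section \<open>Well-formedness and degrees of the colored graph\<close>

lemma cls_cases:
  assumes "{x, y} \<in> cls i"
  obtains (spine) u r where "u \<in> U" "r < l - 3" "scol u r = i" "x = nm u r" "y = nm u (Suc r)"
  | (spine') u r where "u \<in> U" "r < l - 3" "scol u r = i" "y = nm u r" "x = nm u (Suc r)"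
  | (conn) u v where "R u v" "3 - (\<chi> u + \<chi> v) = i" "x = nm u 0" "y = nm v 0"
  | (star) j where "i = 0" "j < 16" "x = st 0" "y = st (Suc j)"
  | (star') j where "i = 0" "j < 16" "y = st 0" "x = st (Suc j)"
proof -
  from assms consider
    (1) u r where "u \<in> U" "r < l - 3" "scol u r = i" "{x, y} = {nm u r, nm u (Suc r)}"
  | (2) u v where "R u v" "3 - (\<chi> u + \<chi> v) = i" "{x, y} = {nm u 0, nm v 0}"
  | (3) j where "i = 0" "j < 16" "{x, y} = {st 0, st (Suc j)}"
    unfolding cls_def by blast
  then show thesis
  proof cases
    case 1
    then show ?thesis using that(1,2) by (auto simp: doubleton_eq_iff)
  next
    case 2
    have "3 - (\<chi> v + \<chi> u) = i" using 2(2) by (simp add: add.commute)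
    then show ?thesis using that(3) 2 R_sym[OF 2(1)] by (auto simp: doubleton_eq_iff)
  next
    case 3
    then show ?thesis using that(4,5) by (auto simp: doubleton_eq_iff)
  qed
qed

lemma cls_member:
  assumes "e \<in> cls i"
  obtains x y where "e = {x, y}" "x \<noteq> y"
proof -
  from assms consider
    (1) u r where "e = {nm u r, nm u (Suc r)}"
  | (2) u v where "R u v" "e = {nm u 0, nm v 0}"
  | (3) j where "e = {st 0, st (Suc j)}"
    unfolding cls_def by blast
  then show thesis
    by cases (use that \<chi>_proper in \<open>force simp: nm_inj st_inj\<close>)+
qed

lemma st_nm': "u \<in> U \<Longrightarrow> nm u r \<noteq> st i"
  using st_nm by metis

lemma spine_in_cls: "u \<in> U \<Longrightarrow> r < l - 3 \<Longrightarrow> scol u r = i \<Longrightarrow> {nm u r, nm u (Suc r)} \<in> cls i"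
  unfolding cls_def by blast

lemma conn_in_cls: "R u v \<Longrightarrow> 3 - (\<chi> u + \<chi> v) = i \<Longrightarrow> {nm u 0, nm v 0} \<in> cls i"
  unfolding cls_def by blast

lemma cls_unique:
  assumes "e \<in> cls i" "e \<in> cls j"
  shows "i = j"
proof -
  from assms(1) obtain x y where e: "e = {x, y}" by (rule cls_member)
  from assms(1)[unfolded e] show ?thesis
    by (cases rule: cls_cases; use assms(2)[unfolded e] in \<open>cases rule: cls_cases\<close>)
      (auto simp: nm_inj st_nm st_nm' dest: R_dom)
qed

lemma third_less: "3 - (\<chi> u + \<chi> v) < 3" if "R u v"
  using \<chi>_proper[OF that] by auto

lemma cls_less: "e \<in> cls i \<Longrightarrow> i < l - 1"
proof -
  assume *: "e \<in> cls i"
  then obtain x y where e: "e = {x, y}" by (rule cls_member)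
  have "\<chi> u < l - 1" for u using \<chi>_less[of u] l by linarith
  moreover have "3 - (\<chi> u + \<chi> v) < l - 1" if "R u v" for u v using third_less[OF that] l by linarith
  note bounds = calculation this
  from *[unfolded e] show ?thesis
    by (cases rule: cls_cases) (use l bounds in \<open>auto simp: scol_def split: if_splits\<close>)
qed

lemma edges_graph: "edges graph = (\<Union>i. cls i)"
  using cls_less by (fastforce simp: edges_def graph_def)

lemma nth_delete: "i < l - 1 \<Longrightarrow> classes (delete_edges graph S) ! i = cls i - S"
  by (simp add: delete_edges_def graph_def)

lemma length_delete: "length (classes (delete_edges graph S)) = l - 1"
  by (simp add: delete_edges_def graph_def)

lemma edges_delete: "edges (delete_edges graph S) = edges graph - S"
  by (auto simp: delete_edges_def edges_def)

lemma verts_delete: "verts (delete_edges graph S) = verts graph"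
  by (simp add: delete_edges_def)

lemma finite_verts: "finite (verts graph)"
proof -
  have "{nm u r | u r. u \<in> U \<and> r < l - 2} = (\<lambda>(u, r). nm u r) ` (U \<times> {..<l - 2})" by auto
  then show ?thesis by (simp add: graph_def fin_U)
qed

lemma nm_in_verts: "u \<in> U \<Longrightarrow> r < l - 2 \<Longrightarrow> nm u r \<in> verts graph"
  by (auto simp: graph_def)

lemma st_in_verts: "i \<le> 16 \<Longrightarrow> st i \<in> verts graph"
  by (auto simp: graph_def)

lemma edge_in_verts:
  assumes "{x, y} \<in> cls i"
  shows "x \<in> verts graph \<and> y \<in> verts graph"
  using assms by (cases rule: cls_cases) (use l in \<open>auto dest: R_dom intro!: nm_in_verts st_in_verts\<close>)

lemma colored: "colored_graph (l - 1) graph"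
  unfolding colored_graph_def
proof (intro conjI allI impI ballI)
  fix e assume "e \<in> edges graph"
  then obtain i where i: "e \<in> cls i" by (auto simp: edges_graph)
  then obtain x y where e: "e = {x, y}" "x \<noteq> y" by (rule cls_member)
  show "e \<subseteq> verts graph" using edge_in_verts i e by auto
  show "card e = 2" using e by simp
next
  fix i assume i: "i < l - 1"
  show "classes graph ! i \<noteq> {}"
  proof (cases "i < 3")
    case True
    then obtain u where "u \<in> U" "\<chi> u = i" using \<chi>_surj by blast
    then have "{nm u 0, nm u (Suc 0)} \<in> cls i" using l by (intro spine_in_cls) (auto simp: scol_def)
    then show ?thesis using i by (auto simp: graph_def)
  next
    case False
    obtain u where "u \<in> U" using \<chi>_surj[of 0] by auto
    then have "{nm u (i - 2), nm u (Suc (i - 2))} \<in> cls i"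
      using i False by (intro spine_in_cls) (auto simp: scol_def)
    then show ?thesis using i by (auto simp: graph_def)
  qed
next
  fix i j assume "i < l - 1" "j < l - 1" "i \<noteq> j"
  then show "classes graph ! i \<inter> classes graph ! j = {}"
    using cls_unique by (auto simp: graph_def)
qed (simp_all add: finite_verts, simp add: graph_def)

lemma finite_edges: "finite (edges graph)"
proof (rule finite_subset)
  show "edges graph \<subseteq> Pow (verts graph)" using colored by (auto simp: colored_graph_def)
qed (simp add: finite_verts)

lemma finite_R: "finite {v. R u v}"
  by (rule finite_subset[OF _ fin_U]) (auto dest: R_dom)

text \<open>At \<open>nm u 0\<close> only the pendant edge joins the connecting edges, whence 15 +
  1; the other vertices of a tail lie on at most two edges.\<close>

lemma degree_nm:
  assumes "u \<in> U"
  shows "degree graph (nm u r) \<le> 16"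
proof (cases "r = 0")
  case True
  let ?F = "insert {nm u 0, nm u 1} ((\<lambda>v. {nm u 0, nm v 0}) ` {v. R u v})"
  have "{e \<in> edges graph. nm u r \<in> e} \<subseteq> ?F"
  proof
    fix e assume *: "e \<in> {e \<in> edges graph. nm u r \<in> e}"
    then obtain i where i: "e \<in> cls i" by (auto simp: edges_graph)
    then obtain x y where e: "e = {x, y}" by (rule cls_member)
    from i[unfolded e] show "e \<in> ?F"
      by (cases rule: cls_cases)
        (use * e True assms in \<open>auto simp: nm_inj st_nm st_nm' insert_commute dest: R_sym\<close>)
  qed
  moreover have "finite ?F" using finite_R by auto
  ultimately have "degree graph (nm u r) \<le> card ?F" unfolding degree_def by (rule card_mono[rotated])
  also have "\<dots> \<le> Suc (card ((\<lambda>v. {nm u 0, nm v 0}) ` {v. R u v}))" by (rule card_insert_le_m1) auto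
  also have "\<dots> \<le> Suc (card {v. R u v})" using card_image_le[OF finite_R] by auto
  finally show ?thesis using deg[of u] by linarith
next
  case False
  let ?F = "{{nm u r, nm u (Suc r)}, {nm u (r - 1), nm u r}}"
  have "{e \<in> edges graph. nm u r \<in> e} \<subseteq> ?F"
  proof
    fix e assume *: "e \<in> {e \<in> edges graph. nm u r \<in> e}"
    then obtain i where i: "e \<in> cls i" by (auto simp: edges_graph)
    then obtain x y where e: "e = {x, y}" by (rule cls_member)
    from i[unfolded e] show "e \<in> ?F"
      by (cases rule: cls_cases)
        (use * e False assms in \<open>auto simp: nm_inj st_nm st_nm' insert_commute\<close>)
  qed
  then have "degree graph (nm u r) \<le> card ?F" unfolding degree_def by (intro card_mono) auto
  also have "\<dots> \<le> 2" by (simp add: card_insert_if)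
  finally show ?thesis by simp
qed

lemma star_in_cls: "j < 16 \<Longrightarrow> {st 0, st (Suc j)} \<in> cls 0"
  unfolding cls_def by blast

lemma degree_st0: "degree graph (st 0) = 16"
proof -
  have "{e \<in> edges graph. st 0 \<in> e} = (\<lambda>j. {st 0, st (Suc j)}) ` {..<16}"
  proof (intro equalityI subsetI)
    fix e assume *: "e \<in> {e \<in> edges graph. st 0 \<in> e}"
    then obtain i where i: "e \<in> cls i" by (auto simp: edges_graph)
    then obtain x y where e: "e = {x, y}" by (rule cls_member)
    from i[unfolded e] show "e \<in> (\<lambda>j. {st 0, st (Suc j)}) ` {..<16}"
      by (cases rule: cls_cases)
        (use * e in \<open>auto simp: st_inj st_nm st_nm' insert_commute dest: R_dom\<close>)
  next
    fix e assume "e \<in> (\<lambda>j. {st 0, st (Suc j)}) ` {..<16}"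
    then show "e \<in> {e \<in> edges graph. st 0 \<in> e}" using star_in_cls by (auto simp: edges_graph)
  qed
  moreover have "inj_on (\<lambda>j. {st 0, st (Suc j)}) {..<16}"
    by (auto simp: inj_on_def doubleton_eq_iff st_inj)
  ultimately show ?thesis by (simp add: degree_def card_image)
qed

lemma degree_st:
  assumes "i \<le> 16"
  shows "degree graph (st i) \<le> 16"
proof (cases i)
  case (Suc k)
  have "{e \<in> edges graph. st i \<in> e} \<subseteq> {{st 0, st i}}"
  proof
    fix e assume *: "e \<in> {e \<in> edges graph. st i \<in> e}"
    then obtain j where i: "e \<in> cls j" by (auto simp: edges_graph)
    then obtain x y where e: "e = {x, y}" by (rule cls_member)
    from i[unfolded e] show "e \<in> {{st 0, st i}}"
      by (cases rule: cls_cases)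
        (use * e Suc in \<open>auto simp: st_inj st_nm st_nm' insert_commute dest: R_dom\<close>)
  qed
  then have "degree graph (st i) \<le> card {{st 0, st i}}" unfolding degree_def by (intro card_mono) auto
  then show ?thesis by simp
qed (simp add: degree_st0)

lemma max_degree_graph: "max_degree graph = 16"
  unfolding max_degree_def
proof (rule Max_eqI)
  show "16 \<in> degree graph ` verts graph"
    using degree_st0 by (auto simp: graph_def intro!: image_eqI[of _ _ "st 0"])
  show "y \<le> 16" if "y \<in> degree graph ` verts graph" for y
    using that degree_nm degree_st by (auto simp: graph_def)
qed (simp add: finite_verts)


subsection \<open>From covers to deletion sets\<close>

text \<open>Inducedness is dropped: a cover destroys every rainbow path on \<open>l\<close>
  vertices, induced or not, and arbitrary paths are easier to follow edge by edge.\<close>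

definition rainbow :: "nat set set \<Rightarrow> nat list \<Rightarrow> (nat \<Rightarrow> nat) \<Rightarrow> bool" where
  "rainbow S vs col \<longleftrightarrow> length vs = l \<and> distinct vs \<and>
     (\<forall>i<l - 1. {vs ! i, vs ! Suc i} \<in> cls (col i) \<and> {vs ! i, vs ! Suc i} \<notin> S) \<and>
     inj_on col {..<l - 1}"

text \<open>The path has only \<open>l - 1\<close> edges, so \<open>l - 1\<close> colors force all
  of its edges to have different colors.\<close>

lemma rainbow_if_path:
  assumes "has_colored_induced_path (l - 1) l (delete_edges graph S)"
  obtains vs col where "rainbow S vs col"
proof -
  let ?H = "delete_edges graph S"
  from assms obtain vs where vs: "induced_path ?H l vs" and
    card: "card (colors_of ?H (path_edges vs)) = l - 1"
    unfolding has_colored_induced_path_def by blast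
  have "\<exists>k. {vs ! i, vs ! Suc i} \<in> cls k - S" if "i < l - 1" for i
  proof -
    have "Suc i < l" "i < Suc i" using that by auto
    then have "{vs ! i, vs ! Suc i} \<in> edges ?H" using vs unfolding induced_path_def by blast
    then show ?thesis unfolding edges_delete edges_graph by blast
  qed
  then obtain col where col: "\<And>i. i < l - 1 \<Longrightarrow> {vs ! i, vs ! Suc i} \<in> cls (col i) - S" by metis
  have len: "length vs = l" using vs by (simp add: induced_path_def)
  have "colors_of ?H (path_edges vs) \<subseteq> col ` {..<l - 1}"
  proof
    fix k assume "k \<in> colors_of ?H (path_edges vs)"
    then obtain e where e: "k < l - 1" "e \<in> cls k" "e \<in> path_edges vs"
      unfolding colors_of_def using nth_delete length_delete by fastforce
    then obtain i where i: "e = {vs ! i, vs ! Suc i}" "i < l - 1"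
      unfolding path_edges_def len by auto
    with e col[OF i(2)] have "k = col i" using cls_unique by blast
    with i(2) show "k \<in> col ` {..<l - 1}" by blast
  qed
  then have "l - 1 \<le> card (col ` {..<l - 1})" unfolding card[symmetric] by (intro card_mono) auto
  then have "card (col ` {..<l - 1}) = card {..<l - 1}"
    using card_image_le[of "{..<l - 1}" col] by simp
  then have "inj_on col {..<l - 1}" by (intro eq_card_imp_inj_on) auto
  with col len vs have "rainbow S vs col" by (auto simp: rainbow_def induced_path_def)
  then show thesis by (rule that)
qed

text \<open>Allows the end of a tail, once it is known to be an end of the path, to be taken as its
  first vertex.\<close>

lemma rainbow_rev:
  assumes "rainbow S vs col"
  shows "rainbow S (rev vs) (\<lambda>i. col (l - 2 - i))"
proof -
  have len: "length vs = l" using assms by (simp add: rainbow_def)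
  have "{rev vs ! i, rev vs ! Suc i} = {vs ! (l - 2 - i), vs ! Suc (l - 2 - i)}" if "i < l - 1" for i
  proof -
    have i: "l - Suc i = Suc (l - 2 - i)" "l - Suc (Suc i) = l - 2 - i" using that by auto
    have "rev vs ! i = vs ! (l - Suc i)" "rev vs ! Suc i = vs ! (l - Suc (Suc i))"
      using that by (simp_all add: rev_nth len)
    then show ?thesis unfolding i by (simp only: insert_commute)
  qed
  moreover have "inj_on (\<lambda>i. col (l - 2 - i)) {..<l - 1}"
  proof (rule inj_onI)
    fix i j assume *: "i \<in> {..<l - 1}" "j \<in> {..<l - 1}" "col (l - 2 - i) = col (l - 2 - j)"
    have "inj_on col {..<l - 1}" using assms by (simp add: rainbow_def)
    then have "l - 2 - i = l - 2 - j" by (rule inj_onD) (use * in auto)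
    with * show "i = j" by auto
  qed
  ultimately show ?thesis using assms unfolding rainbow_def by auto
qed

lemma tip_neighbour: "{x, nm u (l - 3)} \<in> cls k \<Longrightarrow> u \<in> U \<Longrightarrow> x = nm u (l - 4)"
  by (cases rule: cls_cases) (use l R_dom st_nm st_nm' in \<open>auto simp: nm_inj\<close>)

text \<open>The last vertex of a tail has a single neighbour, whereas an inner vertex of a path
  needs two.\<close>

lemma rainbow_tip:
  assumes "rainbow S vs col" "i < l" "vs ! i = nm u (l - 3)" "u \<in> U"
  shows "i = 0 \<or> i = l - 1"
proof (rule ccontr)
  assume "\<not> ?thesis"
  then obtain j where j: "i = Suc j" "Suc i < l" using assms(2) by (cases i) auto
  have *: "\<And>i. i < l - 1 \<Longrightarrow> {vs ! i, vs ! Suc i} \<in> cls (col i)" and d: "distinct vs" "length vs = l"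
    using assms(1) by (auto simp: rainbow_def)
  have "{vs ! j, nm u (l - 3)} \<in> cls (col j)" using *[of j] assms(3) j by auto
  then have "vs ! j = nm u (l - 4)" using assms(4) by (rule tip_neighbour)
  moreover have "{vs ! Suc i, nm u (l - 3)} \<in> cls (col i)"
    using *[of i] assms(3) j by (auto simp: insert_commute)
  then have "vs ! Suc i = nm u (l - 4)" using assms(4) by (rule tip_neighbour)
  ultimately have "vs ! j = vs ! Suc i" by simp
  then show False using nth_eq_iff_index_eq[OF d(1), of j "Suc i"] d j by auto
qed

lemma rainbow_has_tip:
  assumes "rainbow S vs col"
  obtains u i where "u \<in> U" "i < l" "vs ! i = nm u (l - 3)"
proof -
  have e: "\<And>i. i < l - 1 \<Longrightarrow> {vs ! i, vs ! Suc i} \<in> cls (col i)" and d: "distinct vs" "length vs = l"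
    and inj: "inj_on col {..<l - 1}"
    using assms by (auto simp: rainbow_def)
  show thesis
  proof (cases "l = 4")
    case False
    \<comment> \<open>Every color occurs on the path; for \<open>l \<ge> 5\<close> the color
      \<open>l - 2\<close> belongs only to the last edges of tails.\<close>
    have "col ` {..<l - 1} = {..<l - 1}"
      by (rule card_subset_eq) (use e cls_less inj in \<open>auto simp: card_image\<close>)
    moreover have "l - 2 \<in> {..<l - 1}" using l by auto
    ultimately obtain i where i: "i < l - 1" "col i = l - 2" by (metis imageE lessThan_iff)
    have "3 - (\<chi> u + \<chi> v) \<noteq> l - 2" if "R u v" for u v using third_less[OF that] l False by linarith
    moreover have "\<chi> u \<noteq> l - 2" for u using \<chi>_less[of u] l False by linarith
    note bounds = calculation this
    from e[OF i(1), unfolded i(2)] have "\<exists>u\<in>U. vs ! i = nm u (l - 3) \<or> vs ! Suc i = nm u (l - 3)"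
      by (cases rule: cls_cases) (use l False bounds in \<open>auto simp: scol_def nm_inj split: if_splits\<close>)
    then obtain u where u: "u \<in> U" "vs ! i = nm u (l - 3) \<or> vs ! Suc i = nm u (l - 3)" by blast
    have "i < l" "Suc i < l" using i(1) by auto
    then show ?thesis using that u by blast
  next
    case True
    have c: "col 0 \<noteq> col 1" "col 1 \<noteq> col 2" using inj_onD[OF inj, of 0 1] inj_onD[OF inj, of 1 2] True by auto
    have e0: "{vs ! 0, vs ! 1} \<in> cls (col 0)" and e1: "{vs ! 1, vs ! 2} \<in> cls (col 1)"
      and e2: "{vs ! 2, vs ! 3} \<in> cls (col 2)"
      using e[of 0] e[of 1] e[of 2] True by (simp_all add: numeral_2_eq_2 numeral_3_eq_3)
    note tip = that[unfolded True]
    \<comment> \<open>For \<open>l = 4\<close> the pendant edges end in the sought vertices, so only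
      paths of three connecting edges and paths with a star edge in the middle have to be
      excluded.\<close>
    from e1 show ?thesis
    proof (cases rule: cls_cases)
      case (conn u v)
      from e0 show ?thesis
      proof (cases rule: cls_cases)
        case (spine' u' r')
        then show ?thesis using tip[of u' 0] True by auto
      next
        case 0: (conn w u')
        from e2 show ?thesis
        proof (cases rule: cls_cases)
          case (spine v' r')
          then show ?thesis using tip[of v' 3] True by auto
        next
          case 2: (conn v' z)
          have "u' = u" "v' = v" using conn 0 2 by (auto simp: nm_inj)
          \<comment> \<open>An end of the middle edge with neighbours of one color gives the
            adjacent outer edge the same missing color as the middle edge.\<close>
          then have "\<chi> w = \<chi> v \<or> \<chi> z = \<chi> u"
            using mono[OF conn(1)] 0(1) 2(1) R_sym by blast
          then have False
            using c conn(2) 0(2) 2(2) \<open>u' = u\<close> \<open>v' = v\<close> by (auto simp: add.commute)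
          then show ?thesis ..
        qed (use conn R_dom st_nm st_nm' in \<open>auto simp: nm_inj\<close>)
      qed (use conn R_dom st_nm st_nm' in \<open>auto simp: nm_inj\<close>)
    next
      case (spine u r)
      then show ?thesis using tip[of u 2] True by auto
    next
      case (spine' u r)
      then show ?thesis using tip[of u 1] True by auto
    next
      case (star j)
      from e0 have "col 0 = 0"
        by (cases rule: cls_cases) (use star R_dom st_nm st_nm' in \<open>auto simp: nm_inj\<close>)
      with star c show ?thesis by simp
    next
      case (star' j)
      from e0 have "col 0 = 0"
        by (cases rule: cls_cases) (use star' R_dom st_nm st_nm' in \<open>auto simp: nm_inj\<close>)
      with star' c show ?thesis by simp
    qed
  qed
qed

definition pendant :: "'u \<Rightarrow> nat set" where
  "pendant u = {nm u 0, nm u 1}"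

text \<open>Unable to turn back, the path descends the tail to \<open>nm u 0\<close> and uses the
  pendant edge of \<open>u\<close>, so \<open>u \<notin> C\<close>. Its next step leads to some
  \<open>w\<close>, which therefore lies in \<open>C\<close>; with the pendant edge of
  \<open>w\<close> deleted, the last edge joins \<open>w\<close> to some \<open>z\<close>. The color
  missing at \<open>w\<close> and \<open>z\<close> is not \<open>\<chi> w\<close>, so it is
  \<open>\<chi> u\<close> or the color missing at \<open>u\<close> and \<open>w\<close>, and both
  have been used.\<close>

lemma no_rainbow_from_tip:
  assumes C: "\<And>u v. R u v \<Longrightarrow> u \<in> C \<or> v \<in> C"
    and rb: "rainbow (pendant ` C) vs col" and u: "u \<in> U" "vs ! 0 = nm u (l - 3)"
  shows False
proof -
  have e: "\<And>i. i < l - 1 \<Longrightarrow> {vs ! i, vs ! Suc i} \<in> cls (col i)"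
    and ns: "\<And>i. i < l - 1 \<Longrightarrow> {vs ! i, vs ! Suc i} \<notin> pendant ` C"
    and d: "distinct vs" "length vs = l"
    and inj: "inj_on col {..<l - 1}"
    using rb by (auto simp: rainbow_def)
  have neq: "vs ! i \<noteq> vs ! j" if "i < l" "j < l" "i \<noteq> j" for i j
    using nth_eq_iff_index_eq[OF d(1)] that d(2) by auto
  have walk: "i \<le> l - 3 \<Longrightarrow> vs ! i = nm u (l - 3 - i)" for i
  proof (induction i rule: less_induct)
    case (less i)
    show ?case
    proof (cases i)
      case (Suc j)
      have j: "vs ! j = nm u (l - 3 - j)" using less Suc by auto
      have "j < l - 1" using less Suc by auto
      from e[OF this] show ?thesis
      proof (cases rule: cls_cases)
        case (spine u' r)
        then have r: "r = l - 3 - j" "u' = u" using j by (auto simp: nm_inj)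
        with spine have "j \<noteq> 0" by auto
        then obtain k where k: "j = Suc k" by (cases j) auto
        have "vs ! k = nm u (l - 3 - k)" using less Suc k by auto
        moreover have "Suc r = l - 3 - k" using r k less.prems Suc by arith
        ultimately have "vs ! k = vs ! Suc j" using spine(5) r by simp
        moreover have "Suc j < l" "k < l" "k \<noteq> Suc j" using less.prems Suc k l by linarith+
        ultimately show ?thesis using neq[of k "Suc j"] by blast
      next
        case (spine' u' r)
        then have r: "Suc r = l - 3 - j" "u' = u" using j by (auto simp: nm_inj)
        then have "r = l - 3 - i" using Suc by arith
        then show ?thesis using spine'(4) r(2) Suc by simp
      next
        case (conn u' v')
        then show ?thesis using j less.prems Suc by (auto simp: nm_inj)
      qed (use j u st_nm st_nm' in auto)
    qed (use u in simp)
  qed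
  define m where "m = l - 4"
  have m: "l = m + 4" using l m_def by simp
  have w1: "vs ! m = nm u 1" and w0: "vs ! (m + 1) = nm u 0"
    using walk[of m] walk[of "m + 1"] m by auto
  have "{vs ! m, vs ! (m + 1)} \<in> cls (col m)" using e[of m] m by simp
  then have c0: "col m = \<chi> u"
    by (cases rule: cls_cases) (use w1 w0 u st_nm st_nm' in \<open>auto simp: nm_inj scol_def\<close>)
  have uC: "u \<notin> C" using ns[of m] w1 w0 m by (auto simp: pendant_def insert_commute)
  have "{vs ! (m + 1), vs ! (m + 2)} \<in> cls (col (m + 1))" using e[of "m + 1"] m by simp
  then obtain w where w: "vs ! (m + 2) = nm w 0" "R u w" and c1: "col (m + 1) = 3 - (\<chi> u + \<chi> w)"
  proof (cases rule: cls_cases)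
    case (spine u' r)
    then have "vs ! (m + 2) = vs ! m" using w0 w1 by (auto simp: nm_inj)
    then show ?thesis using neq[of "m + 2" m] m by auto
  next
    case (conn u' v)
    then show ?thesis using that w0 by (auto simp: nm_inj)
  qed (use w0 u st_nm st_nm' in \<open>auto simp: nm_inj\<close>)
  have wU: "w \<in> U" "w \<in> C" using R_dom w C uC by blast+
  have "{vs ! (m + 2), vs ! (m + 3)} \<in> cls (col (m + 2))" using e[of "m + 2"] m by (simp add: numeral_3_eq_3 numeral_2_eq_2)
  then obtain z where z: "R w z" and c2: "col (m + 2) = 3 - (\<chi> w + \<chi> z)"
  proof (cases rule: cls_cases)
    case (spine u' r)
    then have "vs ! (m + 3) = nm w 1" using w by (auto simp: nm_inj)
    then have "{vs ! (m + 2), vs ! Suc (m + 2)} = pendant w"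
      using w by (simp add: pendant_def numeral_3_eq_3 numeral_2_eq_2)
    then show ?thesis using ns[of "m + 2"] m wU by auto
  next
    case (conn u' v)
    then show ?thesis using that w by (auto simp: nm_inj)
  qed (use w wU st_nm st_nm' in \<open>auto simp: nm_inj\<close>)
  have "col m \<noteq> col (m + 2)" "col (m + 1) \<noteq> col (m + 2)"
    using inj_onD[OF inj, of m "m + 2"] inj_onD[OF inj, of "m + 1" "m + 2"] m by auto
  moreover have "\<chi> u < 3" "\<chi> w < 3" "\<chi> z < 3" "\<chi> u \<noteq> \<chi> w" "\<chi> w \<noteq> \<chi> z"
    using \<chi>_less \<chi>_proper w z by auto
  ultimately show False using c0 c1 c2 by arith
qed

lemma deletable_if_cover:
  assumes C: "C \<subseteq> U" "\<And>u v. R u v \<Longrightarrow> u \<in> C \<or> v \<in> C" and k: "card C \<le> k"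
  shows "deletable (l - 1) l graph k"
  unfolding deletable_def
proof (intro exI conjI notI)
  show "pendant ` C \<subseteq> edges graph"
    using C(1) l spine_in_cls[of _ 0] by (auto simp: edges_graph pendant_def)
  show "card (pendant ` C) \<le> k"
    using card_image_le[OF finite_subset[OF C(1) fin_U], of pendant] k by linarith
  assume "has_colored_induced_path (l - 1) l (delete_edges graph (pendant ` C))"
  then obtain vs col where rb: "rainbow (pendant ` C) vs col" by (rule rainbow_if_path)
  then obtain u i where ui: "u \<in> U" "i < l" "vs ! i = nm u (l - 3)" by (rule rainbow_has_tip)
  from rainbow_tip[OF rb ui(2,3,1)] show False
  proof
    assume "i = 0"
    then show False using no_rainbow_from_tip[OF C(2) rb ui(1)] ui by simp
  next
    assume "i = l - 1"
    moreover have "length vs = l" using rb by (simp add: rainbow_def)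
    ultimately have "rev vs ! 0 = nm u (l - 3)" using ui l by (simp add: rev_nth)
    then show False using no_rainbow_from_tip[OF C(2) rainbow_rev[OF rb] ui(1)] by simp
  qed
qed


subsection \<open>From deletion sets to covers\<close>

text \<open>The two pendant edges and the connecting edge carry the colors below 3, and the rest of
  the tail of \<open>u\<close> carries the others. There are no chords, since different tails are
  joined only at their vertices of index 0.\<close>

lemma rainbow_path_exists:
  assumes R: "R u v" and conn: "{nm u 0, nm v 0} \<notin> S"
    and spine: "\<And>w r. w \<in> {u, v} \<Longrightarrow> {nm w r, nm w (Suc r)} \<notin> S"
  shows "has_colored_induced_path (l - 1) l (delete_edges graph S)"
proof -
  let ?H = "delete_edges graph S"
  define m where "m = l - 4"
  have m: "l = m + 4" using l m_def by simp
  \<comment> \<open>The tail of \<open>u\<close> contributes its \<open>m + 2\<close> vertices in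
    descending order, \<open>v\<close> its first two, which makes \<open>l\<close> vertices.\<close>
  define p where "p i = (if i < m + 2 then nm u (m + 1 - i) else nm v (i - (m + 2)))" for i
  define vs where "vs = map p [0..<l]"
  have uv: "u \<in> U" "v \<in> U" "u \<noteq> v" using R_dom[OF R] \<chi>_proper[OF R] by auto
  have vs: "\<And>i. i < l \<Longrightarrow> vs ! i = p i" "length vs = l" by (auto simp: vs_def)
  have edge: "{p i, p (Suc i)} \<in> (\<Union>k. cls k) - S" if i: "i < m + 3" for i
  proof -
    consider "i < m + 1" | "i = m + 1" | "i = m + 2" using i by linarith
    then show ?thesis
    proof cases
      case 1
      have "{p i, p (Suc i)} = {nm u (m - i), nm u (Suc (m - i))}"
        using 1 by (simp add: p_def insert_commute Suc_diff_le)
      moreover have "m - i < l - 3" using m by simp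
      ultimately show ?thesis using spine_in_cls[of u "m - i"] uv spine by auto
    next
      case 2
      then show ?thesis using conn_in_cls[OF R] conn by (auto simp: p_def)
    next
      case 3
      then show ?thesis using spine_in_cls[of v 0] uv l spine by (auto simp: p_def)
    qed
  qed
  have inj: "p i = p j \<longleftrightarrow> i = j" if "i < l" "j < l" for i j
    using that uv m by (auto simp: p_def nm_inj)
  have chord: "j = Suc i" if ij: "i < j" "j < l" and E: "{p i, p j} \<in> cls k" for i j k
    using E
  proof (cases rule: cls_cases)
    case (spine w r)
    with ij uv m show ?thesis by (auto simp: p_def nm_inj split: if_splits)
  next
    case (spine' w r)
    with ij uv m show ?thesis by (auto simp: p_def nm_inj split: if_splits)
  next
    case (conn w z)
    with ij uv m show ?thesis by (auto simp: p_def nm_inj split: if_splits)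
  qed (use uv st_nm st_nm' in \<open>auto simp: p_def split: if_splits\<close>)
  have "induced_path ?H l vs"
    unfolding induced_path_def
  proof (intro conjI allI impI)
    show "distinct vs" using inj by (auto simp: vs_def distinct_map inj_on_def)
    show "set vs \<subseteq> verts ?H"
      using uv m_def l unfolding verts_delete by (auto simp: vs_def p_def intro!: nm_in_verts)
    fix i j assume ij: "i < j \<and> j < l"
    show "({vs ! i, vs ! j} \<in> edges ?H) = (j = Suc i)"
    proof
      assume "{vs ! i, vs ! j} \<in> edges ?H"
      then show "j = Suc i" using chord ij vs by (auto simp: edges_delete edges_graph)
    next
      assume "j = Suc i"
      then show "{vs ! i, vs ! j} \<in> edges ?H"
        using edge[of i] ij vs m_def l by (auto simp: edges_delete edges_graph)
    qed
  qed (simp add: vs)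
  moreover have "colors_of ?H (path_edges vs) = {..<l - 1}"
  proof (intro equalityI subsetI)
    fix k assume "k \<in> {..<l - 1}"
    then have k: "k < l - 1" by simp
    have "\<exists>i<m + 3. {p i, p (Suc i)} \<in> cls k"
    proof (cases "k < 3")
      case True
      have "k = \<chi> u \<or> k = \<chi> v \<or> k = 3 - (\<chi> u + \<chi> v)"
        using True \<chi>_less[of u] \<chi>_less[of v] \<chi>_proper[OF R] by arith
      then consider "k = \<chi> u" | "k = \<chi> v" | "k = 3 - (\<chi> u + \<chi> v)" by blast
      then show ?thesis
      proof cases
        case 1
        then show ?thesis using spine_in_cls[of u 0 k] uv l
          by (intro exI[of _ m]) (auto simp: p_def scol_def insert_commute)
      next
        case 2
        then show ?thesis using spine_in_cls[of v 0 k] uv l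
          by (intro exI[of _ "m + 2"]) (auto simp: p_def scol_def)
      next
        case 3
        then show ?thesis using conn_in_cls[OF R]
          by (intro exI[of _ "m + 1"]) (auto simp: p_def)
      qed
    next
      case False
      \<comment> \<open>As the tail is traversed downwards, its edge of index \<open>k - 2\<close>
        appears at position \<open>m - (k - 2)\<close> of the path.\<close>
      then have "{nm u (k - 2), nm u (Suc (k - 2))} \<in> cls k"
        using k uv by (intro spine_in_cls) (auto simp: scol_def)
      moreover have "m + 1 - (m - (k - 2)) = Suc (k - 2)" "m + 1 - Suc (m - (k - 2)) = k - 2"
        using False k m by auto
      ultimately show ?thesis
        by (intro exI[of _ "m - (k - 2)"]) (auto simp: p_def insert_commute)
    qed
    then obtain i where i: "i < m + 3" "{p i, p (Suc i)} \<in> cls k" by blast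
    have "{p i, p (Suc i)} \<in> path_edges vs"
      using i vs m_def l unfolding path_edges_def by (auto intro!: exI[of _ i])
    then show "k \<in> colors_of ?H (path_edges vs)"
      using i edge[OF i(1)] k by (auto simp: colors_of_def length_delete nth_delete)
  qed (auto simp: colors_of_def length_delete)
  ultimately show ?thesis unfolding has_colored_induced_path_def by auto
qed

lemma cover_if_deletable:
  assumes "deletable (l - 1) l graph k"
  shows "\<exists>C\<subseteq>U. card C \<le> k \<and> (\<forall>u v. R u v \<longrightarrow> u \<in> C \<or> v \<in> C)"
proof -
  from assms obtain S where S: "S \<subseteq> edges graph" "card S \<le> k"
    and no: "\<not> has_colored_induced_path (l - 1) l (delete_edges graph S)"
    unfolding deletable_def by blast
  \<comment> \<open>Each deleted edge is charged to one vertex of the cover problem; a connecting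
    edge goes to either of its two ends. For star edges the value has no meaning, and the
    intersection with \<open>U\<close> keeps the cover inside \<open>U\<close>.\<close>
  define owner where "owner e = (SOME u. \<exists>r. nm u r \<in> e)" for e
  have owner: "\<exists>r. nm (owner e) r \<in> e" if "nm u r \<in> e" for e u r
    unfolding owner_def by (rule someI[of _ u]) (use that in blast)
  have finS: "finite S" using S(1) finite_edges finite_subset by blast
  have "card (owner ` S \<inter> U) \<le> card (owner ` S)" using finS by (intro card_mono) auto
  also have "\<dots> \<le> k" using card_image_le[OF finS, of owner] S(2) by linarith
  finally have "card (owner ` S \<inter> U) \<le> k" .
  moreover have "u \<in> owner ` S \<inter> U \<or> v \<in> owner ` S \<inter> U" if R: "R u v" for u v
  proof (rule ccontr)
    assume neg: "\<not> ?thesis"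
    have uv: "u \<in> U" "v \<in> U" using R_dom[OF R] by auto
    have "{nm u 0, nm v 0} \<notin> S"
    proof
      assume *: "{nm u 0, nm v 0} \<in> S"
      have "owner {nm u 0, nm v 0} \<in> {u, v}" using owner[of u 0 "{nm u 0, nm v 0}"] by (auto simp: nm_inj)
      then show False using * neg uv by (metis IntI imageI insertE singletonD)
    qed
    moreover have "{nm w r, nm w (Suc r)} \<notin> S" if "w \<in> {u, v}" for w r
    proof
      assume *: "{nm w r, nm w (Suc r)} \<in> S"
      have "owner {nm w r, nm w (Suc r)} = w" using owner[of w r "{nm w r, nm w (Suc r)}"] by (auto simp: nm_inj)
      then show False using * neg uv that by (metis IntI imageI insertE singletonD)
    qed
    ultimately show False using rainbow_path_exists[OF R] no by blast
  qed
  ultimately show ?thesis by (intro exI[of _ "owner ` S \<inter> U"]) auto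
qed

theorem deletable_iff_cover:
  "deletable (l - 1) l graph k \<longleftrightarrow> (\<exists>C\<subseteq>U. card C \<le> k \<and> (\<forall>u v. R u v \<longrightarrow> u \<in> C \<or> v \<in> C))"
  using cover_if_deletable deletable_if_cover by blast

end


section \<open>A grid constraint problem as vertex cover\<close>

subsection \<open>Vertex names\<close>

fun bits_val :: "bool list \<Rightarrow> nat" where
  "bits_val [] = 0"
| "bits_val (b # bs) = of_bool b + 2 * bits_val bs"

lemma bits_val_pos: "bs \<noteq> [] \<Longrightarrow> last bs \<Longrightarrow> bits_val bs > 0"
  by (induction bs) (auto split: if_splits)

lemma binary_bits_val: "bs = [] \<or> last bs \<Longrightarrow> binary (bits_val bs) = bs"
proof (induction bs)
  case Nil
  then show ?case by (simp add: binary.simps)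
next
  case (Cons b bs)
  then have "bits_val (b # bs) > 0" by (intro bits_val_pos) auto
  moreover have "odd (bits_val (b # bs)) = b" "bits_val (b # bs) div 2 = bits_val bs" by auto
  moreover have "binary (bits_val bs) = bs" using Cons by (auto split: if_splits)
  ultimately show ?case using binary.simps[of "bits_val (b # bs)"] by simp
qed

text \<open>With the least significant bit first, a non-empty bit string is the representation of a
  number only if it ends in \<open>True\<close>; \<open>Suc z\<close> ensures this even for
  \<open>z = 0\<close>.\<close>

definition name_bits :: "nat \<Rightarrow> nat \<Rightarrow> nat \<Rightarrow> bool list" where
  "name_bits t c z = replicate t True @ False # replicate c True @ False # replicate (Suc z) True"

definition name :: "nat \<Rightarrow> nat \<Rightarrow> nat \<Rightarrow> nat" where
  "name t c z = bits_val (name_bits t c z)"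

lemma binary_name: "binary (name t c z) = name_bits t c z"
  unfolding name_def by (rule binary_bits_val) (simp add: name_bits_def del: replicate_Suc)

lemma replicate_False_eq:
  "replicate m True @ False # u = replicate n True @ False # v \<longleftrightarrow> m = n \<and> u = v"
proof (induction m arbitrary: n)
  case 0
  then show ?case by (cases n) auto
next
  case (Suc m)
  then show ?case by (cases n) auto
qed

lemma name_inj [simp]: "name t c z = name t' c' z' \<longleftrightarrow> t = t' \<and> c = c' \<and> z = z'"
proof
  assume "name t c z = name t' c' z'"
  then have "name_bits t c z = name_bits t' c' z'" by (metis binary_name)
  then show "t = t' \<and> c = c' \<and> z = z'"
    by (auto simp: name_bits_def replicate_False_eq simp del: replicate_Suc dest: arg_cong[of _ _ length])
qed simp

text \<open>Only \<open>t\<close> and \<open>c\<close> grow with the input. The remaining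
  coordinates have constant range, so any injective packing into one constant will do.\<close>

definition zid :: "nat \<Rightarrow> nat \<Rightarrow> nat \<Rightarrow> nat" where
  "zid a p r = prod_encode (a, prod_encode (p, r))"

lemma zid_inj [simp]: "zid a p r = zid a' p' r' \<longleftrightarrow> a = a' \<and> p = p' \<and> r = r'"
  by (simp add: zid_def)


subsection \<open>The grid constraint problem\<close>

text \<open>
  Direction \<open>d < 5\<close> relates the values of the cells \<open>(t + src_t d, c)\<close> and
  \<open>(t + tgt_t d, c + tgt_c d)\<close>. Direction 0 relates a cell to itself: it forbids two values at once
  and expresses unary constraints.
\<close>

definition src_t :: "nat \<Rightarrow> nat" where "src_t d = (if d = 4 then 1 else 0)"
definition tgt_t :: "nat \<Rightarrow> nat" where "tgt_t d = (if d = 2 \<or> d = 3 then 1 else 0)"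
definition tgt_c :: "nat \<Rightarrow> nat" where "tgt_c d = (if d = 1 \<or> d = 3 \<or> d = 4 then 1 else 0)"

text \<open>The \<open>m\<close> pairs of consecutive positions are disjoint, and each of them
  contains an element of the cover.\<close>

lemma path_cover_lower:
  fixes D :: "nat set"
  assumes "finite D" "\<And>i. i < m \<Longrightarrow> s + 2 * i \<in> D \<or> Suc (s + 2 * i) \<in> D"
  shows "m \<le> card (D \<inter> {s..<s + 2 * m})"
  using assms(2)
proof (induction m)
  case (Suc m)
  have eq: "D \<inter> {s..<s + 2 * Suc m} = (D \<inter> {s..<s + 2 * m}) \<union> (D \<inter> {s + 2 * m, Suc (s + 2 * m)})"
    by auto
  moreover have "card (D \<inter> {s + 2 * m, Suc (s + 2 * m)}) > 0"
    using Suc.prems[of m] assms(1) by (auto simp: card_gt_0_iff)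
  moreover have "card ((D \<inter> {s..<s + 2 * m}) \<union> (D \<inter> {s + 2 * m, Suc (s + 2 * m)})) =
      card (D \<inter> {s..<s + 2 * m}) + card (D \<inter> {s + 2 * m, Suc (s + 2 * m)})"
    using assms(1) by (intro card_Un_disjoint) auto
  moreover have "m \<le> card (D \<inter> {s..<s + 2 * m})" by (rule Suc.IH) (use Suc.prems in simp)
  ultimately show ?case unfolding eq by linarith
qed simp

text \<open>The even position \<open>2 * j\<close> cuts the path into \<open>j\<close> pairs before
  it and \<open>m - j\<close> pairs behind it, each of which needs an element besides
  \<open>2 * j\<close> itself.\<close>

lemma path_cover_even:
  fixes D :: "nat set"
  assumes "finite D" "\<And>p. p < 2 * m \<Longrightarrow> p \<in> D \<or> Suc p \<in> D" "2 * j \<in> D" "j \<le> m"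
  shows "m + 1 \<le> card D"
proof -
  let ?D1 = "D \<inter> {0..<0 + 2 * j}" and ?D2 = "D \<inter> {2 * j + 1..<2 * j + 1 + 2 * (m - j)}"
  have "j \<le> card ?D1"
    by (rule path_cover_lower) (use assms in auto)
  moreover have "m - j \<le> card ?D2"
  proof (rule path_cover_lower)
    fix i assume "i < m - j"
    then show "2 * j + 1 + 2 * i \<in> D \<or> Suc (2 * j + 1 + 2 * i) \<in> D"
      using assms(2)[of "2 * j + 1 + 2 * i"] by auto
  qed (rule assms)
  moreover have "card (insert (2 * j) ?D1) = Suc (card ?D1)"
    using assms(1) by (intro card_insert_disjoint) auto
  moreover have "card (insert (2 * j) ?D1 \<union> ?D2) =
      card (insert (2 * j) ?D1) + card ?D2"
    using assms(1) by (intro card_Un_disjoint) auto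
  moreover have "card (insert (2 * j) ?D1 \<union> ?D2) \<le> card D"
    using assms by (intro card_mono) auto
  ultimately show ?thesis using assms(4) by linarith
qed

type_synonym node = "nat \<times> nat \<times> nat \<times> nat"

locale grid_csp =
  fixes A :: nat and bad :: "nat \<Rightarrow> nat \<Rightarrow> nat \<Rightarrow> bool" and b0 :: "bool \<Rightarrow> nat \<Rightarrow> nat \<Rightarrow> bool"
    and bF :: "nat \<Rightarrow> bool"
  assumes A_pos: "A \<ge> 1"
begin

text \<open>In direction 0 a pair with \<open>a = b\<close> yields an edge between two even
  positions of the same path; selecting \<open>a\<close> would leave it uncovered, so the value is
  excluded. Column \<open>N\<close> is the head column, hence the input position
  \<open>c - N\<close>.\<close>

definition conflict :: "nat \<Rightarrow> bool list \<Rightarrow> nat \<Rightarrow> nat \<Rightarrow> nat \<Rightarrow> nat \<Rightarrow> nat \<Rightarrow> bool" where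
  "conflict N x t c d a b \<longleftrightarrow> a < A \<and> b < A \<and>
     (if d = 0 then t \<le> N \<and> c \<le> 2 * N \<and>
        (a \<noteq> b \<or> t = 0 \<and> b0 (c = N) (contents x (int c - int N)) a \<or> t = N \<and> c = N \<and> bF a)
      else d \<le> 4 \<and> t < N \<and> c < 2 * N \<and> bad d a b)"

definition sat :: "nat \<Rightarrow> bool list \<Rightarrow> bool" where
  "sat N x \<longleftrightarrow> (\<exists>f. (\<forall>t\<le>N. \<forall>c\<le>2 * N. f t c < A) \<and>
     (\<forall>t c d. \<not> conflict N x t c d (f (t + src_t d) c) (f (t + tgt_t d) (c + tgt_c d))))"

text \<open>Each value path has its own port for every direction and every partner value,
  \<open>5 * A\<close> outgoing and \<open>5 * A\<close> incoming ones, on even positions only;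
  hence \<open>10 * A\<close>. With 8 positions for the color change in between,
  \<open>2 * half\<close> is the last incoming port \<open>inp 4 (A - 1)\<close>.\<close>

definition Q :: nat where "Q = 10 * A"
definition half :: nat where "half = 10 * A + 3"
definition outp :: "nat \<Rightarrow> nat \<Rightarrow> nat" where "outp d b = 2 * (d * A + b)"
definition inp :: "nat \<Rightarrow> nat \<Rightarrow> nat" where "inp d a = Q + 8 + 2 * (d * A + a)"

text \<open>
  Conflict edges run from even positions below \<open>Q\<close> (color 0) to even positions above \<open>Q + 8\<close> (color 1).
  In between, the color of the even positions changes such that only the pairwise non-adjacent
  positions \<open>Q + 1\<close>, \<open>Q + 4\<close>, \<open>Q + 7\<close> have neighbours of two colors; \<open>ncol p\<close> is the color of all
  neighbours of any other position \<open>p\<close>.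
\<close>

definition pcol :: "nat \<Rightarrow> nat" where
  "pcol p = (if p < Q then p mod 2 else if p < Q + 8 then [0, 1, 2, 1, 2, 0, 2, 0] ! (p - Q) else (p + 1) mod 2)"

definition ncol :: "nat \<Rightarrow> nat" where
  "ncol p = (if p < Q then (p + 1) mod 2 else if p < Q + 8 then [1, 0, 1, 2, 0, 2, 0, 0] ! (p - Q) else p mod 2)"

definition pure :: "nat \<Rightarrow> bool" where
  "pure p \<longleftrightarrow> p \<noteq> Q + 1 \<and> p \<noteq> Q + 4 \<and> p \<noteq> Q + 7"

definition U :: "nat \<Rightarrow> node set" where
  "U N = {(t, c, a, p). t \<le> N \<and> c \<le> 2 * N \<and> a < A \<and> p \<le> 2 * half}"

definition pathE :: "nat \<Rightarrow> node \<Rightarrow> node \<Rightarrow> bool" where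
  "pathE N u v \<longleftrightarrow> (\<exists>t c a p. t \<le> N \<and> c \<le> 2 * N \<and> a < A \<and> p < 2 * half \<and>
     u = (t, c, a, p) \<and> v = (t, c, a, Suc p))"

definition confE :: "nat \<Rightarrow> bool list \<Rightarrow> node \<Rightarrow> node \<Rightarrow> bool" where
  "confE N x u v \<longleftrightarrow> (\<exists>t c d a b. conflict N x t c d a b \<and>
     u = (t + src_t d, c, a, outp d b) \<and> v = (t + tgt_t d, c + tgt_c d, b, inp d a))"

definition R :: "nat \<Rightarrow> bool list \<Rightarrow> node \<Rightarrow> node \<Rightarrow> bool" where
  "R N x u v \<longleftrightarrow> pathE N u v \<or> pathE N v u \<or> confE N x u v \<or> confE N x v u"

definition col :: "node \<Rightarrow> nat" where
  "col = (\<lambda>(t, c, a, p). pcol p)"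

definition nm :: "node \<Rightarrow> nat \<Rightarrow> nat" where
  "nm = (\<lambda>(t, c, a, p) r. name t c (zid a p r))"

text \<open>The value index \<open>A\<close> is out of range for the nodes in \<open>U N\<close>,
  which keeps the star disjoint from the rest.\<close>

definition star :: "nat \<Rightarrow> nat" where
  "star i = name 0 0 (zid A 0 i)"

text \<open>In each of the \<open>(N + 1) * (2 * N + 1)\<close> cells one value path is covered by
  \<open>half\<close> vertices and each of the other \<open>A - 1\<close> by
  \<open>half + 1\<close>.\<close>

definition budget :: "nat \<Rightarrow> nat" where
  "budget N = (N + 1) * (2 * N + 1) * (A * half + A - 1)"

section \<open>The conflict graph as a cover graph\<close>

lemma mult_add_inj:
  fixes d d' b b' :: nat
  assumes "d * A + b = d' * A + b'" "b < A" "b' < A"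
  shows "d = d' \<and> b = b'"
proof -
  have "(d * A + b) div A = (d' * A + b') div A" "(d * A + b) mod A = (d' * A + b') mod A"
    using assms(1) by auto
  then show ?thesis using assms(2,3) by simp
qed

lemma conflict_dom:
  assumes "conflict N x t c d a b"
  shows "a < A" "b < A" "d \<le> 4" "t + src_t d \<le> N" "c \<le> 2 * N" "t + tgt_t d \<le> N" "c + tgt_c d \<le> 2 * N"
  using assms by (auto simp: conflict_def src_t_def tgt_t_def tgt_c_def split: if_splits)

lemma port_less:
  assumes "d \<le> 4" "b < A"
  shows "d * A + b < 5 * A"
proof -
  have "d * A + b < d * A + A" using assms by simp
  also have "\<dots> = (d + 1) * A" by simp
  also have "\<dots> \<le> 5 * A" using assms by (intro mult_right_mono) auto
  finally show ?thesis .
qed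

lemma outp_bound: "d \<le> 4 \<Longrightarrow> b < A \<Longrightarrow> outp d b < Q"
  using port_less[of d b] by (auto simp: outp_def Q_def)

lemma inp_bound: "d \<le> 4 \<Longrightarrow> b < A \<Longrightarrow> inp d b \<le> 2 * half"
  using port_less[of d b] by (auto simp: inp_def Q_def half_def)

lemma inp_lower: "inp d b \<ge> Q + 8"
  by (simp add: inp_def)

lemma even_ports: "even (outp d b)" "even (inp d b)"
  by (auto simp: outp_def inp_def Q_def)

lemma pathE_R: "pathE N u v \<Longrightarrow> R N x u v" and confE_R: "confE N x u v \<Longrightarrow> R N x u v"
  by (auto simp: R_def)

lemma confE_dom:
  assumes "confE N x u v"
  shows "u \<in> U N" "v \<in> U N"
proof -
  from assms obtain t c d a b where c: "conflict N x t c d a b" and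
    uv: "u = (t + src_t d, c, a, outp d b)" "v = (t + tgt_t d, c + tgt_c d, b, inp d a)"
    unfolding confE_def by blast
  note dom = conflict_dom[OF c]
  have "outp d b \<le> 2 * half" using outp_bound[OF dom(3,2)] by (auto simp: Q_def half_def)
  then show "u \<in> U N" "v \<in> U N" using dom uv inp_bound[OF dom(3,1)] by (auto simp: U_def)
qed

lemma R_dom: "R N x u v \<Longrightarrow> u \<in> U N \<and> v \<in> U N"
  using confE_dom[of N x u v] confE_dom[of N x v u] by (auto simp: R_def pathE_def U_def)

lemma R_sym: "R N x u v \<Longrightarrow> R N x v u"
  unfolding R_def by blast

lemma less_8_cases:
  fixes k :: nat
  assumes "k < 8"
  obtains "k = 0" | "k = 1" | "k = 2" | "k = 3" | "k = 4" | "k = 5" | "k = 6" | "k = 7"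
  using assms by linarith

lemma even_Q: "even Q" by (simp add: Q_def)

text \<open>Supplies properness and \<open>mono\<close> along a path: of two adjacent positions at
  most one sees two colors. The evenness of \<open>Q\<close> makes the parity colorings on both
  sides fit the tables at \<open>Q\<close> and \<open>Q + 8\<close>.\<close>

lemma pcol_path:
  "pcol p \<noteq> pcol (Suc p) \<and> (pure p \<longrightarrow> pcol (Suc p) = ncol p) \<and>
      (pure (Suc p) \<longrightarrow> pcol p = ncol (Suc p)) \<and> (pure p \<or> pure (Suc p))"
proof -
  consider (1) "p < Q" | (2) k where "p = Q + k" "k < 8" | (3) "p \<ge> Q + 8"
    by (metis less_or_eq_imp_le linorder_not_less nat_add_left_cancel_less nat_le_iff_add)
  then show ?thesis
  proof cases
    case 1
    show ?thesis
    proof (cases "Suc p = Q")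
      case True
      then have "odd p" using even_Q by (metis even_Suc)
      moreover have "Q mod 2 = 0" using even_Q by simp
      ultimately show ?thesis using True 1 by (auto simp: pcol_def ncol_def pure_def odd_iff_mod_2_eq_one)
    next
      case False
      then have "Suc p < Q" using 1 by simp
      then show ?thesis using 1 by (auto simp: pcol_def ncol_def pure_def mod_Suc)
    qed
  next
    case 2
    have "Q mod 2 = 0" using even_Q by auto
    then have "(Q + 8 + 1) mod 2 = 1" "(Q + 8) mod 2 = 0" by presburger+
    with 2(2) show ?thesis
      by (cases rule: less_8_cases) (auto simp: 2(1) pcol_def ncol_def pure_def eval_nat_numeral)
  next
    case 3
    then show ?thesis by (auto simp: pcol_def ncol_def pure_def mod_Suc)
  qed
qed

text \<open>The path neighbours of an outgoing port have color 1, like the incoming port at the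
  other end of a conflict edge, and conversely with color 0. Conflict edges thus leave ports pure
  and get the color 2.\<close>

lemma port_cols:
  assumes "d \<le> 4" "b < A"
  shows "pcol (outp d b) = 0" "ncol (outp d b) = 1" "pure (outp d b)"
    "pcol (inp d a) = 1" "ncol (inp d a) = 0" "pure (inp d a)"
proof -
  have "outp d b < Q" "outp d b mod 2 = 0" using outp_bound[OF assms] even_ports by auto
  then show "pcol (outp d b) = 0" "ncol (outp d b) = 1" "pure (outp d b)"
    by (auto simp: pcol_def ncol_def pure_def mod_Suc)
  have "inp d a \<ge> Q + 8" "inp d a mod 2 = 0" using inp_lower even_ports by auto
  then show "pcol (inp d a) = 1" "ncol (inp d a) = 0" "pure (inp d a)"
    by (auto simp: pcol_def ncol_def pure_def mod_Suc)
qed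

definition pos :: "node \<Rightarrow> nat" where
  "pos = (\<lambda>(t, c, a, p). p)"

lemma R_cols:
  assumes "R N x u v"
  shows "col u \<noteq> col v" "pure (pos u) \<Longrightarrow> col v = ncol (pos u)" "pure (pos u) \<or> pure (pos v)"
proof -
  let ?P = "\<lambda>u v. col u \<noteq> col v \<and> (pure (pos u) \<longrightarrow> col v = ncol (pos u)) \<and>
     (pure (pos v) \<longrightarrow> col u = ncol (pos v)) \<and> (pure (pos u) \<or> pure (pos v))"
  have path: "?P u v" if "pathE N u v" for u v
    using that pcol_path unfolding pathE_def by (auto simp: col_def pos_def)
  have conf: "?P u v" if "confE N x u v" for u v
  proof -
    from that obtain t c d a b where c: "conflict N x t c d a b" and
      uv: "u = (t + src_t d, c, a, outp d b)" "v = (t + tgt_t d, c + tgt_c d, b, inp d a)"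
      unfolding confE_def by blast
    show ?thesis using port_cols[OF conflict_dom(3,2)[OF c]] uv by (simp add: col_def pos_def)
  qed
  from assms have "col u \<noteq> col v \<and> (pure (pos u) \<longrightarrow> col v = ncol (pos u)) \<and> (pure (pos u) \<or> pure (pos v))"
    unfolding R_def using path[of u v] path[of v u] conf[of u v] conf[of v u] by metis
  then show "col u \<noteq> col v" "pure (pos u) \<Longrightarrow> col v = ncol (pos u)" "pure (pos u) \<or> pure (pos v)" by auto
qed

lemma confE_unique_target: "confE N x u v \<Longrightarrow> confE N x u v' \<Longrightarrow> v = v'"
  unfolding confE_def
proof (elim exE conjE)
  fix t c d a b t' c' d' a' b'
  assume c: "conflict N x t c d a b" and c': "conflict N x t' c' d' a' b'"
    and u: "u = (t + src_t d, c, a, outp d b)" "u = (t' + src_t d', c', a', outp d' b')"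
    and v: "v = (t + tgt_t d, c + tgt_c d, b, inp d a)" "v' = (t' + tgt_t d', c' + tgt_c d', b', inp d' a')"
  have "d = d' \<and> b = b'"
    using mult_add_inj[of d b d' b'] u conflict_dom(2)[OF c] conflict_dom(2)[OF c'] by (auto simp: outp_def)
  then show "v = v'" using u v by auto
qed

lemma confE_unique_source: "confE N x u v \<Longrightarrow> confE N x u' v \<Longrightarrow> u = u'"
  unfolding confE_def
proof (elim exE conjE)
  fix t c d a b t' c' d' a' b'
  assume c: "conflict N x t c d a b" and c': "conflict N x t' c' d' a' b'"
    and u: "u = (t + src_t d, c, a, outp d b)" "u' = (t' + src_t d', c', a', outp d' b')"
    and v: "v = (t + tgt_t d, c + tgt_c d, b, inp d a)" "v = (t' + tgt_t d', c' + tgt_c d', b', inp d' a')"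
  have "d = d' \<and> a = a'"
    using mult_add_inj[of d a d' a'] v conflict_dom(1)[OF c] conflict_dom(1)[OF c'] by (auto simp: inp_def)
  then show "u = u'" using u v by auto
qed

lemma finite_U: "finite (U N)"
proof (rule finite_subset)
  show "U N \<subseteq> {..N} \<times> {..2 * N} \<times> {..<A} \<times> {..2 * half}" by (auto simp: U_def)
qed simp

text \<open>A position has at most two neighbours on its path, and by the uniqueness of ports at
  most one conflict edge in either orientation.\<close>

lemma R_degree: "card {v. R N x u v} \<le> 15"
proof -
  obtain t c a p where u: "u = (t, c, a, p)" by (cases u) auto
  let ?P = "{(t, c, a, Suc p), (t, c, a, p - 1)}" and ?X = "{v. confE N x u v}" and ?Y = "{v. confE N x v u}"
  have fin: "finite ?X" "finite ?Y"
    by (rule finite_subset[OF _ finite_U], use confE_dom in blast)+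
  have "card ?X \<le> Suc 0" "card ?Y \<le> Suc 0"
    using fin confE_unique_source confE_unique_target by (auto simp: card_le_Suc0_iff_eq)
  moreover have "{v. R N x u v} \<subseteq> ?P \<union> (?X \<union> ?Y)"
    by (auto simp: R_def pathE_def u)
  then have "card {v. R N x u v} \<le> card (?P \<union> (?X \<union> ?Y))"
    using fin by (intro card_mono) auto
  moreover have "card (?P \<union> (?X \<union> ?Y)) \<le>
      card ?P + card (?X \<union> ?Y)"
    by (rule card_Un_le)
  moreover have "card (?X \<union> ?Y) \<le> card ?X + card ?Y"
    by (rule card_Un_le)
  moreover have "card ?P \<le> 2" by (simp add: card_insert_if)
  ultimately show ?thesis by linarith
qed

lemma cover_graph_R:
  assumes "l \<ge> 4"
  shows "cover_graph (U N) (R N x) col nm star l"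
proof
  show "finite (U N)" by (rule finite_U)
  show "u \<in> U N \<and> v \<in> U N" if "R N x u v" for u v using R_dom that .
  show "R N x v u" if "R N x u v" for u v using R_sym that .
  have "[0, 1, 2, 1, 2, 0, 2, 0] ! k < (3::nat)" if "k < 8" for k :: nat
    using that by (cases rule: less_8_cases) auto
  then show "col u < 3" for u
    by (cases u) (auto simp: col_def pcol_def less_Suc_eq_le intro: le_less_trans[of _ 1])
  show "col u \<noteq> col v" if "R N x u v" for u v using R_cols(1)[OF that] .
  show "\<exists>u\<in>U N. col u = i" if "i < 3" for i
  proof -
    have "i = 0 \<or> i = 1 \<or> i = 2" using that by auto
    \<comment> \<open>The color change begins with the colors 0, 1, 2 at the positions
      \<open>Q\<close>, \<open>Q + 1\<close>, \<open>Q + 2\<close>.\<close>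
    moreover have "(0, 0, 0, Q + i) \<in> U N" using A_pos that by (auto simp: U_def Q_def half_def)
    ultimately show ?thesis by (intro bexI[of _ "(0, 0, 0, Q + i)"]) (auto simp: col_def pcol_def)
  qed
  show "(\<forall>w. R N x u w \<longrightarrow> col w = col v) \<or> (\<forall>w. R N x v w \<longrightarrow> col w = col u)" if "R N x u v" for u v
    using R_cols that R_sym by metis
  show "card {v. R N x u v} \<le> 15" for u by (rule R_degree)
  show "(nm u r = nm v s) = (u = v \<and> r = s)" for u v r s by (cases u; cases v) (auto simp: nm_def)
  show "(star i = star j) = (i = j)" for i j by (simp add: star_def)
  show "star i \<noteq> nm u r" if "u \<in> U N" for u i r using that by (auto simp: star_def nm_def U_def)
qed (rule assms)


subsection \<open>Satisfiability and covers\<close>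

lemma card_grid:
  assumes "C \<subseteq> U N"
  shows "card C = (\<Sum>t\<le>N. \<Sum>c\<le>2 * N. \<Sum>a<A. card {p. (t, c, a, p) \<in> C})"
proof -
  have fin: "finite {p. (t, c, a, p) \<in> C}" for t c a
    by (rule finite_subset[of _ "{..2 * half}"]) (use assms in \<open>auto simp: U_def\<close>)
  have "C = (SIGMA t:{..N}. SIGMA c:{..2 * N}. SIGMA a:{..<A}. {p. (t, c, a, p) \<in> C})"
    using assms by (auto simp: U_def)
  then have "card C = card (SIGMA t:{..N}. SIGMA c:{..2 * N}. SIGMA a:{..<A}. {p. (t, c, a, p) \<in> C})" by simp
  also have "\<dots> = (\<Sum>t\<le>N. \<Sum>c\<le>2 * N. \<Sum>a<A. card {p. (t, c, a, p) \<in> C})"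
    using fin by simp
  finally show ?thesis .
qed

lemma sum_all_but_one:
  assumes "a < A"
  shows "(\<Sum>b<A. if a = b then half else half + 1) = A * half + A - 1"
proof -
  have "(\<Sum>b<A. if a = b then half else half + 1) + 1 =
      (\<Sum>b<A. if a = b then half else half + 1) + (\<Sum>b<A. if a = b then 1 else 0)"
    using assms by simp
  also have "\<dots> = (\<Sum>b<A. half + 1)" unfolding sum.distrib[symmetric] by (rule sum.cong) auto
  finally show ?thesis by simp
qed

lemma card_even: "card {p. p \<le> 2 * n \<and> even p} = n + 1"
proof -
  have "{p. p \<le> 2 * n \<and> even p} = (\<lambda>i. 2 * i) ` {..n}" by (auto elim!: evenE)
  then show ?thesis by (simp add: card_image inj_on_def)
qed

lemma card_odd: "card {p. p \<le> 2 * n \<and> odd p} = n"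
proof -
  have "{p. p \<le> 2 * n \<and> odd p} = (\<lambda>i. 2 * i + 1) ` {..<n}" by (auto elim!: oddE)
  then show ?thesis by (simp add: card_image inj_on_def)
qed

lemma budget_sum: "(\<Sum>t\<le>N. \<Sum>c\<le>2 * N. A * half + A - 1) = budget N"
  by (simp add: budget_def mult.assoc del: mult_Suc mult_Suc_right)

lemma cover_if_sat:
  assumes "sat N x"
  shows "\<exists>C\<subseteq>U N. card C \<le> budget N \<and> (\<forall>u v. R N x u v \<longrightarrow> u \<in> C \<or> v \<in> C)"
proof -
  from assms obtain f where f: "\<And>t c. t \<le> N \<Longrightarrow> c \<le> 2 * N \<Longrightarrow> f t c < A"
    and ok: "\<And>t c d. \<not> conflict N x t c d (f (t + src_t d) c) (f (t + tgt_t d) (c + tgt_c d))"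
    unfolding sat_def by blast
  \<comment> \<open>Odd positions cover a selected path, even positions any other one. As ports are
    even, a conflict edge stays uncovered only if both of its values are selected.\<close>
  define C where "C = {(t, c, a, p). (t, c, a, p) \<in> U N \<and> (if f t c = a then odd p else even p)}"
  have sub: "C \<subseteq> U N" by (auto simp: C_def)
  have "card {p. (t, c, a, p) \<in> C} = (if f t c = a then half else half + 1)"
    if "t \<le> N" "c \<le> 2 * N" "a < A" for t c a
  proof -
    have "{p. (t, c, a, p) \<in> C} =
        (if f t c = a then {p. p \<le> 2 * half \<and> odd p} else {p. p \<le> 2 * half \<and> even p})"
      using that by (auto simp: C_def U_def)
    then show ?thesis by (simp add: card_even card_odd)
  qed
  then have "card C = (\<Sum>t\<le>N. \<Sum>c\<le>2 * N. \<Sum>a<A. if f t c = a then half else half + 1)"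
    unfolding card_grid[OF sub] by (intro sum.cong refl) auto
  also have "\<dots> = (\<Sum>t\<le>N. \<Sum>c\<le>2 * N. A * half + A - 1)"
    by (intro sum.cong refl sum_all_but_one f) auto
  finally have "card C \<le> budget N" unfolding budget_sum by simp
  moreover have path: "u \<in> C \<or> v \<in> C" if "pathE N u v" for u v
    using that by (auto simp: pathE_def C_def U_def)
  moreover have conf: "u \<in> C \<or> v \<in> C" if c: "confE N x u v" for u v
  proof -
    from c obtain t c d a b where cf: "conflict N x t c d a b" and
      uv: "u = (t + src_t d, c, a, outp d b)" "v = (t + tgt_t d, c + tgt_c d, b, inp d a)"
      unfolding confE_def by blast
    have "\<not> (f (t + src_t d) c = a \<and> f (t + tgt_t d) (c + tgt_c d) = b)" using ok cf by metis
    then show ?thesis using confE_dom[OF c] uv even_ports by (auto simp: C_def)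
  qed
  ultimately show ?thesis using sub unfolding R_def by (intro exI[of _ C] conjI) metis+
qed

text \<open>A value is free if the cover avoids all even positions of its path; any other value
  costs at least \<open>half + 1\<close>. The conflicts of direction 0 allow at most one free value
  per cell, so the budget is the sum of the least possible costs of the cells and leaves no cell
  without a free value. The free values form the solution.\<close>

lemma sat_if_cover:
  assumes sub: "C \<subseteq> U N" and card: "card C \<le> budget N"
    and cov: "\<And>u v. R N x u v \<Longrightarrow> u \<in> C \<or> v \<in> C"
  shows "sat N x"
proof -
  define D where "D t c a = {p. (t, c, a, p) \<in> C}" for t c a
  define free where "free t c a \<longleftrightarrow> a < A \<and> (\<forall>p. even p \<longrightarrow> (t, c, a, p) \<notin> C)" for t c a
  have fin: "finite (D t c a)" for t c a
    by (rule finite_subset[of _ "{..2 * half}"]) (use sub in \<open>auto simp: U_def D_def\<close>)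
  have cover: "p \<in> D t c a \<or> Suc p \<in> D t c a" if "t \<le> N" "c \<le> 2 * N" "a < A" "p < 2 * half" for t c a p
    using cov[of "(t, c, a, p)" "(t, c, a, Suc p)"] that by (auto simp: R_def pathE_def D_def)
  have lower: "half \<le> card (D t c a)" if "t \<le> N" "c \<le> 2 * N" "a < A" for t c a
  proof -
    have "half \<le> card (D t c a \<inter> {0..<0 + 2 * half})"
      by (rule path_cover_lower[OF fin]) (use cover[OF that] in auto)
    also have "\<dots> \<le> card (D t c a)" by (rule card_mono[OF fin]) auto
    finally show ?thesis .
  qed
  have lower': "half + 1 \<le> card (D t c a)" if tca: "t \<le> N" "c \<le> 2 * N" "a < A" and "\<not> free t c a" for t c a
  proof -
    from that obtain p where p: "even p" "(t, c, a, p) \<in> C" by (auto simp: free_def)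
    then obtain j where j: "p = 2 * j" by (auto elim: evenE)
    have "j \<le> half" using p sub j by (auto simp: U_def)
    then show ?thesis
      by (rule path_cover_even[OF fin _ _, rotated 2]) (use cover[OF tca] p j in \<open>auto simp: D_def\<close>)
  qed
  have no_conf: "\<not> (free (t + src_t d) c a \<and> free (t + tgt_t d) (c + tgt_c d) b)"
    if "conflict N x t c d a b" for t c d a b
  proof -
    have "confE N x (t + src_t d, c, a, outp d b) (t + tgt_t d, c + tgt_c d, b, inp d a)"
      using that unfolding confE_def by blast
    from cov[OF confE_R[OF this]] show ?thesis using even_ports by (auto simp: free_def)
  qed
  have free_unique: "a = b" if "t \<le> N" "c \<le> 2 * N" "free t c a" "free t c b" for t c a b
  proof (rule ccontr)
    assume "a \<noteq> b"
    then have "conflict N x t c 0 a b" using that by (auto simp: conflict_def free_def)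
    from no_conf[OF this] that show False by (simp add: src_t_def tgt_t_def tgt_c_def)
  qed
  define s where "s t c = (\<Sum>a<A. card (D t c a))" for t c
  have s_free: "A * half + A - 1 \<le> s t c" if tc: "t \<le> N" "c \<le> 2 * N" and a: "free t c a" for t c a
  proof -
    have "a < A" using a by (simp add: free_def)
    then have "A * half + A - 1 = (\<Sum>b<A. if a = b then half else half + 1)" by (rule sum_all_but_one[symmetric])
    also have "\<dots> \<le> s t c"
      unfolding s_def
    proof (rule sum_mono)
      fix b assume "b \<in> {..<A}"
      then have b: "b < A" by simp
      show "(if a = b then half else half + 1) \<le> card (D t c b)"
      proof (cases "a = b")
        case True
        then show ?thesis using lower[OF tc b] by simp
      next
        case False
        then have "\<not> free t c b" using free_unique[OF tc a] by blast
        then show ?thesis using lower'[OF tc b] False by simp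
      qed
    qed
    finally show ?thesis .
  qed
  have s_nofree: "A * half + A - 1 < s t c" if tc: "t \<le> N" "c \<le> 2 * N" and a: "\<And>a. \<not> free t c a" for t c
  proof -
    have "(\<Sum>a<A. half + 1) \<le> s t c"
      unfolding s_def by (rule sum_mono) (use lower'[OF tc] a in simp)
    then show ?thesis using A_pos by simp
  qed
  have s_lower: "A * half + A - 1 \<le> s t c" if tc: "t \<le> N" "c \<le> 2 * N" for t c
    using s_free[OF tc] s_nofree[OF tc] by (meson less_imp_le)
  \<comment> \<open>A cell without free value would exceed its share of the budget, and no other
    cell can fall below its own.\<close>
  have ex: "\<exists>a. free t c a" if tc: "t \<le> N" "c \<le> 2 * N" for t c
  proof (rule ccontr)
    assume "\<not> ?thesis"
    then have gt: "A * half + A - 1 < s t c" using s_nofree[OF tc] by blast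
    have "(\<Sum>t\<le>N. \<Sum>c\<le>2 * N. A * half + A - 1) < (\<Sum>t\<le>N. \<Sum>c\<le>2 * N. s t c)"
    proof (rule sum_strict_mono_ex1)
      show "\<forall>t\<in>{..N}. (\<Sum>c\<le>2 * N. A * half + A - 1) \<le> (\<Sum>c\<le>2 * N. s t c)"
        using s_lower by (intro ballI sum_mono) auto
      have "(\<Sum>c\<le>2 * N. A * half + A - 1) < (\<Sum>c\<le>2 * N. s t c)"
        by (rule sum_strict_mono_ex1) (use s_lower tc gt in auto)
      then show "\<exists>t\<in>{..N}. (\<Sum>c\<le>2 * N. A * half + A - 1) < (\<Sum>c\<le>2 * N. s t c)" using tc by auto
    qed simp
    then have "budget N < card C" unfolding budget_sum card_grid[OF sub] s_def D_def .
    with card show False by simp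
  qed
  define f where "f t c = (SOME a. free t c a)" for t c
  have f: "free t c (f t c)" if "t \<le> N" "c \<le> 2 * N" for t c
    unfolding f_def using ex[OF that] by (rule someI_ex)
  show ?thesis
    unfolding sat_def
  proof (intro exI[of _ f] conjI allI impI)
    show "f t c < A" if "t \<le> N" "c \<le> 2 * N" for t c using f[OF that] by (simp add: free_def)
    show "\<not> conflict N x t c d (f (t + src_t d) c) (f (t + tgt_t d) (c + tgt_c d))" for t c d
    proof
      assume *: "conflict N x t c d (f (t + src_t d) c) (f (t + tgt_t d) (c + tgt_c d))"
      show False using no_conf[OF *] f conflict_dom(4-7)[OF *] by blast
    qed
  qed
qed

theorem sat_iff_cover:
  "sat N x \<longleftrightarrow> (\<exists>C\<subseteq>U N. card C \<le> budget N \<and> (\<forall>u v. R N x u v \<longrightarrow> u \<in> C \<or> v \<in> C))"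
  using cover_if_sat sat_if_cover by blast

end


section \<open>Accepting computations as a grid constraint problem\<close>

text \<open>A transition records the state and the symbols to which it applies, so that its
  applicability can be checked inside a cell; the flag marks idle transitions.\<close>

type_synonym trans = "nat \<times> nat list \<times> nat \<times> (nat \<times> move) list \<times> bool"

fun t_src :: "trans \<Rightarrow> nat" where "t_src (q, ss, q', as, fl) = q"
fun t_read :: "trans \<Rightarrow> nat list" where "t_read (q, ss, q', as, fl) = ss"
fun t_tgt :: "trans \<Rightarrow> nat" where "t_tgt (q, ss, q', as, fl) = q'"
fun t_act :: "trans \<Rightarrow> (nat \<times> move) list" where "t_act (q, ss, q', as, fl) = as"
fun t_idle :: "trans \<Rightarrow> bool" where "t_idle (q, ss, q', as, fl) = fl"

definition t_off :: "trans \<Rightarrow> nat \<Rightarrow> int" where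
  "t_off d j = offset (snd (t_act d ! j))"

definition rel :: "config \<Rightarrow> nat \<Rightarrow> int \<Rightarrow> nat" where
  "rel C j i = fst (snd C ! j) (snd (snd C ! j) + i)"

definition appl :: "trans \<Rightarrow> config \<Rightarrow> config" where
  "appl d C = (t_tgt d, map2 act (snd C) (t_act d))"

text \<open>\<open>mk\<close> marks the head column, the only one whose symbols the transition
  replaces.\<close>

definition written :: "bool \<Rightarrow> nat list \<Rightarrow> trans \<Rightarrow> nat \<Rightarrow> nat" where
  "written mk sy d j = (if mk then fst (t_act d ! j) else sy ! j)"

lemma offset_cases: "offset m = - 1 \<or> offset m = 0 \<or> offset m = 1"
  by (cases m) auto

section \<open>Runs padded by idle transitions\<close>

locale ntm =
  fixes M :: tm
  assumes tm: "turing_machine M"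
begin

definition wf :: "config \<Rightarrow> bool" where
  "wf C \<longleftrightarrow> fst C < states M \<and> length (snd C) = tapes M \<and>
     (\<forall>j<tapes M. \<forall>i. fst (snd C ! j) i < symbols M)"

text \<open>The idle transitions make all accepting computations equally long.\<close>

definition Delta :: "trans set" where
  "Delta = {(q, ss, q', as, False) | q ss q' as. q < states M \<and> ss \<in> reads M \<and> (q', as) \<in> delta M q ss} \<union>
     {(1, ss, 1, map (\<lambda>s. (s, Stay)) ss, True) | ss. ss \<in> reads M \<and> delta M 1 ss = {}}"

definition fires :: "trans \<Rightarrow> config \<Rightarrow> bool" where
  "fires d C \<longleftrightarrow> d \<in> Delta \<and> t_src d = fst C \<and> t_read d = map read (snd C)"

text \<open>An idle transition can fire only in a halted accepting configuration, so demanding one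
  at time \<open>N\<close> expresses acceptance within \<open>N\<close> steps.\<close>

definition run :: "nat \<Rightarrow> bool list \<Rightarrow> (nat \<Rightarrow> trans) \<Rightarrow> (nat \<Rightarrow> config) \<Rightarrow> bool" where
  "run N x ds C \<longleftrightarrow> C 0 = initial M x \<and>
     (\<forall>t\<le>N. fires (ds t) (C t) \<and> C (Suc t) = appl (ds t) (C t)) \<and> t_idle (ds N)"

lemma tm_bounds: "tapes M \<ge> 1" "states M \<ge> 2" "symbols M \<ge> 3"
  using tm by (auto simp: turing_machine_def)

lemma wf_initial: "wf (initial M x)"
  using tm_bounds by (auto simp: wf_def initial_def contents_def nth_Cons')

lemma wf_reads: "wf C \<Longrightarrow> map read (snd C) \<in> reads M"
  by (auto simp: wf_def reads_def read_def in_set_conv_nth) (metis fst_conv)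

lemma Delta_wf:
  assumes "d \<in> Delta"
  shows "t_tgt d < states M" "length (t_act d) = tapes M" "\<And>j. j < tapes M \<Longrightarrow> fst (t_act d ! j) < symbols M"
    "t_read d \<in> reads M" "t_src d < states M"
proof -
  have "t_tgt d < states M \<and> length (t_act d) = tapes M \<and> (\<forall>j<tapes M. fst (t_act d ! j) < symbols M) \<and>
     t_read d \<in> reads M \<and> t_src d < states M"
    using assms unfolding Delta_def
  proof (elim UnE CollectE exE conjE)
    fix q ss q' as
    assume d: "d = (q, ss, q', as, False)" "q < states M" "ss \<in> reads M" "(q', as) \<in> delta M q ss"
    then have *: "q' < states M \<and> length as = tapes M \<and> (\<forall>(s, m)\<in>set as. s < symbols M)"
      using tm unfolding turing_machine_def by fastforce
    moreover have "fst (as ! j) < symbols M" if "j < tapes M" for j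
      using * nth_mem[of j as] that by (cases "as ! j") auto
    ultimately show ?thesis using d by auto
  next
    fix ss assume "d = (1, ss, 1, map (\<lambda>s. (s, Stay)) ss, True)" "ss \<in> reads M" "delta M 1 ss = {}"
    then show ?thesis using tm_bounds by (auto simp: reads_def)
  qed
  then show "t_tgt d < states M" "length (t_act d) = tapes M" "\<And>j. j < tapes M \<Longrightarrow> fst (t_act d ! j) < symbols M"
    "t_read d \<in> reads M" "t_src d < states M" by auto
qed

lemma wf_appl: "wf C \<Longrightarrow> d \<in> Delta \<Longrightarrow> wf (appl d C)"
  using Delta_wf[of d] by (auto simp: wf_def appl_def act_def)

text \<open>What lies at offset \<open>i\<close> after the move was at offset
  \<open>i + t_off d j\<close> before, and the old offset 0 is where the head wrote.\<close>

lemma rel_appl: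
  assumes "wf C" "d \<in> Delta" "j < tapes M"
  shows "rel (appl d C) j i = (if i + t_off d j = 0 then fst (t_act d ! j) else rel C j (i + t_off d j))"
proof -
  have "j < length (snd C)" "j < length (t_act d)" using assms Delta_wf by (auto simp: wf_def)
  moreover have "snd (snd C ! j) + t_off d j + i = snd (snd C ! j) \<longleftrightarrow> i + t_off d j = 0" by auto
  ultimately show ?thesis
    by (auto simp: rel_def appl_def act_def t_off_def algebra_simps)
qed

lemma fires_appl_step:
  assumes "fires d C" "\<not> t_idle d"
  shows "step M C (appl d C)"
  using assms by (fastforce simp: fires_def Delta_def step_def appl_def)

lemma appl_idle:
  assumes "t_idle d" "fires d C"
  shows "appl d C = C" "fst C = 1" "halted M C"
proof -
  from assms obtain ss where d: "d = (1, ss, 1, map (\<lambda>s. (s, Stay)) ss, True)" and del: "delta M 1 ss = {}"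
    by (auto simp: fires_def Delta_def)
  with assms have C: "fst C = 1" "ss = map read (snd C)" by (auto simp: fires_def)
  have "map2 act (snd C) (map (\<lambda>s. (s, Stay)) (map read (snd C))) = snd C"
    by (rule nth_equalityI) (auto simp: act_def read_def)
  then show "appl d C = C" using C d by (cases C) (simp add: appl_def)
  show "fst C = 1" using C by simp
  show "halted M C" using C del by (auto simp: halted_def step_def)
qed

lemma step_fires:
  assumes "step M C C'" "wf C"
  obtains d where "fires d C" "C' = appl d C" "\<not> t_idle d"
proof -
  from assms obtain q' as where *: "(q', as) \<in> delta M (fst C) (map read (snd C))" "C' = (q', map2 act (snd C) as)"
    by (auto simp: step_def)
  let ?d = "(fst C, map read (snd C), q', as, False)"
  have "fires ?d C" using * assms wf_reads by (auto simp: fires_def Delta_def wf_def)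
  then show thesis using that[of ?d] * by (auto simp: appl_def)
qed

text \<open>An accepting computation is extended by the idle transition of its last configuration;
  conversely, a run is cut off at its first idle transition, before which only machine steps
  occur.\<close>

lemma accepts_iff_run:
  assumes time: "\<And>t C. (step M ^^ t) (initial M x) C \<Longrightarrow> t \<le> N"
  shows "(\<exists>t C. (step M ^^ t) (initial M x) C \<and> halted M C \<and> fst C = 1) \<longleftrightarrow> (\<exists>ds C. run N x ds C)"
proof
  assume "\<exists>t C. (step M ^^ t) (initial M x) C \<and> halted M C \<and> fst C = 1"
  then obtain t0 C0 where C0: "(step M ^^ t0) (initial M x) C0" "halted M C0" "fst C0 = 1" by blast
  from C0(1) obtain Cs where Cs: "Cs 0 = initial M x" "Cs t0 = C0" "\<And>i. i < t0 \<Longrightarrow> step M (Cs i) (Cs (Suc i))"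
    unfolding relpowp_fun_conv by blast
  have wf: "t \<le> t0 \<Longrightarrow> wf (Cs t)" for t
  proof (induction t)
    case (Suc t)
    then have "wf (Cs t)" "step M (Cs t) (Cs (Suc t))" using Cs by auto
    then show ?case using wf_appl by (metis step_fires fires_def)
  qed (simp add: Cs wf_initial)
  define d0 :: trans where "d0 = (1, map read (snd C0), 1, map (\<lambda>s. (s, Stay)) (map read (snd C0)), True)"
  have "delta M 1 (map read (snd C0)) = {}"
    using C0(2,3) by (auto simp: halted_def step_def)
  then have d0: "fires d0 C0" "t_idle d0"
    using wf[of t0] Cs(2) C0(3) wf_reads by (auto simp: fires_def Delta_def d0_def)
  have "\<exists>d. fires d (Cs t) \<and> Cs (Suc t) = appl d (Cs t)" if "t < t0" for t
    using step_fires[OF Cs(3)[OF that] wf] that by (metis less_imp_le)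
  then obtain ds where ds: "\<And>t. t < t0 \<Longrightarrow> fires (ds t) (Cs t) \<and> Cs (Suc t) = appl (ds t) (Cs t)" by metis
  have "run N x (\<lambda>t. if t < t0 then ds t else d0) (\<lambda>t. if t < t0 then Cs t else C0)"
    unfolding run_def
  proof (intro conjI allI impI)
    show "t_idle (if N < t0 then ds N else d0)" using time[OF C0(1)] d0 by simp
    fix t
    show "fires (if t < t0 then ds t else d0) (if t < t0 then Cs t else C0)" using ds d0 by auto
    show "(if Suc t < t0 then Cs (Suc t) else C0) =
        appl (if t < t0 then ds t else d0) (if t < t0 then Cs t else C0)"
    proof (cases "t < t0")
      case True
      then have "Suc t < t0 \<or> Suc t = t0" by auto
      then show ?thesis using ds[OF True] True Cs(2) by auto
    qed (use appl_idle[OF d0(2,1)] in auto)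
  qed (use Cs in auto)
  then show "\<exists>ds C. run N x ds C" by blast
next
  assume "\<exists>ds C. run N x ds C"
  then obtain ds C where run: "run N x ds C" by blast
  define t0 where "t0 = (LEAST t. t_idle (ds t))"
  have idle: "t_idle (ds t0)" "t0 \<le> N"
    using run LeastI[of "\<lambda>t. t_idle (ds t)" N] Least_le[of "\<lambda>t. t_idle (ds t)" N]
    by (auto simp: run_def t0_def)
  have "step M (C t) (C (Suc t))" if "t < t0" for t
  proof -
    have "\<not> t_idle (ds t)" using that not_less_Least unfolding t0_def by blast
    then show ?thesis using run that idle(2) fires_appl_step by (auto simp: run_def)
  qed
  then have "(step M ^^ t0) (initial M x) (C t0)"
    unfolding relpowp_fun_conv using run by (intro exI[of _ C]) (auto simp: run_def)
  moreover have "fires (ds t0) (C t0)" using run idle by (auto simp: run_def)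
  ultimately show "\<exists>t C. (step M ^^ t) (initial M x) C \<and> halted M C \<and> fst C = 1"
    using appl_idle[OF idle(1)] by blast
qed


subsection \<open>The tableau as a grid constraint problem\<close>

text \<open>A cell consists of the head mark, the symbols of all tapes in its column and the
  transition of its row. Only the marked cell is scanned, so only there must the symbols agree with
  the transition.\<close>

definition Val :: "(bool \<times> nat list \<times> trans) set" where
  "Val = {(mk, sy, d). sy \<in> reads M \<and> d \<in> Delta \<and> (mk \<longrightarrow> sy = t_read d)}"

text \<open>Direction 1 spreads the transition along a row. Directions 2, 3 and 4 transfer the
  symbols of the tapes whose heads stay, move left and move right. In direction 4 the later cell
  comes first, so the governing transition is that of the second argument.\<close>

fun ok :: "nat \<Rightarrow> bool \<times> nat list \<times> trans \<Rightarrow> bool \<times> nat list \<times> trans \<Rightarrow> bool" where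
  "ok e (mk, sy, d) (mk', sy', d') \<longleftrightarrow>
     (e = 1 \<longrightarrow> d = d') \<and>
     (e = 2 \<longrightarrow> mk = mk' \<and> (mk \<longrightarrow> t_tgt d = t_src d') \<and>
        (\<forall>j<tapes M. t_off d j = 0 \<longrightarrow> sy' ! j = written mk sy d j)) \<and>
     (e = 3 \<longrightarrow> (\<forall>j<tapes M. t_off d j = - 1 \<longrightarrow> sy' ! j = written mk sy d j)) \<and>
     (e = 4 \<longrightarrow> (\<forall>j<tapes M. t_off d' j = 1 \<longrightarrow> sy ! j = written mk' sy' d' j))"

fun start :: "bool \<Rightarrow> nat \<Rightarrow> bool \<times> nat list \<times> trans \<Rightarrow> bool" where
  "start m s (mk, sy, d) \<longleftrightarrow> mk = m \<and> sy = s # replicate (tapes M - 1) 0 \<and> t_src d = 0"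

fun final :: "bool \<times> nat list \<times> trans \<Rightarrow> bool" where
  "final (mk, sy, d) = t_idle d"

lemma finite_Val: "finite Val"
proof -
  let ?As = "{as :: (nat \<times> move) list. set as \<subseteq> {..<symbols M} \<times> UNIV \<and> length as = tapes M}"
  let ?S = "{..<states M} \<times> reads M \<times> {..<states M} \<times> ?As \<times> (UNIV :: bool set)"
  have reads: "finite (reads M)"
    using finite_lists_length_eq[of "{..<symbols M}" "tapes M"]
    by (rule finite_subset[rotated]) (auto simp: reads_def)
  have "(UNIV :: move set) = {Left, Stay, Right}" using move.exhaust by auto
  then have "finite (UNIV :: move set)" by (metis finite.emptyI finite.insertI)
  then have "finite ?As"
    by (intro finite_lists_length_eq) auto
  then have "finite ?S"
    using reads by auto
  moreover have "Delta \<subseteq> ?S"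
  proof
    fix d assume d: "d \<in> Delta"
    obtain q ss q' as fl where e: "d = (q, ss, q', as, fl)" by (metis prod_cases5)
    have "set as \<subseteq> {..<symbols M} \<times> UNIV"
      using Delta_wf(2,3)[OF d] e by (auto simp: in_set_conv_nth) (metis fst_conv)
    then show "d \<in> ?S"
      using Delta_wf[OF d] e by auto
  qed
  ultimately have "finite Delta" by (rule finite_subset[rotated])
  then have "finite ((UNIV :: bool set) \<times> reads M \<times> Delta)" using reads by auto
  then show ?thesis by (rule finite_subset[rotated]) (auto simp: Val_def)
qed

lemma Val_nonempty: "Val \<noteq> {}"
proof -
  let ?ss = "replicate (tapes M) 0"
  have ss: "?ss \<in> reads M" using tm_bounds by (auto simp: reads_def)
  have "\<exists>d\<in>Delta. t_read d = ?ss"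
  proof (cases "delta M 1 ?ss = {}")
    case True
    then show ?thesis using ss by (intro bexI[of _ "(1, ?ss, 1, map (\<lambda>s. (s, Stay)) ?ss, True)"]) (auto simp: Delta_def)
  next
    case False
    then obtain q' as where "(q', as) \<in> delta M 1 ?ss" by auto
    then show ?thesis using ss tm_bounds by (intro bexI[of _ "(1, ?ss, q', as, False)"]) (auto simp: Delta_def)
  qed
  then obtain d where "d \<in> Delta" "t_read d = ?ss" by blast
  then have "(True, ?ss, d) \<in> Val" using ss by (simp add: Val_def)
  then show ?thesis by blast
qed

definition tableau :: "nat \<Rightarrow> bool list \<Rightarrow> (nat \<Rightarrow> nat \<Rightarrow> bool \<times> nat list \<times> trans) \<Rightarrow> bool" where
  "tableau N x v \<longleftrightarrow> (\<forall>t\<le>N. \<forall>c\<le>2 * N. v t c \<in> Val) \<and>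
     (\<forall>t<N. \<forall>c<2 * N. \<forall>e. ok e (v (t + src_t e) c) (v (t + tgt_t e) (c + tgt_c e))) \<and>
     (\<forall>c\<le>2 * N. start (c = N) (contents x (int c - int N)) (v 0 c)) \<and> final (v N N)"

lemma rel_initial: "j < tapes M \<Longrightarrow> rel (initial M x) j i = (if j = 0 then contents x i else 0)"
  by (auto simp: rel_def initial_def nth_Cons' contents_def)

lemma tableau_if_run:
  assumes run: "run N x ds C"
  shows "\<exists>v. tableau N x v"
proof -
  have wf: "t \<le> Suc N \<Longrightarrow> wf (C t)" for t
  proof (induction t)
    case (Suc t)
    then show ?case using run wf_appl by (auto simp: run_def fires_def)
  qed (use run wf_initial in \<open>simp add: run_def\<close>)
  have fires: "fires (ds t) (C t)" and nxt: "C (Suc t) = appl (ds t) (C t)" if "t \<le> N" for t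
    using run that by (auto simp: run_def)
  define sy where "sy t c = map (\<lambda>j. rel (C t) j (int c - int N)) [0..<tapes M]" for t c
  define v where "v t c = (c = N, sy t c, ds t)" for t c
  have center: "sy t N = map read (snd (C t))" if "t \<le> N" for t
    using wf[of t] that by (intro nth_equalityI) (auto simp: sy_def wf_def rel_def read_def)
  have sy_reads: "sy t c \<in> reads M" if "t \<le> N" for t c
    using wf[of t] that by (auto simp: sy_def reads_def wf_def rel_def)
  have Val: "v t c \<in> Val" if "t \<le> N" for t c
    using fires[OF that] sy_reads[OF that] center[OF that] by (auto simp: v_def Val_def fires_def)
  have next_sy: "sy (Suc t) c' ! j = written (c = N) (sy t c) (ds t) j"
    if "t \<le> N" "j < tapes M" "int c = int c' + t_off (ds t) j" for t c c' j
  proof -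
    have eq: "int c' - int N + t_off (ds t) j = int c - int N" using that(3) by simp
    have "rel (C (Suc t)) j (int c' - int N) = (if int c - int N = 0
        then fst (t_act (ds t) ! j) else rel (C t) j (int c - int N))"
      using wf[of t] fires[OF that(1)] rel_appl[of "C t" "ds t" j "int c' - int N"] that
      unfolding nxt[OF that(1)] eq by (auto simp: fires_def)
    then show ?thesis using that(2) by (simp add: sy_def written_def)
  qed
  have "tableau N x v"
    unfolding tableau_def
  proof (intro conjI allI impI)
    fix t c e assume t: "t < N" "c < 2 * N"
    have st: "t_tgt (ds t) = t_src (ds (Suc t))"
      using fires[of "Suc t"] nxt[of t] t by (auto simp: fires_def appl_def)
    show "ok e (v (t + src_t e) c) (v (t + tgt_t e) (c + tgt_c e))"
      using t st next_sy[of t _ c c] next_sy[of t _ c "Suc c"] next_sy[of t _ "Suc c" c]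
      by (auto simp: v_def src_t_def tgt_t_def tgt_c_def)
  next
    fix c assume "c \<le> 2 * N"
    have "t_src (ds 0) = 0" using fires[of 0] run by (auto simp: fires_def run_def initial_def)
    moreover have "sy 0 c = contents x (int c - int N) # replicate (tapes M - 1) 0"
      using run tm_bounds(1)
      by (intro nth_equalityI) (auto simp: sy_def run_def rel_initial nth_Cons')
    ultimately show "start (c = N) (contents x (int c - int N)) (v 0 c)" by (simp add: v_def)
  next
    show "final (v N N)" using run by (simp add: v_def run_def)
  qed (use Val in auto)
  then show ?thesis by blast
qed

lemma run_if_tableau:
  assumes tab: "tableau N x v"
  shows "\<exists>ds C. run N x ds C"
proof -
  define mk where "mk t c = fst (v t c)" for t c
  define sy where "sy t c = fst (snd (v t c))" for t c
  define dd where "dd t c = snd (snd (v t c))" for t c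
  have v: "v t c = (mk t c, sy t c, dd t c)" for t c by (simp add: mk_def sy_def dd_def)
  \<comment> \<open>Horizontal constraints stop before row \<open>N\<close>; reading transitions off
    the middle column gives the right one for the last row as well.\<close>
  define ds where "ds t = dd t N" for t
  define C where "C = rec_nat (initial M x) (\<lambda>t. appl (ds t))"
  have C0: "C 0 = initial M x" and CS: "\<And>t. C (Suc t) = appl (ds t) (C t)" by (auto simp: C_def)
  have Val: "sy t c \<in> reads M" "dd t c \<in> Delta" "mk t c \<Longrightarrow> sy t c = t_read (dd t c)"
    if "t \<le> N" "c \<le> 2 * N" for t c
    using tab that unfolding tableau_def v Val_def by auto
  have ok: "ok e (v (t + src_t e) c) (v (t + tgt_t e) (c + tgt_c e))" if "t < N" "c < 2 * N" for t c e
    using tab that unfolding tableau_def by blast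
  have row: "dd t c = dd t 0" if "t < N" "c \<le> 2 * N" for t c
    using that(2)
  proof (induction c)
    case (Suc c)
    then show ?case using ok[OF that(1), of c 1] by (simp add: v src_t_def tgt_t_def tgt_c_def)
  qed simp
  have dd: "dd t c = ds t" if "t < N" "c \<le> 2 * N" for t c
    using row[OF that] row[OF that(1), of N] by (simp add: ds_def)
  have ds: "t \<le> N \<Longrightarrow> ds t \<in> Delta" for t using Val(2)[of t N] by (simp add: ds_def)
  \<comment> \<open>The part of the tableau known to be correct is a triangle: it loses one column
    on each side per row and shrinks to the middle cell at \<open>t = N\<close>.\<close>
  have inv: "wf (C t) \<and> fst (C t) = t_src (ds t) \<and>
      (\<forall>c. t \<le> c \<and> c + t \<le> 2 * N \<longrightarrow> mk t c = (c = N) \<and> (\<forall>j<tapes M. sy t c ! j = rel (C t) j (int c - int N)))"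
    if "t \<le> N" for t
    using that
  proof (induction t)
    case 0
    have st: "start (c = N) (contents x (int c - int N)) (v 0 c)" if "c \<le> 2 * N" for c
      using tab that unfolding tableau_def by blast
    have "fst (C 0) = t_src (ds 0)"
      using st[of N] unfolding C0 v ds_def by (auto simp: initial_def)
    moreover have "mk 0 c = (c = N) \<and> (\<forall>j<tapes M. sy 0 c ! j = rel (C 0) j (int c - int N))"
      if "c \<le> 2 * N" for c
      using st[OF that] unfolding C0 v by (auto simp: rel_initial nth_Cons')
    ultimately show ?case using wf_initial C0 by auto
  next
    case (Suc t)
    then have t: "t < N" "t \<le> N" by auto
    have wfC: "wf (C t)" and srcC: "fst (C t) = t_src (ds t)"
      and IH: "\<And>c. t \<le> c \<Longrightarrow> c + t \<le> 2 * N \<Longrightarrow> mk t c = (c = N)"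
      and IHs: "\<And>c j. t \<le> c \<Longrightarrow> c + t \<le> 2 * N \<Longrightarrow> j < tapes M \<Longrightarrow> sy t c ! j = rel (C t) j (int c - int N)"
      using Suc by auto
    have wr: "written (mk t c) (sy t c) (ds t) j = rel (C (Suc t)) j (int c' - int N)"
      if "t \<le> c" "c + t \<le> 2 * N" "j < tapes M" "int c = int c' + t_off (ds t) j" for c c' j
    proof -
      have eq: "int c' - int N + t_off (ds t) j = int c - int N" using that by simp
      show ?thesis
        using IH[OF that(1,2)] IHs[OF that(1,2,3)]
        unfolding CS rel_appl[OF wfC ds[OF t(2)] that(3)] eq by (simp add: written_def)
    qed
    have "mk (Suc t) c = (c = N)" "\<And>j. j < tapes M \<Longrightarrow> sy (Suc t) c ! j = rel (C (Suc t)) j (int c - int N)"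
      if c: "Suc t \<le> c" "c + Suc t \<le> 2 * N" for c
    proof -
      have c': "c < 2 * N" "c - 1 < 2 * N" "c \<le> 2 * N" "t \<le> c" "c + t \<le> 2 * N" "Suc (c - 1) = c" using c by auto
      note ok2 = ok[OF t(1) c'(1), of 2] and ok3 = ok[OF t(1) c'(2), of 3] and ok4 = ok[OF t(1) c'(1), of 4]
      show "mk (Suc t) c = (c = N)"
        using ok2 IH[OF c'(4,5)] by (simp add: v src_t_def tgt_t_def tgt_c_def)
      fix j assume j: "j < tapes M"
      consider "t_off (ds t) j = 0" | "t_off (ds t) j = - 1" | "t_off (ds t) j = 1"
        using offset_cases unfolding t_off_def by blast
      then show "sy (Suc t) c ! j = rel (C (Suc t)) j (int c - int N)"
      proof cases
        case 1
        have "sy (Suc t) c ! j = written (mk t c) (sy t c) (ds t) j"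
          using ok2 j 1 dd[OF t(1) c'(3)] by (simp add: v src_t_def tgt_t_def tgt_c_def)
        then show ?thesis using wr[of c j c] c' j 1 by simp
      next
        case 2
        have "sy (Suc t) c ! j = written (mk t (c - 1)) (sy t (c - 1)) (ds t) j"
          using ok3 j 2 dd[OF t(1), of "c - 1"] c' by (simp add: v src_t_def tgt_t_def tgt_c_def)
        then show ?thesis using wr[of "c - 1" j c] c j 2 by simp
      next
        case 3
        have "sy (Suc t) c ! j = written (mk t (Suc c)) (sy t (Suc c)) (ds t) j"
          using ok4 j 3 dd[OF t(1), of "Suc c"] c' by (simp add: v src_t_def tgt_t_def tgt_c_def)
        then show ?thesis using wr[of "Suc c" j c] c j 3 by simp
      qed
    qed
    moreover have "fst (C (Suc t)) = t_src (ds (Suc t))"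
    proof -
      have "N < 2 * N" using t by simp
      from ok[OF t(1) this, of 2] IH[of N] t show ?thesis
        by (simp add: v src_t_def tgt_t_def tgt_c_def CS appl_def ds_def)
    qed
    moreover have "wf (C (Suc t))" unfolding CS by (rule wf_appl[OF wfC ds[OF t(2)]])
    ultimately show ?case by blast
  qed
  have "fires (ds t) (C t)" if t: "t \<le> N" for t
  proof -
    have wfC: "wf (C t)" and m: "mk t N" and s: "\<And>j. j < tapes M \<Longrightarrow> sy t N ! j = rel (C t) j 0"
      using inv[OF t] t by auto
    have "sy t N = map read (snd (C t))"
      using Val(1)[of t N] t wfC s by (intro nth_equalityI) (auto simp: reads_def wf_def rel_def read_def)
    then show ?thesis using Val(3)[of t N] t m ds[OF t] inv[OF t] by (simp add: fires_def ds_def)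
  qed
  moreover have "t_idle (ds N)" using tab unfolding tableau_def v ds_def by simp
  ultimately have "run N x ds C" unfolding run_def using C0 CS by blast
  then show ?thesis by blast
qed

end

section \<open>From languages in NP to grid constraint problems\<close>

lemma poly_bound:
  fixes p :: "nat poly"
  shows "\<exists>e\<ge>1. \<forall>n. poly p n \<le> (n + e) ^ e"
proof (induction p)
  case 0
  then show ?case by (auto intro!: exI[of _ 1])
next
  case (pCons a p)
  then obtain e where e: "e \<ge> 1" "\<And>n. poly p n \<le> (n + e) ^ e" by blast
  let ?e = "e + a + 1"
  have "poly (pCons a p) n \<le> (n + ?e) ^ ?e" for n
  proof -
    have 1: "1 \<le> (n + e) ^ e" using e(1) by simp
    have "poly (pCons a p) n \<le> a + n * (n + e) ^ e" using e(2)[of n] by simp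
    also have "\<dots> \<le> a * (n + e) ^ e + n * (n + e) ^ e" using 1 by simp
    also have "\<dots> = (n + a) * (n + e) ^ e" by (simp add: algebra_simps)
    also have "\<dots> \<le> (n + ?e) * (n + ?e) ^ e" by (intro mult_mono power_mono) auto
    also have "\<dots> = (n + ?e) ^ (e + 1)" by simp
    also have "\<dots> \<le> (n + ?e) ^ ?e" by (rule power_increasing) auto
    finally show ?thesis .
  qed
  then show ?case by (intro exI[of _ ?e]) auto
qed

theorem NP_grid_csp:
  assumes "L \<in> NP"
  shows "\<exists>A bad b0 bF e. A \<ge> 1 \<and> e \<ge> 1 \<and> (\<forall>x. x \<in> L \<longleftrightarrow> grid_csp.sat A bad b0 bF ((length x + e) ^ e) x)"
proof -
  from assms obtain M p where M: "turing_machine M"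
    and time: "\<And>x t C. (step M ^^ t) (initial M x) C \<Longrightarrow> t \<le> poly p (length x)"
    and acc: "\<And>x. x \<in> L \<longleftrightarrow> (\<exists>t C. (step M ^^ t) (initial M x) C \<and> halted M C \<and> fst C = 1)"
    unfolding NP_def by blast
  interpret ntm M by unfold_locales (rule M)
  \<comment> \<open>A power of this form dominates the time bound and can be computed by a fixed
    number of unary multiplications.\<close>
  obtain e where e: "e \<ge> 1" "\<And>n. poly p n \<le> (n + e) ^ e" using poly_bound by blast
  \<comment> \<open>The list numbers the values; repeated entries merely give several numbers to one
    value.\<close>
  obtain vals where vals: "set vals = Val" using finite_list[OF finite_Val] by blast
  define A where "A = length vals"
  define bad where "bad d a b \<longleftrightarrow> \<not> ok d (vals ! a) (vals ! b)" for d a b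
  define b0 where "b0 m s a \<longleftrightarrow> \<not> start m s (vals ! a)" for m s a
  define bF where "bF a \<longleftrightarrow> \<not> final (vals ! a)" for a
  have A: "A \<ge> 1" using Val_nonempty vals by (cases vals) (auto simp: A_def)
  interpret grid_csp A bad b0 bF by unfold_locales (rule A)
  have ok_cases: "ok d u w" if "d \<noteq> 1" "d \<noteq> 2" "d \<noteq> 3" "d \<noteq> 4" for d u w
    using that by (cases u; cases w) simp
  have sat_iff: "sat N x \<longleftrightarrow> (\<exists>v. tableau N x v)" for N x
  proof
    assume "sat N x"
    then obtain f where "(\<forall>t\<le>N. \<forall>c\<le>2 * N. f t c < A) \<and>
        (\<forall>t c d. \<not> conflict N x t c d (f (t + src_t d) c) (f (t + tgt_t d) (c + tgt_c d)))"
      unfolding sat_def by (rule exE)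
    then have f: "\<And>t c. t \<le> N \<Longrightarrow> c \<le> 2 * N \<Longrightarrow> f t c < A"
      and nc: "\<And>t c d. \<not> conflict N x t c d (f (t + src_t d) c) (f (t + tgt_t d) (c + tgt_c d))"
      by simp_all
    have "tableau N x (\<lambda>t c. vals ! f t c)"
      unfolding tableau_def
    proof (intro conjI allI impI)
      show "vals ! f t c \<in> Val" if "t \<le> N" "c \<le> 2 * N" for t c
        using nth_mem[of "f t c" vals] f[OF that] unfolding A_def vals .
      show "ok d (vals ! f (t + src_t d) c) (vals ! f (t + tgt_t d) (c + tgt_c d))" if tc: "t < N" "c < 2 * N" for t c d
      proof (cases "1 \<le> d \<and> d \<le> 4")
        case True
        have "f (t + src_t d) c < A" "f (t + tgt_t d) (c + tgt_c d) < A"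
          by (rule f; use tc in \<open>simp add: src_t_def tgt_t_def tgt_c_def\<close>)+
        then show ?thesis using nc[of t c d] True tc by (auto simp: conflict_def bad_def)
      qed (rule ok_cases; auto)
      show "start (c = N) (contents x (int c - int N)) (vals ! f 0 c)" if "c \<le> 2 * N" for c
        using nc[of 0 c 0] that f[of 0 c] by (auto simp: conflict_def b0_def src_t_def tgt_t_def tgt_c_def)
      show "final (vals ! f N N)"
        using nc[of N N 0] f[of N N] by (auto simp: conflict_def bF_def src_t_def tgt_t_def tgt_c_def)
    qed
    then show "\<exists>v. tableau N x v" by blast
  next
    assume "\<exists>v. tableau N x v"
    then obtain v where v: "tableau N x v" by blast
    have "\<exists>a<A. vals ! a = v t c" if "t \<le> N" "c \<le> 2 * N" for t c
    proof -
      have "v t c \<in> set vals" using v that by (simp add: tableau_def vals)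
      then show ?thesis by (auto simp: in_set_conv_nth A_def)
    qed
    then obtain f where f: "\<And>t c. t \<le> N \<Longrightarrow> c \<le> 2 * N \<Longrightarrow> f t c < A \<and> vals ! f t c = v t c" by metis
    have "\<not> conflict N x t c d (f (t + src_t d) c) (f (t + tgt_t d) (c + tgt_c d))" for t c d
    proof
      assume *: "conflict N x t c d (f (t + src_t d) c) (f (t + tgt_t d) (c + tgt_c d))"
      note dom = conflict_dom(4-7)[OF *]
      have eq: "vals ! f (t + src_t d) c = v (t + src_t d) c"
        "vals ! f (t + tgt_t d) (c + tgt_c d) = v (t + tgt_t d) (c + tgt_c d)"
        using f dom by auto
      show False
      proof (cases "d = 0")
        case True
        have "c \<le> 2 * N \<Longrightarrow> start (c = N) (contents x (int c - int N)) (v 0 c)" "final (v N N)"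
          using v by (auto simp: tableau_def)
        with True show ?thesis using * eq
          by (auto simp: conflict_def b0_def bF_def src_t_def tgt_t_def tgt_c_def)
      next
        case False
        have "t < N \<Longrightarrow> c < 2 * N \<Longrightarrow> ok d (v (t + src_t d) c) (v (t + tgt_t d) (c + tgt_c d))"
          using v unfolding tableau_def by blast
        with False show ?thesis using * unfolding conflict_def bad_def eq by simp
      qed
    qed
    then show "sat N x" unfolding sat_def using f by (intro exI[of _ f]) auto
  qed
  have "x \<in> L \<longleftrightarrow> sat ((length x + e) ^ e) x" for x
  proof -
    have "x \<in> L \<longleftrightarrow> (\<exists>ds C. run ((length x + e) ^ e) x ds C)"
      unfolding acc by (rule accepts_iff_run) (use time e(2) le_trans in blast)
    also have "\<dots> \<longleftrightarrow> sat ((length x + e) ^ e) x"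
      unfolding sat_iff using tableau_if_run run_if_tableau by blast
    finally show ?thesis .
  qed
  with A e(1) show ?thesis by blast
qed


section \<open>The instances\<close>

definition grid_list :: "nat \<Rightarrow> nat \<Rightarrow> (nat \<Rightarrow> nat \<Rightarrow> 'a list) \<Rightarrow> 'a list" where
  "grid_list n m h = concat (map (\<lambda>t. concat (map (h t) [0..<m])) [0..<n])"

lemma set_grid_list: "set (grid_list n m h) = (\<Union>t<n. \<Union>c<m. set (h t c))"
  by (simp add: grid_list_def atLeast0LessThan)

text \<open>A displacement from the current cell together with the constant part of a name. The
  lists of templates depend only on the constraint problem and \<open>l\<close>, so programs can
  contain them, and only the cell is supplied at run time.\<close>

type_synonym vtemplate = "nat \<times> nat \<times> nat"

definition at_v :: "nat \<Rightarrow> nat \<Rightarrow> vtemplate \<Rightarrow> nat" where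
  "at_v t c = (\<lambda>(dt, dc, z). name (t + dt) (c + dc) z)"

definition at_e :: "nat \<Rightarrow> nat \<Rightarrow> vtemplate \<times> vtemplate \<Rightarrow> nat \<times> nat" where
  "at_e t c = (\<lambda>(p, q). (at_v t c p, at_v t c q))"

locale reduction = grid_csp +
  fixes l :: nat
  assumes l: "l \<ge> 4"
begin

definition vertT :: "vtemplate list" where
  "vertT = [(0, 0, zid a p r). a \<leftarrow> [0..<A], p \<leftarrow> [0..<Suc (2 * half)], r \<leftarrow> [0..<l - 2]]"

text \<open>These edges are the same in every cell: tails, value paths and the exclusion of two
  different values. Conflict edges join ports of colors 0 and 1, hence the color 2.\<close>

definition cellT :: "nat \<Rightarrow> (vtemplate \<times> vtemplate) list" where
  "cellT i =
     [((0, 0, zid a p r), (0, 0, zid a p (Suc r))). a \<leftarrow> [0..<A], p \<leftarrow> [0..<Suc (2 * half)],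
        r \<leftarrow> [0..<l - 3], (if r = 0 then pcol p else r + 2) = i] @
     [((0, 0, zid a p 0), (0, 0, zid a (Suc p) 0)). a \<leftarrow> [0..<A], p \<leftarrow> [0..<2 * half],
        3 - (pcol p + pcol (Suc p)) = i] @
     [((0, 0, zid a (outp 0 b) 0), (0, 0, zid b (inp 0 a) 0)). a \<leftarrow> [0..<A], b \<leftarrow> [0..<A],
        a \<noteq> b \<and> i = 2]"

definition confT :: "(vtemplate \<times> vtemplate) list" where
  "confT = [((src_t d, 0, zid a (outp d b) 0), (tgt_t d, tgt_c d, zid b (inp d a) 0)).
     d \<leftarrow> [1..<5], a \<leftarrow> [0..<A], b \<leftarrow> [0..<A], bad d a b]"

definition unaryT :: "(nat \<Rightarrow> bool) \<Rightarrow> (vtemplate \<times> vtemplate) list" where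
  "unaryT P = [((0, 0, zid a (outp 0 a) 0), (0, 0, zid a (inp 0 a) 0)). a \<leftarrow> [0..<A], P a]"

definition starV :: "nat list" where "starV = map star [0..<17]"

definition starL :: "(nat \<times> nat) list" where "starL = map (\<lambda>j. (star 0, star (Suc j))) [0..<16]"

definition vertL :: "nat \<Rightarrow> nat list" where
  "vertL N = grid_list (N + 1) (2 * N + 1) (\<lambda>t c. map (at_v t c) vertT) @ starV"

text \<open>The only edges that depend on the bits of the input and not just on its length.\<close>

definition startL :: "nat \<Rightarrow> bool list \<Rightarrow> (nat \<times> nat) list" where
  "startL N x = concat (map (\<lambda>c. map (at_e 0 c) (unaryT (b0 (c = N) (contents x (int c - int N))))) [0..<2 * N + 1])"

definition classL :: "nat \<Rightarrow> bool list \<Rightarrow> nat \<Rightarrow> (nat \<times> nat) list" where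
  "classL N x i = grid_list (N + 1) (2 * N + 1) (\<lambda>t c. map (at_e t c) (cellT i)) @
     (if i = 0 then starL else []) @
     (if i = 2 then grid_list N (2 * N) (\<lambda>t c. map (at_e t c) confT) @ startL N x @ map (at_e N N) (unaryT bF)
      else [])"

definition instance_of :: "nat \<Rightarrow> bool list \<Rightarrow> inst" where
  "instance_of N x = (vertL N, map (classL N x) [0..<l - 1], budget N)"

section \<open>Agreement of the lists with the color classes\<close>

definition pair_set :: "nat \<times> nat \<Rightarrow> nat set" where
  "pair_set = (\<lambda>(u, v). {u, v})"

lemma pair_set_at_e: "pair_set (at_e t c (p, q)) = {at_v t c p, at_v t c q}"
  by (simp add: pair_set_def at_e_def)

lemma pair_set_grid:
  "pair_set ` set (grid_list n m (\<lambda>t c. map (at_e t c) T)) =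
     {pair_set (at_e t c e) | t c e. t < n \<and> c < m \<and> e \<in> set T}"
  unfolding set_grid_list set_map by blast

lemma pair_set_startL:
  "pair_set ` set (startL N x) =
     {pair_set (at_e 0 c e) | c e. c < 2 * N + 1 \<and> e \<in> set (unaryT (b0 (c = N) (contents x (int c - int N))))}"
  unfolding startL_def set_concat set_map image_image image_UN set_upt atLeast0LessThan by blast

definition spineS :: "nat \<Rightarrow> nat \<Rightarrow> nat set set" where
  "spineS N i = {{name t c (zid a p r), name t c (zid a p (Suc r))} | t c a p r.
     t \<le> N \<and> c \<le> 2 * N \<and> a < A \<and> p \<le> 2 * half \<and> r < l - 3 \<and> (if r = 0 then pcol p else r + 2) = i}"

definition pathS :: "nat \<Rightarrow> nat \<Rightarrow> nat set set" where
  "pathS N i = {{name t c (zid a p 0), name t c (zid a (Suc p) 0)} | t c a p.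
     t \<le> N \<and> c \<le> 2 * N \<and> a < A \<and> p < 2 * half \<and> 3 - (pcol p + pcol (Suc p)) = i}"

definition conf_edge :: "nat \<Rightarrow> nat \<Rightarrow> nat \<Rightarrow> nat \<Rightarrow> nat \<Rightarrow> nat set" where
  "conf_edge t c d a b = {name (t + src_t d) c (zid a (outp d b) 0), name (t + tgt_t d) (c + tgt_c d) (zid b (inp d a) 0)}"

definition confS :: "nat \<Rightarrow> bool list \<Rightarrow> nat \<Rightarrow> nat set set" where
  "confS N x i = {conf_edge t c d a b | t c d a b. i = 2 \<and> conflict N x t c d a b}"

definition distinctS :: "nat \<Rightarrow> nat \<Rightarrow> nat set set" where
  "distinctS N i = {conf_edge t c 0 a b | t c a b. t \<le> N \<and> c \<le> 2 * N \<and> a < A \<and> b < A \<and> a \<noteq> b \<and> i = 2}"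

lemma pair_set_conf_edge:
  "pair_set (at_e t c ((src_t d, 0, zid a (outp d b) 0), (tgt_t d, tgt_c d, zid b (inp d a) 0))) = conf_edge t c d a b"
  "pair_set (at_e t c ((0, 0, zid a (outp 0 b) 0), (0, 0, zid b (inp 0 a) 0))) = conf_edge t c 0 a b"
  by (simp_all add: conf_edge_def src_t_def tgt_t_def tgt_c_def pair_set_at_e at_v_def)

definition starS :: "nat \<Rightarrow> nat set set" where
  "starS i = {{star 0, star (Suc j)} | j. i = 0 \<and> j < 16}"

lemma set_cellT:
  "pair_set ` set (grid_list (N + 1) (2 * N + 1) (\<lambda>t c. map (at_e t c) (cellT i))) =
     spineS N i \<union> pathS N i \<union> distinctS N i" (is "?L = ?R1 \<union> ?R2 \<union> ?R3")
proof -
  have "pair_set (at_e t c e) \<in> ?R1 \<union> ?R2 \<union> ?R3" if "t \<le> N" "c \<le> 2 * N" "e \<in> set (cellT i)" for t c e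
  proof -
    from that(3) consider
      (1) a p r where "a < A" "p \<le> 2 * half" "r < l - 3" "(if r = 0 then pcol p else r + 2) = i"
        "e = ((0, 0, zid a p r), (0, 0, zid a p (Suc r)))"
    | (2) a p where "a < A" "p < 2 * half" "3 - (pcol p + pcol (Suc p)) = i"
        "e = ((0, 0, zid a p 0), (0, 0, zid a (Suc p) 0))"
    | (3) a b where "a < A" "b < A" "a \<noteq> b" "i = 2"
        "e = ((0, 0, zid a (outp 0 b) 0), (0, 0, zid b (inp 0 a) 0))"
      unfolding cellT_def by (auto split: if_splits)
    then show ?thesis
    proof cases
      case 1
      then have "pair_set (at_e t c e) \<in> ?R1" using that(1,2) unfolding spineS_def
        by (intro CollectI exI[of _ t] exI[of _ c] exI[of _ a] exI[of _ p] exI[of _ r]) (simp add: pair_set_at_e at_v_def)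
      then show ?thesis by blast
    next
      case 2
      then have "pair_set (at_e t c e) \<in> ?R2" using that(1,2) unfolding pathS_def
        by (intro CollectI exI[of _ t] exI[of _ c] exI[of _ a] exI[of _ p]) (simp add: pair_set_at_e at_v_def)
      then show ?thesis by blast
    next
      case 3
      then have "pair_set (at_e t c e) \<in> ?R3" using that(1,2) unfolding distinctS_def 3(5) pair_set_conf_edge by blast
      then show ?thesis by blast
    qed
  qed
  then have s0: "?L \<subseteq> ?R1 \<union> ?R2 \<union> ?R3" unfolding pair_set_grid Suc_eq_plus1[symmetric] less_Suc_eq_le by blast
  have mem: "pair_set (at_e t c e) \<in> ?L" if "t \<le> N" "c \<le> 2 * N" "e \<in> set (cellT i)" for t c e
    unfolding pair_set_grid Suc_eq_plus1[symmetric] less_Suc_eq_le using that by blast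
  have s1: "?R1 \<subseteq> ?L"
  proof
    fix s assume "s \<in> ?R1"
    then obtain t c a p r where *: "s = {name t c (zid a p r), name t c (zid a p (Suc r))}"
      "t \<le> N" "c \<le> 2 * N" "a < A" "p \<le> 2 * half" "r < l - 3" "(if r = 0 then pcol p else r + 2) = i"
      unfolding spineS_def by blast
    have "((0, 0, zid a p r), (0, 0, zid a p (Suc r))) \<in> set (cellT i)"
      using * unfolding cellT_def by (auto simp: less_Suc_eq_le image_iff split: if_splits)
    from mem[OF *(2,3) this] show "s \<in> ?L" unfolding *(1) by (simp add: pair_set_at_e at_v_def)
  qed
  have s2: "?R2 \<subseteq> ?L"
  proof
    fix s assume "s \<in> ?R2"
    then obtain t c a p where *: "s = {name t c (zid a p 0), name t c (zid a (Suc p) 0)}"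
      "t \<le> N" "c \<le> 2 * N" "a < A" "p < 2 * half" "3 - (pcol p + pcol (Suc p)) = i"
      unfolding pathS_def by blast
    have "((0, 0, zid a p 0), (0, 0, zid a (Suc p) 0)) \<in> set (cellT i)"
      using * unfolding cellT_def by (auto simp: image_iff split: if_splits)
    from mem[OF *(2,3) this] show "s \<in> ?L" unfolding *(1) by (simp add: pair_set_at_e at_v_def)
  qed
  have s3: "?R3 \<subseteq> ?L"
  proof
    fix s assume "s \<in> ?R3"
    then obtain t c a b where *: "s = conf_edge t c 0 a b"
      "t \<le> N" "c \<le> 2 * N" "a < A" "b < A" "a \<noteq> b" "i = 2"
      unfolding distinctS_def by blast
    have "((0, 0, zid a (outp 0 b) 0), (0, 0, zid b (inp 0 a) 0)) \<in> set (cellT i)"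
      using * unfolding cellT_def by (auto simp: image_iff split: if_splits)
    from mem[OF *(2,3) this] show "s \<in> ?L" unfolding *(1) pair_set_conf_edge .
  qed
  show ?thesis by (intro equalityI Un_least s0 s1 s2 s3)
qed

lemma unaryT_iff: "e \<in> set (unaryT P) \<longleftrightarrow> (\<exists>a<A. P a \<and> e = ((0, 0, zid a (outp 0 a) 0), (0, 0, zid a (inp 0 a) 0)))"
  unfolding unaryT_def by auto

lemma confT_iff: "e \<in> set confT \<longleftrightarrow> (\<exists>d a b. 1 \<le> d \<and> d \<le> 4 \<and> a < A \<and> b < A \<and> bad d a b \<and>
    e = ((src_t d, 0, zid a (outp d b) 0), (tgt_t d, tgt_c d, zid b (inp d a) 0)))"
  unfolding confT_def by (auto split: if_splits)

text \<open>Conflicts of direction 0 are split into pairs of different values, which occur in every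
  cell, and pairs of equal values, which stem from row 0 and from the cell
  \<open>(N, N)\<close>.\<close>

lemma set_confS:
  "confS N x i = distinctS N i \<union>
     (if i = 2 then pair_set ` set (grid_list N (2 * N) (\<lambda>t c. map (at_e t c) confT)) \<union>
        pair_set ` set (startL N x) \<union> pair_set ` set (map (at_e N N) (unaryT bF)) else {})"
    (is "_ = _ \<union> (if _ then ?R1 \<union> ?R2 \<union> ?R3 else _)")
proof (cases "i = 2")
  case True
  have S: "confS N x i = {conf_edge t c d a b | t c d a b. conflict N x t c d a b}"
    unfolding confS_def using True by simp
  have R0: "distinctS N i = {conf_edge t c 0 a b | t c a b. t \<le> N \<and> c \<le> 2 * N \<and> a < A \<and> b < A \<and> a \<noteq> b}"
    unfolding distinctS_def using True by simp
  have R1: "?R1 = {conf_edge t c d a b | t c d a b. t < N \<and> c < 2 * N \<and> 1 \<le> d \<and> d \<le> 4 \<and> a < A \<and> b < A \<and> bad d a b}"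
    (is "_ = ?T1")
  proof (intro equalityI subsetI)
    fix s assume "s \<in> ?R1"
    then obtain t c e where *: "t < N" "c < 2 * N" "e \<in> set confT" "s = pair_set (at_e t c e)"
      unfolding pair_set_grid by blast
    then show "s \<in> ?T1" unfolding confT_iff using pair_set_conf_edge by blast
  next
    fix s assume "s \<in> ?T1"
    then obtain t c d a b where *: "s = conf_edge t c d a b" "t < N" "c < 2 * N" "1 \<le> d" "d \<le> 4" "a < A" "b < A" "bad d a b" by blast
    then have "((src_t d, 0, zid a (outp d b) 0), (tgt_t d, tgt_c d, zid b (inp d a) 0)) \<in> set confT"
      unfolding confT_iff by blast
    then show "s \<in> ?R1" unfolding *(1) pair_set_conf_edge(1)[symmetric] pair_set_grid using *(2,3) by blast
  qed
  have R2: "?R2 = {conf_edge 0 c 0 a a | c a. c \<le> 2 * N \<and> a < A \<and> b0 (c = N) (contents x (int c - int N)) a}"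
    (is "_ = ?T2")
  proof (intro equalityI subsetI)
    fix s assume "s \<in> ?R2"
    then obtain c e where *: "c \<le> 2 * N" "e \<in> set (unaryT (b0 (c = N) (contents x (int c - int N))))"
        "s = pair_set (at_e 0 c e)"
      unfolding pair_set_startL Suc_eq_plus1[symmetric] less_Suc_eq_le by blast
    then show "s \<in> ?T2" unfolding unaryT_iff using pair_set_conf_edge by blast
  next
    fix s assume "s \<in> ?T2"
    then obtain c a where *: "s = conf_edge 0 c 0 a a" "c \<le> 2 * N" "a < A" "b0 (c = N) (contents x (int c - int N)) a" by blast
    then have "((0, 0, zid a (outp 0 a) 0), (0, 0, zid a (inp 0 a) 0)) \<in> set (unaryT (b0 (c = N) (contents x (int c - int N))))"
      unfolding unaryT_iff by blast
    then show "s \<in> ?R2" unfolding *(1) pair_set_conf_edge(2)[symmetric] pair_set_startL Suc_eq_plus1[symmetric] less_Suc_eq_le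
      using *(2) by blast
  qed
  have R3: "?R3 = {conf_edge N N 0 a a | a. a < A \<and> bF a}" (is "_ = ?T3")
  proof (intro equalityI subsetI)
    fix s assume "s \<in> ?R3"
    then obtain e where *: "e \<in> set (unaryT bF)" "s = pair_set (at_e N N e)" by auto
    then show "s \<in> ?T3" unfolding unaryT_iff using pair_set_conf_edge by blast
  next
    fix s assume "s \<in> ?T3"
    then obtain a where *: "s = conf_edge N N 0 a a" "a < A" "bF a" by blast
    then have "((0, 0, zid a (outp 0 a) 0), (0, 0, zid a (inp 0 a) 0)) \<in> set (unaryT bF)"
      unfolding unaryT_iff by blast
    then show "s \<in> ?R3" unfolding *(1) pair_set_conf_edge(2)[symmetric] by (intro imageI) auto
  qed
  have XY: "{conf_edge t c d a b | t c d a b. conflict N x t c d a b} =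
      {conf_edge t c 0 a b | t c a b. t \<le> N \<and> c \<le> 2 * N \<and> a < A \<and> b < A \<and> a \<noteq> b} \<union>
      ({conf_edge t c d a b | t c d a b. t < N \<and> c < 2 * N \<and> 1 \<le> d \<and> d \<le> 4 \<and> a < A \<and> b < A \<and> bad d a b} \<union>
      {conf_edge 0 c 0 a a | c a. c \<le> 2 * N \<and> a < A \<and> b0 (c = N) (contents x (int c - int N)) a} \<union>
      {conf_edge N N 0 a a | a. a < A \<and> bF a})" (is "?X = ?Y")
  proof (intro equalityI subsetI)
    fix s assume "s \<in> ?X"
    then obtain t c d a b where *: "s = conf_edge t c d a b" "conflict N x t c d a b" by blast
    show "s \<in> ?Y"
    proof (cases "d = 0")
      case True
      then show ?thesis using * unfolding conflict_def by (cases "a = b") auto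
    next
      case False
      then have "1 \<le> d" by simp
      then show ?thesis using * False unfolding conflict_def by auto
    qed
  next
    fix s assume "s \<in> ?Y"
    then consider
      t c a b where "s = conf_edge t c 0 a b" "conflict N x t c 0 a b"
    | t c d a b where "s = conf_edge t c d a b" "conflict N x t c d a b"
    | c a where "s = conf_edge 0 c 0 a a" "conflict N x 0 c 0 a a"
    | a where "s = conf_edge N N 0 a a" "conflict N x N N 0 a a"
      unfolding conflict_def by fastforce
    then show "s \<in> ?X" by cases blast+
  qed
  show ?thesis unfolding if_P[OF True] S R0 R1 R2 R3 by (rule XY)
qed (simp add: confS_def distinctS_def)

lemma set_classL: "pair_set ` set (classL N x i) = spineS N i \<union> pathS N i \<union> confS N x i \<union> starS i"
proof -
  have "pair_set ` set (if i = 0 then starL else []) = starS i"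
    by (auto simp: starL_def starS_def pair_set_def)
  then show ?thesis
    unfolding classL_def set_append image_Un set_cellT set_confS by (cases "i = 2") auto
qed

interpretation G: cover_graph "U N" "R N x" col nm star l for N x
  by (rule cover_graph_R[OF l])

lemma cls_eq: "G.cls N x i = spineS N i \<union> pathS N i \<union> confS N x i \<union> starS i"
proof -
  have "{{nm u r, nm u (Suc r)} | u r. u \<in> U N \<and> r < l - 3 \<and> G.scol u r = i} = spineS N i"
    (is "?L = ?R")
  proof (intro equalityI subsetI)
    fix s assume "s \<in> ?L"
    then obtain t c a p r where *: "s = {nm (t, c, a, p) r, nm (t, c, a, p) (Suc r)}" "(t, c, a, p) \<in> U N"
      "r < l - 3" "G.scol (t, c, a, p) r = i" by auto
    have "t \<le> N \<and> c \<le> 2 * N \<and> a < A \<and> p \<le> 2 * half \<and> r < l - 3 \<and> (if r = 0 then pcol p else r + 2) = i"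
      "s = {name t c (zid a p r), name t c (zid a p (Suc r))}"
      using *[unfolded G.scol_def] by (auto simp add: U_def nm_def col_def split: if_splits)
    then show "s \<in> ?R" unfolding spineS_def by blast
  next
    fix s assume "s \<in> ?R"
    then obtain t c a p r where *: "s = {name t c (zid a p r), name t c (zid a p (Suc r))}"
      "t \<le> N" "c \<le> 2 * N" "a < A" "p \<le> 2 * half" "r < l - 3" "(if r = 0 then pcol p else r + 2) = i"
      unfolding spineS_def by blast
    then show "s \<in> ?L" unfolding G.scol_def
      by (intro CollectI exI[of _ "(t, c, a, p)"] exI[of _ r]) (auto simp: U_def nm_def col_def split: if_splits)
  qed
  moreover have "{{nm u 0, nm v 0} | u v. R N x u v \<and> 3 - (col u + col v) = i} = pathS N i \<union> confS N x i" (is "?L = ?R")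
  proof -
    have conf_col: "3 - (col u + col v) = 2" if "confE N x u v" for u v
    proof -
      from that obtain t c d a b where c: "conflict N x t c d a b" and
        uv: "u = (t + src_t d, c, a, outp d b)" "v = (t + tgt_t d, c + tgt_c d, b, inp d a)"
        unfolding confE_def by blast
      show ?thesis using port_cols[OF conflict_dom(3,2)[OF c]] uv by (simp add: col_def)
    qed
    have path_in: "{nm u 0, nm v 0} \<in> ?R" if "pathE N u v" "3 - (col u + col v) = i" for u v
      using that unfolding pathE_def pathS_def nm_def col_def by auto
    have conf_in: "{nm u 0, nm v 0} \<in> ?R" if "confE N x u v" "3 - (col u + col v) = i" for u v
    proof -
      have "i = 2" using conf_col[OF that(1)] that(2) by simp
      then show ?thesis using that(1) unfolding confE_def confS_def nm_def conf_edge_def by auto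
    qed
    have s0: "?L \<subseteq> ?R"
    proof
      fix s assume "s \<in> ?L"
      then obtain u v where s: "s = {nm u 0, nm v 0}" "R N x u v" "3 - (col u + col v) = i" by blast
      have i: "3 - (col v + col u) = i" using s(3) by (simp add: add.commute)
      from s(2) show "s \<in> ?R"
        unfolding R_def
        using path_in[OF _ s(3)] path_in[OF _ i] conf_in[OF _ s(3)] conf_in[OF _ i] s(1)
        by (metis insert_commute)
    qed
    have s1: "pathS N i \<subseteq> ?L"
    proof
      fix s assume "s \<in> pathS N i"
      then obtain t c a p where *: "s = {name t c (zid a p 0), name t c (zid a (Suc p) 0)}"
        "t \<le> N" "c \<le> 2 * N" "a < A" "p < 2 * half" "3 - (pcol p + pcol (Suc p)) = i"
        unfolding pathS_def by blast
      have "pathE N (t, c, a, p) (t, c, a, Suc p)" using * unfolding pathE_def by blast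
      then have "R N x (t, c, a, p) (t, c, a, Suc p)" by (rule pathE_R)
      then show "s \<in> ?L" using * by (intro CollectI exI[of _ "(t, c, a, p)"] exI[of _ "(t, c, a, Suc p)"])
          (simp add: nm_def col_def)
    qed
    have s2: "confS N x i \<subseteq> ?L"
    proof
      fix s assume "s \<in> confS N x i"
      then obtain t c d a b where *: "s = conf_edge t c d a b" "i = 2" "conflict N x t c d a b"
        unfolding confS_def by blast
      let ?u = "(t + src_t d, c, a, outp d b)" and ?v = "(t + tgt_t d, c + tgt_c d, b, inp d a)"
      have "confE N x ?u ?v" using * unfolding confE_def by blast
      then show "s \<in> ?L" using * conf_col[of ?u ?v] confE_R[of N x ?u ?v]
        by (intro CollectI exI[of _ ?u] exI[of _ ?v]) (simp add: nm_def conf_edge_def)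
    qed
    show ?thesis by (intro equalityI Un_least s0 s1 s2)
  qed
  ultimately show ?thesis unfolding G.cls_def starS_def by (simp only: Un_assoc)
qed

lemma inst_graph_instance: "inst_graph (instance_of N x) = G.graph N x"
proof -
  have "set (vertL N) = {nm u r | u r. u \<in> U N \<and> r < l - 2} \<union> star ` {..16}"
  proof -
    have "set (grid_list (N + 1) (2 * N + 1) (\<lambda>t c. map (at_v t c) vertT)) = {nm u r | u r. u \<in> U N \<and> r < l - 2}"
      (is "?L = ?R")
    proof (intro equalityI subsetI)
      fix s assume "s \<in> ?L"
      then obtain t c a p r where "t \<le> N" "c \<le> 2 * N" "a < A" "p \<le> 2 * half" "r < l - 2" "s = name t c (zid a p r)"
        unfolding set_grid_list vertT_def by (auto simp: at_v_def less_Suc_eq_le simp del: upt_Suc)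
      then show "s \<in> ?R"
        by (intro CollectI exI[of _ "(t, c, a, p)"] exI[of _ r]) (simp add: U_def nm_def)
    next
      fix s assume "s \<in> ?R"
      then obtain t c a p r where *: "t \<le> N" "c \<le> 2 * N" "a < A" "p \<le> 2 * half" "r < l - 2" "s = name t c (zid a p r)"
        unfolding U_def nm_def by auto
      then have "(0, 0, zid a p r) \<in> set vertT"
        unfolding vertT_def by (auto simp: less_Suc_eq_le image_iff simp del: upt_Suc)
      then have "at_v t c (0, 0, zid a p r) \<in> ?L"
        unfolding set_grid_list set_map Suc_eq_plus1[symmetric] lessThan_Suc_atMost using *(1,2) by blast
      then show "s \<in> ?L" using * by (simp add: at_v_def)
    qed
    moreover have "set starV = star ` {..16}" unfolding starV_def
      by (simp add: atLeast0LessThan lessThan_Suc_atMost[symmetric] del: upt_Suc)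
    ultimately show ?thesis unfolding vertL_def by simp
  qed
  moreover have "map (\<lambda>es. pair_set ` set es) (map (classL N x) [0..<l - 1]) = map (G.cls N x) [0..<l - 1]"
    unfolding cls_eq set_classL[symmetric] by simp
  ultimately show ?thesis by (simp add: inst_graph_def instance_of_def G.graph_def pair_set_def)
qed

theorem instance_correct:
  "instance_of N x \<in> {I \<in> path_deletion_instances (l - 1). max_degree (inst_graph I) = 16}"
  "instance_of N x \<in> colored_path_deletion (l - 1) l \<longleftrightarrow> sat N x"
proof -
  have "inst_bound (instance_of N x) = budget N" by (simp add: inst_bound_def instance_of_def)
  then show "instance_of N x \<in> {I \<in> path_deletion_instances (l - 1). max_degree (inst_graph I) = 16}"
    "instance_of N x \<in> colored_path_deletion (l - 1) l \<longleftrightarrow> sat N x"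
    unfolding path_deletion_instances_def colored_path_deletion_def
    unfolding sat_iff_cover mem_Collect_eq inst_graph_instance G.deletable_iff_cover[symmetric]
    using G.colored G.max_degree_graph by simp_all
qed

end


section \<open>Programs that print grids\<close>

lemma runs_weaken: "runs c s t s1 \<Longrightarrow> s1 = s' \<Longrightarrow> t \<le> t' \<Longrightarrow> runs c s t' s'"
  unfolding runs_def by (meson le_trans)

lemma runs_start: "s0 = s \<Longrightarrow> runs c s t s' \<Longrightarrow> runs c s0 t s'"
  by simp

lemma runs_Skip: "runs Skip s 0 s"
  unfolding runs_def by (blast intro: exec.intros)

lemma runs_Push: "runs (Push r b) (s, out) 2 (s[r := b # s ! r], out)"
  unfolding runs_def by (blast intro: exec.intros)

lemma runs_Pop: "runs (Pop r) (s, out) 1 (s[r := tl (s ! r)], out)"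
  unfolding runs_def by (blast intro: exec.intros)

lemma runs_Out: "runs (Out b) (s, out) 1 (s, out @ [b])"
  unfolding runs_def by (blast intro: exec.intros)

lemma runs_Seq: "runs c1 s t1 s' \<Longrightarrow> runs c2 s' t2 s'' \<Longrightarrow> runs (c1 ;; c2) s (t1 + t2) s''"
  unfolding runs_def by (meson add_mono exec_Seq)

lemma runs_Cond:
  assumes "P (top_sym (fst s ! r)) \<Longrightarrow> runs c1 s t s'" "\<not> P (top_sym (fst s ! r)) \<Longrightarrow> runs c2 s t s'"
  shows "runs (Cond r P c1 c2) s (t + 2) s'"
proof (cases "P (top_sym (fst s ! r))")
  case True
  then obtain t' where "t' \<le> t" "exec c1 s t' s'" using assms(1) by (auto simp: runs_def)
  then show ?thesis unfolding runs_def using exec_CondT[of P s r, OF True] by (intro exI[of _ "t' + 2"]) auto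
next
  case False
  then obtain t' where "t' \<le> t" "exec c2 s t' s'" using assms(2) by (auto simp: runs_def)
  then show ?thesis unfolding runs_def using exec_CondF[of P s r, OF False] by (intro exI[of _ "t' + 1"]) auto
qed

text \<open>The function \<open>st\<close> lists the states between iterations and takes the place
  of a loop invariant.\<close>

lemma runs_While:
  assumes "\<And>i. i < n \<Longrightarrow> P (top_sym (fst (st i) ! r))" "\<And>i. i < n \<Longrightarrow> runs c (st i) T (st (Suc i))"
    "\<not> P (top_sym (fst (st n) ! r))"
  shows "runs (While r P c) (st 0) (n * (T + 2) + 1) (st n)"
  using assms
proof (induction n arbitrary: st)
  case 0
  then have "exec (While r P c) (st 0) 1 (st 0)" by (intro exec_WhileF) simp
  then show ?case unfolding runs_def by auto
next
  case (Suc n)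
  have "runs (While r P c) (st (Suc 0)) (n * (T + 2) + 1) (st (Suc n))"
    using Suc.IH[of "\<lambda>i. st (Suc i)"] Suc.prems by simp
  then obtain t2 where t2: "t2 \<le> n * (T + 2) + 1" "exec (While r P c) (st (Suc 0)) t2 (st (Suc n))"
    by (auto simp: runs_def)
  from Suc.prems(2)[of 0] obtain t1 where t1: "t1 \<le> T" "exec c (st 0) t1 (st (Suc 0))"
    by (auto simp: runs_def)
  have "exec (While r P c) (st 0) (t1 + t2 + 2) (st (Suc n))"
    using Suc.prems(1)[of 0] t1 t2 by (intro exec_WhileT) auto
  then show ?case unfolding runs_def using t1(1) t2(1) by (intro exI[of _ "t1 + t2 + 2"]) auto
qed

section \<open>Sequences of programs and unary stacks\<close>

definition seqs :: "com list \<Rightarrow> com" where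
  "seqs cs = foldr (;;) cs Skip"

lemma uses_seqs [simp]: "uses n (seqs cs) \<longleftrightarrow> (\<forall>c\<in>set cs. uses n c)"
  by (induction cs) (auto simp: seqs_def)

lemma runs_seqs:
  assumes "\<And>x out. x \<in> set xs \<Longrightarrow> runs (f x) (s, out) (k x) (s, out @ h x)"
  shows "runs (seqs (map f xs)) (s, out) (sum_list (map k xs)) (s, out @ concat (map h xs))"
  using assms
proof (induction xs arbitrary: out)
  case Nil
  then show ?case using runs_Skip by (simp add: seqs_def)
next
  case (Cons x xs)
  have "runs (f x) (s, out) (k x) (s, out @ h x)" using Cons.prems by simp
  moreover have "runs (seqs (map f xs)) (s, out @ h x) (sum_list (map k xs)) (s, (out @ h x) @ concat (map h xs))"
    by (rule Cons.IH) (use Cons.prems in simp)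
  ultimately show ?case using runs_Seq by (fastforce simp: seqs_def)
qed

definition outs :: "bool list \<Rightarrow> com" where
  "outs bs = seqs (map Out bs)"

lemma uses_outs [simp]: "uses n (outs bs)"
  by (simp add: outs_def)

lemma runs_outs: "runs (outs bs) (s, out) (length bs) (s, out @ bs)"
proof -
  have "runs (seqs (map Out bs)) (s, out) (sum_list (map (\<lambda>_. 1) bs)) (s, out @ concat (map (\<lambda>b. [b]) bs))"
    by (rule runs_seqs) (rule runs_Out)
  then show ?thesis by (simp add: outs_def sum_list_triv)
qed

abbreviation nonempty :: "nat \<Rightarrow> bool" where
  "nonempty \<equiv> \<lambda>s. s \<noteq> 0"

definition unary :: "nat \<Rightarrow> bool list" where
  "unary n = replicate n True"

lemma unary_simps [simp]:
  "unary 0 = []" "tl (unary n) = unary (n - 1)" "True # unary n = unary (Suc n)" "top_sym (unary n) = 0 \<longleftrightarrow> n = 0"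
  "unary n = [] \<longleftrightarrow> n = 0" "unary m = unary n \<longleftrightarrow> m = n" "length (unary n) = n"
  by (auto simp: unary_def sym_def gr0_conv_Suc neq0_conv[symmetric] simp del: neq0_conv)
    (cases n; simp add: sym_def)+

lemma unary_1: "[True] = unary (Suc 0)"
  by (simp add: unary_def)

lemma list_update_numeral [simp]: "(x # xs)[numeral v := y] = x # xs[pred_numeral v := y]"
  by (simp add: numeral_eq_Suc)

lemma top_sym_contents: "top_sym (drop i x) = contents x (int i)"
  by (cases "i < length x") (auto simp: contents_def sym_def Cons_nth_drop_Suc[symmetric])

definition move_to :: "nat \<Rightarrow> nat \<Rightarrow> com" where
  "move_to r r' = While r nonempty (Pop r ;; Push r' True)"

lemma runs_move_to:
  assumes "s ! r = unary n" "s ! r' = unary m" "r \<noteq> r'" "r < length s" "r' < length s"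
  shows "runs (move_to r r') (s, out) (5 * n + 1) (s[r := [], r' := unary (m + n)], out)"
proof -
  let ?st = "\<lambda>i. (s[r := unary (n - i), r' := unary (m + i)], out)"
  have "runs (move_to r r') (?st 0) (n * (3 + 2) + 1) (?st n)"
    unfolding move_to_def
  proof (rule runs_While)
    fix i assume i: "i < n"
    show "runs (Pop r ;; Push r' True) (?st i) 3 (?st (Suc i))"
      by (rule runs_weaken[OF runs_Seq[OF runs_Pop runs_Push]])
        (use assms i in \<open>auto intro!: nth_equalityI simp: nth_list_update\<close>)
  qed (use assms in auto)
  moreover have "?st 0 = (s, out)" using assms by (metis add.right_neutral list_update_id minus_nat.diff_0)
  ultimately show ?thesis by (simp add: mult.commute)
qed

definition clear :: "nat \<Rightarrow> com" where
  "clear r = While r nonempty (Pop r)"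

lemma runs_clear:
  assumes "s ! r = unary n" "r < length s"
  shows "runs (clear r) (s, out) (3 * n + 1) (s[r := []], out)"
proof -
  let ?st = "\<lambda>i. (s[r := unary (n - i)], out)"
  have "runs (clear r) (?st 0) (n * (1 + 2) + 1) (?st n)"
    unfolding clear_def
  proof (rule runs_While)
    fix i assume i: "i < n"
    show "runs (Pop r) (?st i) 1 (?st (Suc i))"
      by (rule runs_weaken[OF runs_Pop]) (use assms i in auto)
  qed (use assms in auto)
  moreover have "?st 0 = (s, out)" using assms by (metis list_update_id minus_nat.diff_0)
  moreover have "n * (1 + 2) + 1 = 3 * n + 1" by simp
  ultimately show ?thesis by (metis diff_self_eq_0 unary_simps(1))
qed


subsection \<open>Printing templates\<close>

text \<open>
  Registers: 0 holds the input; 1 and 3 hold unary loop counters whose elapsed parts, the current row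
  and column, are in 2 and 4; 5 and 6 are scratch; 7 is a binary counter.
\<close>

definition print_index :: "nat \<Rightarrow> com" where
  "print_index r = While r nonempty (Pop r ;; Push 5 True ;; Out True ;; Out True) ;; move_to 5 r"

lemma runs_print_index:
  assumes "s ! r = unary n" "s ! 5 = []" "r \<noteq> 5" "r < length s" "5 < length s"
  shows "runs (print_index r) (s, out) (12 * n + 2) (s, out @ replicate (2 * n) True)"
proof -
  let ?st = "\<lambda>i. (s[r := unary (n - i), 5 := unary i], out @ replicate (2 * i) True)"
  have "runs (While r nonempty (Pop r ;; Push 5 True ;; Out True ;; Out True)) (?st 0) (n * (5 + 2) + 1) (?st n)"
  proof (rule runs_While)
    fix i assume i: "i < n"
    have "replicate (2 * i) True @ [True] @ [True] = replicate (2 * Suc i) True"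
      by (metis append_Cons append_Nil replicate_append_same mult_Suc_right add_2_eq_Suc replicate_Suc append_assoc)
    then show "runs (Pop r ;; Push 5 True ;; Out True ;; Out True) (?st i) 5 (?st (Suc i))"
      by (intro runs_weaken[OF runs_Seq[OF runs_Pop runs_Seq[OF runs_Push runs_Seq[OF runs_Out runs_Out]]]])
        (use assms i in \<open>auto intro!: nth_equalityI simp: nth_list_update simp del: replicate_Suc\<close>)
  qed (use assms in auto)
  moreover have "?st 0 = (s, out)" using assms by (metis append_Nil2 list_update_id minus_nat.diff_0 mult_0_right replicate_empty unary_simps(1))
  moreover have "runs (move_to 5 r) (?st n) (5 * n + 1) ((s[r := unary (n - n), 5 := unary n])[5 := [], r := unary (0 + n)], out @ replicate (2 * n) True)"
    by (rule runs_move_to) (use assms in auto)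
  moreover have "(s[r := unary (n - n), 5 := unary n])[5 := [], r := unary (0 + n)] = s"
    using assms by (intro nth_equalityI) (auto simp: nth_list_update)
  ultimately show ?thesis unfolding print_index_def using runs_Seq by (fastforce intro: runs_weaken)
qed

lemma enc_nat_binary: "enc_nat n = concat (map (\<lambda>b. [True, b]) (binary n)) @ [False]"
proof -
  have "enc_list (\<lambda>b. [b]) bs = concat (map (\<lambda>b. [True, b]) bs) @ [False]" for bs
    by (induction bs) auto
  then show ?thesis by (simp add: enc_nat_def)
qed

lemma concat_replicate_True: "concat (map (\<lambda>b. [True, b]) (replicate n True)) = replicate (2 * n) True"
  by (induction n) auto

text \<open>\<open>enc_nat\<close> puts \<open>True\<close> before every bit, so a unary block
  becomes a block of twice the length; loops over the row and column counters can print it without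
  computing the number.\<close>

lemma enc_nat_name:
  "enc_nat (name t c z) = replicate (2 * t) True @ [True, False] @ replicate (2 * c) True @ [True, False] @
     replicate (2 * Suc z) True @ [False]"
  unfolding enc_nat_binary binary_name name_bits_def
  by (simp add: concat_replicate_True del: replicate_Suc mult_Suc_right map_replicate)

definition print_v :: "vtemplate \<Rightarrow> com" where
  "print_v = (\<lambda>(dt, dc, z). print_index 2 ;; outs (replicate (2 * dt) True @ [True, False]) ;;
     print_index 4 ;; outs (replicate (2 * dc) True @ [True, False] @ replicate (2 * Suc z) True @ [False]))"

text \<open>The factor of a time bound \<open>cost_v p * B\<close> with \<open>t + c < B\<close>: a
  product form in which the loops and the constant output are absorbed alike, uniformly over all
  cells.\<close>

definition cost_v :: "vtemplate \<Rightarrow> nat" where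
  "cost_v = (\<lambda>(dt, dc, z). 24 + 2 * (dt + dc + z))"

lemma runs_print_v:
  assumes "s ! 2 = unary t" "s ! 4 = unary c" "s ! 5 = []" "length s = 8" "t + c < B"
  shows "runs (print_v p) (s, out) (cost_v p * B) (s, out @ enc_nat (at_v t c p))"
proof -
  obtain dt dc z where p: "p = (dt, dc, z)" by (metis prod_cases3)
  have "(24 + 2 * (dt + dc + z)) * (t + c + 1) \<le> cost_v p * B"
    unfolding p cost_v_def prod.case using assms(5) by (intro mult_left_mono) auto
  then have B: "12 * t + 12 * c + 22 + 2 * dt + 2 * dc + 2 * Suc z \<le> cost_v p * B"
    by (simp add: algebra_simps)
  show ?thesis
    unfolding p print_v_def prod.case
    by (rule runs_weaken[OF runs_Seq[OF runs_print_index[of _ _ t] runs_Seq[OF runs_outs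
        runs_Seq[OF runs_print_index[of _ _ c] runs_outs]]]])
      (use assms B[unfolded p] in \<open>auto simp: at_v_def enc_nat_name replicate_add distrib_left simp del: replicate_Suc mult_Suc_right\<close>)
qed

text \<open>Without the end marker of \<open>enc_list\<close> the encodings of consecutive pieces
  can be concatenated, so that a list can be printed in parts.\<close>

definition encs :: "('a \<Rightarrow> bool list) \<Rightarrow> 'a list \<Rightarrow> bool list" where
  "encs e xs = concat (map (\<lambda>x. True # e x) xs)"

lemma enc_list_encs: "enc_list e xs = encs e xs @ [False]"
  by (induction xs) (auto simp: encs_def)

lemma encs_append [simp]: "encs e (xs @ ys) = encs e xs @ encs e ys"
  by (simp add: encs_def)

lemma encs_concat: "encs e (concat xss) = concat (map (encs e) xss)"
  by (induction xss) (auto simp: encs_def)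

lemma encs_grid_list: "encs e (grid_list n m h) = grid_list n m (\<lambda>t c. encs e (h t c))"
  unfolding grid_list_def encs_concat by (simp add: o_def encs_concat)

definition print_vs :: "vtemplate list \<Rightarrow> com" where
  "print_vs ps = seqs (map (\<lambda>p. Out True ;; print_v p) ps)"

definition print_es :: "(vtemplate \<times> vtemplate) list \<Rightarrow> com" where
  "print_es es = seqs (map (\<lambda>(p, q). Out True ;; print_v p ;; print_v q) es)"

definition cost_vs :: "vtemplate list \<Rightarrow> nat" where
  "cost_vs ps = sum_list (map (\<lambda>p. 1 + cost_v p) ps)"

definition cost_es :: "(vtemplate \<times> vtemplate) list \<Rightarrow> nat" where
  "cost_es es = sum_list (map (\<lambda>(p, q). 1 + cost_v p + cost_v q) es)"

lemma runs_print_vs: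
  assumes "s ! 2 = unary t" "s ! 4 = unary c" "s ! 5 = []" "length s = 8" "t + c < B"
  shows "runs (print_vs ps) (s, out) (cost_vs ps * B) (s, out @ encs enc_nat (map (at_v t c) ps))"
proof -
  have "runs (print_vs ps) (s, out) (sum_list (map (\<lambda>p. (1 + cost_v p) * B) ps))
      (s, out @ concat (map (\<lambda>p. True # enc_nat (at_v t c p)) ps))"
    unfolding print_vs_def
    by (rule runs_seqs, rule runs_weaken[OF runs_Seq[OF runs_Out runs_print_v]], rule assms, rule assms,
        rule assms, rule assms, rule assms) (use assms(5) in auto)
  moreover have "sum_list (map (\<lambda>p. (1 + cost_v p) * B) ps) = cost_vs ps * B"
    by (induction ps) (auto simp: cost_vs_def algebra_simps)
  ultimately show ?thesis by (simp add: encs_def o_def)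
qed

lemma runs_print_es:
  assumes "s ! 2 = unary t" "s ! 4 = unary c" "s ! 5 = []" "length s = 8" "t + c < B"
  shows "runs (print_es es) (s, out) (cost_es es * B) (s, out @ encs enc_edge (map (at_e t c) es))"
proof -
  have "runs (print_es es) (s, out) (sum_list (map (\<lambda>e. (case e of (p, q) \<Rightarrow> 1 + cost_v p + cost_v q) * B) es))
      (s, out @ concat (map (\<lambda>e. True # enc_edge (at_e t c e)) es))"
    unfolding print_es_def
  proof (rule runs_seqs)
    fix e :: "vtemplate \<times> vtemplate" and out
    obtain p q where e: "e = (p, q)" by (cases e) blast
    show "runs (case e of (p, q) \<Rightarrow> Out True ;; print_v p ;; print_v q) (s, out)
        ((case e of (p, q) \<Rightarrow> 1 + cost_v p + cost_v q) * B) (s, out @ True # enc_edge (at_e t c e))"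
      unfolding e prod.case
      by (rule runs_weaken[OF runs_Seq[OF runs_Out runs_Seq[OF runs_print_v[OF assms] runs_print_v[OF assms]]]])
        (use assms(5) in \<open>auto simp: enc_edge_def at_e_def algebra_simps\<close>)
  qed
  moreover have "sum_list (map (\<lambda>e. (case e of (p, q) \<Rightarrow> 1 + cost_v p + cost_v q) * B) es) = cost_es es * B"
    by (induction es) (auto simp: cost_es_def algebra_simps)
  ultimately show ?thesis by (simp add: encs_def o_def)
qed

lemma uses_print [simp]: "uses 8 (print_vs ps)" "uses 8 (print_es es)"
  by (auto simp: print_vs_def print_es_def print_v_def print_index_def move_to_def)


subsection \<open>Loops over the grid\<close>

lemma binary_0 [simp]: "binary 0 = []"
  by (simp add: binary.simps)

definition grid :: "com \<Rightarrow> com" where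
  "grid body = While 1 nonempty (Pop 1 ;; While 3 nonempty (Pop 3 ;; body ;; Push 4 True) ;;
     move_to 4 3 ;; Push 2 True) ;; move_to 2 1"

definition grid_time :: "nat \<Rightarrow> nat \<Rightarrow> nat \<Rightarrow> nat" where
  "grid_time n m T = n * (m * (T + 10) + 7) + 5 * n + 2"

text \<open>The body may print and may also advance the binary counter by \<open>q\<close>. Thus the
  same loop serves for the output, with \<open>q = 0\<close>, and for computing the budget, without
  output.\<close>

lemma runs_grid:
  assumes "\<And>t c a b kn out. t < n \<Longrightarrow> c < m \<Longrightarrow> kn \<le> n * m * q \<Longrightarrow>
      runs body ([x, unary a, unary t, unary b, unary c, [], f, binary kn], out) T
        ([x, unary a, unary t, unary b, unary c, [], f, binary (kn + q)], out @ h t c)"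
  shows "runs (grid body) ([x, unary n, [], unary m, [], [], f, []], out) (grid_time n m T)
     ([x, unary n, [], unary m, [], [], f, binary (n * m * q)], out @ grid_list n m h)"
proof -
  have inner: "runs (While 3 nonempty (Pop 3 ;; body ;; Push 4 True))
      ([x, unary a, unary t, unary m, [], [], f, binary kn], out) (m * (T + 3 + 2) + 1)
      ([x, unary a, unary t, [], unary m, [], f, binary (kn + m * q)], out @ concat (map (h t) [0..<m]))"
    if t: "t < n" and kn: "kn + m * q \<le> n * m * q" for a t kn out
  proof -
    let ?st = "\<lambda>c. ([x, unary a, unary t, unary (m - c), unary c, [], f, binary (kn + c * q)],
      out @ concat (map (h t) [0..<c]))"
    have "runs (While 3 nonempty (Pop 3 ;; body ;; Push 4 True)) (?st 0) (m * (T + 3 + 2) + 1) (?st m)"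
    proof (rule runs_While)
      fix c assume c: "c < m"
      have "c * q \<le> m * q" using c by simp
      then have "kn + c * q \<le> n * m * q" using kn by linarith
      note body = assms[OF t c this, of a "m - c - 1"]
      show "runs (Pop 3 ;; body ;; Push 4 True) (?st c) (T + 3) (?st (Suc c))"
        by (rule runs_weaken[OF runs_Seq[OF runs_Pop runs_Seq[OF runs_start[OF _ body] runs_Push]]])
          (use c in \<open>auto simp: add_ac\<close>)
    qed auto
    then show ?thesis by simp
  qed
  let ?st = "\<lambda>t. ([x, unary (n - t), unary t, unary m, [], [], f, binary (t * (m * q))],
      out @ concat (map (\<lambda>t. concat (map (h t) [0..<m])) [0..<t]))"
  have outer: "runs (While 1 nonempty (Pop 1 ;; While 3 nonempty (Pop 3 ;; body ;; Push 4 True) ;;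
     move_to 4 3 ;; Push 2 True)) (?st 0) (n * (m * (T + 10) + 5 + 2) + 1) (?st n)"
  proof (rule runs_While)
    fix t assume t: "t < n"
    have "Suc t * (m * q) \<le> n * (m * q)" using t by (intro mult_right_mono) auto
    then have "t * (m * q) + m * q \<le> n * m * q" by (simp add: algebra_simps)
    note inner' = inner[OF t this, of "n - t - 1"]
    show "runs (Pop 1 ;; While 3 nonempty (Pop 3 ;; body ;; Push 4 True) ;; move_to 4 3 ;; Push 2 True)
       (?st t) (m * (T + 10) + 5) (?st (Suc t))"
      by (rule runs_weaken[OF runs_Seq[OF runs_Pop runs_Seq[OF runs_start[OF _ inner']
            runs_Seq[OF runs_move_to[of _ _ m _ 0] runs_Push]]]])
        (use t in \<open>auto simp: algebra_simps\<close>)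
  qed auto
  show ?thesis
    unfolding grid_def
    by (rule runs_weaken[OF runs_Seq[OF runs_start[OF _ outer] runs_move_to[of _ _ n _ 0]]])
      (auto simp: grid_time_def grid_list_def mult.assoc)
qed

definition grid1 :: "com \<Rightarrow> com" where
  "grid1 body = Push 1 True ;; Push 3 True ;; grid body ;; Pop 1 ;; Pop 3"

definition grid1_time :: "nat \<Rightarrow> nat \<Rightarrow> nat" where
  "grid1_time N T = grid_time (N + 1) (2 * N + 1) T + 6"

lemma runs_grid1:
  assumes "\<And>t c a b kn out. t \<le> N \<Longrightarrow> c \<le> 2 * N \<Longrightarrow> kn \<le> (N + 1) * (2 * N + 1) * q \<Longrightarrow>
      runs body ([x, unary a, unary t, unary b, unary c, [], f, binary kn], out) T
        ([x, unary a, unary t, unary b, unary c, [], f, binary (kn + q)], out @ h t c)"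
  shows "runs (grid1 body) ([x, unary N, [], unary (2 * N), [], [], f, []], out) (grid1_time N T)
     ([x, unary N, [], unary (2 * N), [], [], f, binary ((N + 1) * (2 * N + 1) * q)], out @ grid_list (N + 1) (2 * N + 1) h)"
proof -
  have g: "runs (grid body) ([x, unary (N + 1), [], unary (2 * N + 1), [], [], f, []], out) (grid_time (N + 1) (2 * N + 1) T)
     ([x, unary (N + 1), [], unary (2 * N + 1), [], [], f, binary ((N + 1) * (2 * N + 1) * q)], out @ grid_list (N + 1) (2 * N + 1) h)"
    by (rule runs_grid) (use assms in simp)
  show ?thesis
    unfolding grid1_def
    by (rule runs_weaken[OF runs_Seq[OF runs_Push runs_Seq[OF runs_Push runs_Seq[OF runs_start[OF _ g]
          runs_Seq[OF runs_Pop runs_Pop]]]]])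
      (auto simp: grid1_time_def)
qed

abbreviation ready :: "bool list \<Rightarrow> nat \<Rightarrow> bool list list" where
  "ready x N \<equiv> [x, unary N, [], unary (2 * N), [], [], [], []]"

lemma runs_grid1_vs:
  "runs (grid1 (print_vs ps)) (ready x N, out) (grid1_time N (cost_vs ps * (3 * N + 1)))
     (ready x N, out @ encs enc_nat (grid_list (N + 1) (2 * N + 1) (\<lambda>t c. map (at_v t c) ps)))"
  unfolding encs_grid_list
  by (rule runs_weaken[OF runs_grid1[where q = 0, OF runs_weaken[OF runs_print_vs[where B = "3 * N + 1"]]]]) auto

lemma runs_grid1_es:
  "runs (grid1 (print_es es)) (ready x N, out) (grid1_time N (cost_es es * (3 * N + 1)))
     (ready x N, out @ encs enc_edge (grid_list (N + 1) (2 * N + 1) (\<lambda>t c. map (at_e t c) es)))"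
  unfolding encs_grid_list
  by (rule runs_weaken[OF runs_grid1[where q = 0, OF runs_weaken[OF runs_print_es[where B = "3 * N + 1"]]]]) auto

lemma runs_grid_es:
  "runs (grid (print_es es)) (ready x N, out) (grid_time N (2 * N) (cost_es es * (3 * N + 1)))
     (ready x N, out @ encs enc_edge (grid_list N (2 * N) (\<lambda>t c. map (at_e t c) es)))"
  unfolding encs_grid_list
  by (rule runs_weaken[OF runs_grid[where q = 0, OF runs_weaken[OF runs_print_es[where B = "3 * N + 1"]]]]) auto


subsection \<open>Counting in binary\<close>

text \<open>The least significant bit is on top. The initial block of ones moves to register 5, the
  zero below it, if there is one, is replaced by a one, and the block returns as zeros.\<close>

definition inc :: com where
  "inc = While 7 (\<lambda>s. s = 2) (Pop 7 ;; Push 5 True) ;; Cond 7 nonempty (Pop 7) Skip ;; Push 7 True ;;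
     While 5 nonempty (Pop 5 ;; Push 7 False)"

lemma binary_Suc_cases:
  obtains j rest where "binary n = unary j @ rest" "rest = [] \<or> (\<exists>r. rest = False # r)"
    "binary (Suc n) = replicate j False @ True # tl rest"
proof (induction n arbitrary: thesis rule: less_induct)
  case (less n)
  consider "n = 0" | "n > 0" "even n" | "odd n" by blast
  then show ?case
  proof cases
    case 1
    then show ?thesis using less.prems[of 0 "[]"] by (simp add: binary.simps)
  next
    case 2
    then have "binary n = False # binary (n div 2)" "binary (Suc n) = True # binary (n div 2)"
      by (auto simp: binary.simps[of n] binary.simps[of "Suc n"])
    then show ?thesis using less.prems[of 0 "binary n"] by simp
  next
    case 3
    then have n: "binary n = True # binary (n div 2)" "binary (Suc n) = False # binary (Suc (n div 2))" "n div 2 < n"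
      by (auto simp: binary.simps[of n] binary.simps[of "Suc n"] elim!: oddE)
    obtain j rest where "binary (n div 2) = unary j @ rest" "rest = [] \<or> (\<exists>r. rest = False # r)"
      "binary (Suc (n div 2)) = replicate j False @ True # tl rest"
      by (rule less.IH[OF n(3)])
    then show ?thesis using less.prems[of "Suc j" rest] n by (simp flip: unary_simps(3))
  qed
qed

lemma length_binary: "length (binary n) \<le> n"
proof (induction n rule: less_induct)
  case (less n)
  show ?case
  proof (cases "n = 0")
    case False
    then have "length (binary (n div 2)) \<le> n div 2" using less by simp
    then show ?thesis using False by (simp add: binary.simps[of n])
  qed simp
qed

text \<open>The length of the counter is bounded crudely by its value, which suffices because all
  counts are polynomial in the input length.\<close>

lemma runs_inc:
  "runs inc ([x, a, b, c, d, [], f, binary n], out) (10 * n + 7) ([x, a, b, c, d, [], f, binary (Suc n)], out)"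
proof -
  obtain j rest where n: "binary n = unary j @ rest" "rest = [] \<or> (\<exists>r. rest = False # r)"
    "binary (Suc n) = replicate j False @ True # tl rest"
    by (rule binary_Suc_cases)
  have top: "top_sym rest \<noteq> 2" using n(2) by (auto simp: sym_def)
  have j: "j \<le> n" using length_binary[of n] n(1) by simp
  let ?s1 = "\<lambda>i. ([x, a, b, c, d, unary i, f, unary (j - i) @ rest], out)"
  have 1: "runs (While 7 (\<lambda>s. s = 2) (Pop 7 ;; Push 5 True)) (?s1 0) (j * (3 + 2) + 1) (?s1 j)"
  proof (rule runs_While)
    fix i assume i: "i < j"
    then obtain k where k: "j - i = Suc k" "j - Suc i = k" by (metis Suc_diff_Suc)
    show "top_sym (fst (?s1 i) ! 7) = 2" unfolding k(1) by (simp add: sym_def unary_def)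
    show "runs (Pop 7 ;; Push 5 True) (?s1 i) 3 (?s1 (Suc i))"
      by (rule runs_weaken[OF runs_Seq[OF runs_Pop runs_Push]]) (auto simp: k unary_def)
  qed (simp add: top)
  have 2: "runs (Cond 7 nonempty (Pop 7) Skip) ([x, a, b, c, d, unary j, f, rest], out) (1 + 2)
      ([x, a, b, c, d, unary j, f, tl rest], out)"
    by (rule runs_Cond) (rule runs_weaken[OF runs_Pop] runs_weaken[OF runs_Skip]; use n(2) in \<open>auto simp: sym_def\<close>)+
  let ?s3 = "\<lambda>i. ([x, a, b, c, d, unary (j - i), f, replicate i False @ True # tl rest], out)"
  have 3: "runs (While 5 nonempty (Pop 5 ;; Push 7 False)) (?s3 0) (j * (3 + 2) + 1) (?s3 j)"
  proof (rule runs_While)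
    fix i assume i: "i < j"
    show "runs (Pop 5 ;; Push 7 False) (?s3 i) 3 (?s3 (Suc i))"
      by (rule runs_weaken[OF runs_Seq[OF runs_Pop runs_Push]]) auto
  qed auto
  have "runs inc (?s1 0) ((j * (3 + 2) + 1) + ((1 + 2) + (2 + (j * (3 + 2) + 1)))) (?s3 j)"
    unfolding inc_def
    by (rule runs_Seq[OF 1 runs_Seq[OF runs_start[OF _ 2] runs_Seq[OF runs_Push runs_start[OF _ 3]]]]) auto
  then have "runs inc (?s1 0) (10 * n + 7) (?s3 j)" by (rule runs_weaken) (use j in simp_all)
  then show ?thesis using n by simp
qed


section \<open>The reduction in polynomial time\<close>

text \<open>The budget is obtained by counting: each cell of the grid contributes the same constant
  number of increments.\<close>

definition incs :: "nat \<Rightarrow> com" where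
  "incs q = seqs (replicate q inc)"

lemma runs_incs:
  "runs (incs q) ([x, a, b, c, d, [], f, binary n], out) (q * (10 * (n + q) + 7))
     ([x, a, b, c, d, [], f, binary (n + q)], out)"
proof (induction q arbitrary: n)
  case 0
  then show ?case using runs_Skip by (simp add: incs_def seqs_def)
next
  case (Suc q)
  have "runs (inc ;; incs q) ([x, a, b, c, d, [], f, binary n], out) (Suc q * (10 * (n + Suc q) + 7))
     ([x, a, b, c, d, [], f, binary (n + Suc q)], out)"
    by (rule runs_weaken[OF runs_Seq[OF runs_inc Suc.IH]]) (auto simp: algebra_simps)
  then show ?case by (simp add: incs_def seqs_def)
qed

definition print_count :: com where
  "print_count = While 7 nonempty (Out True ;; Cond 7 (\<lambda>s. s = 2) (Out True) (Out False) ;; Pop 7) ;; Out False"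

lemma runs_print_count:
  "runs print_count ([x, a, b, c, d, e, f, binary n], out) (7 * n + 2) ([x, a, b, c, d, e, f, []], out @ enc_nat n)"
proof -
  let ?k = "binary n"
  let ?st = "\<lambda>i. ([x, a, b, c, d, e, f, drop i ?k], out @ concat (map (\<lambda>b. [True, b]) (take i ?k)))"
  have loop: "runs (While 7 nonempty (Out True ;; Cond 7 (\<lambda>s. s = 2) (Out True) (Out False) ;; Pop 7))
      (?st 0) (length ?k * (5 + 2) + 1) (?st (length ?k))"
  proof (rule runs_While)
    fix i assume i: "i < length ?k"
    have d: "drop i ?k = ?k ! i # drop (Suc i) ?k" using i by (rule Cons_nth_drop_Suc[symmetric])
    show "nonempty (top_sym (fst (?st i) ! 7))" by (simp add: d sym_def)
    have bit: "runs (Cond 7 (\<lambda>s. s = 2) (Out True) (Out False)) ([x, a, b, c, d, e, f, ?k ! i # w], out') (1 + 2)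
        ([x, a, b, c, d, e, f, ?k ! i # w], out' @ [?k ! i])" for w out'
      by (rule runs_Cond) (rule runs_weaken[OF runs_Out]; auto simp: sym_def split: if_splits)+
    show "runs (Out True ;; Cond 7 (\<lambda>s. s = 2) (Out True) (Out False) ;; Pop 7) (?st i) 5 (?st (Suc i))"
      unfolding d
      by (rule runs_weaken[OF runs_Seq[OF runs_Out runs_Seq[OF bit runs_Pop]]])
        (use i in \<open>auto simp: take_Suc_conv_app_nth\<close>)
  qed simp
  show ?thesis
    unfolding print_count_def
    by (rule runs_weaken[OF runs_Seq[OF runs_start[OF _ loop] runs_Out]])
      (use length_binary[of n] in \<open>auto simp: enc_nat_binary\<close>)
qed


subsection \<open>Preparing the counters\<close>

definition copy_bit :: "nat \<Rightarrow> nat \<Rightarrow> com" where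
  "copy_bit r r' = Cond r (\<lambda>s. s = 2) (Push r' True) (Push r' False)"

lemma runs_copy_bit:
  assumes "s ! r = b # w"
  shows "runs (copy_bit r r') (s, out) 4 (s[r' := b # s ! r'], out)"
proof -
  have "runs (copy_bit r r') (s, out) (2 + 2) (s[r' := b # s ! r'], out)"
    unfolding copy_bit_def
    by (rule runs_Cond) (rule runs_weaken[OF runs_Push]; use assms in \<open>auto simp: sym_def split: if_splits\<close>)+
  then show ?thesis by simp
qed

text \<open>Passing through register 6 reverses the input, and passing back restores it while its
  length remains in register 2.\<close>

definition count_input :: com where
  "count_input = While 0 nonempty (copy_bit 0 6 ;; Pop 0 ;; Push 2 True) ;;
     While 6 nonempty (copy_bit 6 0 ;; Pop 6)"

lemma runs_count_input:
  "runs count_input ([x, [], [], [], [], [], [], []], out) (16 * length x + 2)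
     ([x, [], unary (length x), [], [], [], [], []], out)"
proof -
  let ?n = "length x"
  let ?s1 = "\<lambda>i. ([drop i x, [], unary i, [], [], [], rev (take i x), []], out)"
  have 1: "runs (While 0 nonempty (copy_bit 0 6 ;; Pop 0 ;; Push 2 True)) (?s1 0) (?n * (7 + 2) + 1) (?s1 ?n)"
  proof (rule runs_While)
    fix i assume i: "i < ?n"
    have d: "drop i x = x ! i # drop (Suc i) x" using i by (rule Cons_nth_drop_Suc[symmetric])
    show "nonempty (top_sym (fst (?s1 i) ! 0))" by (simp add: d sym_def)
    show "runs (copy_bit 0 6 ;; Pop 0 ;; Push 2 True) (?s1 i) 7 (?s1 (Suc i))"
      by (rule runs_weaken[OF runs_Seq[OF runs_copy_bit[of _ 0 "x ! i" "drop (Suc i) x"] runs_Seq[OF runs_Pop runs_Push]]])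
        (use i d in \<open>auto simp: take_Suc_conv_app_nth\<close>)
  qed simp
  let ?y = "rev x"
  let ?s2 = "\<lambda>i. ([rev (take i ?y), [], unary ?n, [], [], [], drop i ?y, []], out)"
  have 2: "runs (While 6 nonempty (copy_bit 6 0 ;; Pop 6)) (?s2 0) (?n * (5 + 2) + 1) (?s2 ?n)"
  proof (rule runs_While)
    fix i assume i: "i < ?n"
    have d: "drop i ?y = ?y ! i # drop (Suc i) ?y" using i by (simp add: Cons_nth_drop_Suc)
    show "nonempty (top_sym (fst (?s2 i) ! 6))" by (simp add: d sym_def)
    show "runs (copy_bit 6 0 ;; Pop 6) (?s2 i) 5 (?s2 (Suc i))"
      by (rule runs_weaken[OF runs_Seq[OF runs_copy_bit[of _ 6 "?y ! i" "drop (Suc i) ?y"] runs_Pop]])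
        (use i d in \<open>auto simp: take_Suc_conv_app_nth\<close>)
  qed simp
  show ?thesis
    unfolding count_input_def
    by (rule runs_weaken[OF runs_Seq[OF runs_start[OF _ 1] runs_start[OF _ 2]]]) auto
qed

definition mult :: com where
  "mult = While 1 nonempty (Pop 1 ;; While 2 nonempty (Pop 2 ;; Push 4 True ;; Push 5 True) ;; move_to 4 2) ;;
     move_to 5 1"

lemma runs_mult:
  "runs mult ([x, unary a, unary b, [], [], [], [], []], out) (a * (17 * b + 5) + 2)
     ([x, unary (a * b), unary b, [], [], [], [], []], out)"
proof -
  have inner: "runs (While 2 nonempty (Pop 2 ;; Push 4 True ;; Push 5 True))
      ([x, unary a', unary b, [], [], unary e, [], []], out) (b * (5 + 2) + 1)
      ([x, unary a', [], [], unary b, unary (e + b), [], []], out)" for a' e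
  proof -
    let ?st = "\<lambda>i. ([x, unary a', unary (b - i), [], unary i, unary (e + i), [], []], out)"
    have "runs (While 2 nonempty (Pop 2 ;; Push 4 True ;; Push 5 True)) (?st 0) (b * (5 + 2) + 1) (?st b)"
    proof (rule runs_While)
      fix i assume i: "i < b"
      show "runs (Pop 2 ;; Push 4 True ;; Push 5 True) (?st i) 5 (?st (Suc i))"
        by (rule runs_weaken[OF runs_Seq[OF runs_Pop runs_Seq[OF runs_Push runs_Push]]]) (use i in auto)
    qed auto
    then show ?thesis by simp
  qed
  let ?st = "\<lambda>i. ([x, unary (a - i), unary b, [], [], unary (i * b), [], []], out)"
  have outer: "runs (While 1 nonempty (Pop 1 ;; While 2 nonempty (Pop 2 ;; Push 4 True ;; Push 5 True) ;; move_to 4 2))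
      (?st 0) (a * (12 * b + 3 + 2) + 1) (?st a)"
  proof (rule runs_While)
    fix i assume i: "i < a"
    show "runs (Pop 1 ;; While 2 nonempty (Pop 2 ;; Push 4 True ;; Push 5 True) ;; move_to 4 2) (?st i) (12 * b + 3) (?st (Suc i))"
      by (rule runs_weaken[OF runs_Seq[OF runs_Pop runs_Seq[OF runs_start[OF _ inner[of "a - i - 1" "i * b"]] runs_move_to[of _ _ b _ 0]]]])
        (use i in \<open>auto simp: add.commute\<close>)
  qed auto
  show ?thesis
    unfolding mult_def
    by (rule runs_weaken[OF runs_Seq[OF runs_start[OF _ outer] runs_move_to[of _ _ "a * b" _ 0]]])
      (auto simp: algebra_simps)
qed

definition setup_com :: "nat \<Rightarrow> com" where
  "setup_com e = count_input ;; seqs (replicate e (Push 2 True)) ;; Push 1 True ;; seqs (replicate e mult) ;; clear 2 ;;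
     While 1 nonempty (Pop 1 ;; Push 5 True ;; Push 3 True ;; Push 3 True) ;; move_to 5 1"

lemma runs_pushes:
  "runs (seqs (replicate e (Push 2 True))) ([x, a, unary b, c, d, g, f, k], out) (2 * e) ([x, a, unary (b + e), c, d, g, f, k], out)"
proof (induction e arbitrary: b)
  case 0
  then show ?case using runs_Skip by (simp add: seqs_def)
next
  case (Suc e)
  have "runs (Push 2 True ;; seqs (replicate e (Push 2 True))) ([x, a, unary b, c, d, g, f, k], out) (2 * Suc e)
      ([x, a, unary (b + Suc e), c, d, g, f, k], out)"
    by (rule runs_weaken[OF runs_Seq[OF runs_Push runs_start[OF _ Suc.IH[of "Suc b"]]]]) auto
  then show ?case by (simp add: seqs_def)
qed

text \<open>As \<open>b \<ge> 1\<close>, no intermediate product exceeds the final one, so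
  \<open>P\<close> bounds the cost of every multiplication.\<close>

lemma runs_power:
  assumes "b \<ge> 1" "a * b ^ e \<le> P"
  shows "runs (seqs (replicate e mult)) ([x, unary a, unary b, [], [], [], [], []], out) (e * (P * (17 * b + 5) + 2))
     ([x, unary (a * b ^ e), unary b, [], [], [], [], []], out)"
  using assms(2)
proof (induction e arbitrary: a)
  case 0
  then show ?case using runs_Skip by (simp add: seqs_def)
next
  case (Suc e)
  have "1 \<le> b ^ Suc e" using assms(1) by simp
  then have "a \<le> P" using Suc.prems by (metis le_trans mult.right_neutral mult_le_mono2)
  then have T: "a * (17 * b + 5) + 2 \<le> P * (17 * b + 5) + 2" by simp
  have "runs (mult ;; seqs (replicate e mult)) ([x, unary a, unary b, [], [], [], [], []], out) (Suc e * (P * (17 * b + 5) + 2))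
     ([x, unary (a * b ^ Suc e), unary b, [], [], [], [], []], out)"
  proof (rule runs_weaken[OF runs_Seq[OF runs_mult Suc.IH]])
    show "a * b * b ^ e \<le> P" using Suc.prems by (simp add: mult.assoc)
    show "a * (17 * b + 5) + 2 + e * (P * (17 * b + 5) + 2) \<le> Suc e * (P * (17 * b + 5) + 2)"
      using T by simp
  qed (simp add: mult.assoc)
  then show ?case by (simp add: seqs_def)
qed

definition setup_time :: "nat \<Rightarrow> nat \<Rightarrow> nat \<Rightarrow> nat" where
  "setup_time e n N = 16 * n + 2 + (2 * e + (2 + (e * (N * (17 * (n + e) + 5) + 2) + (3 * (n + e) + 1 + (9 * N + 1 + (5 * N + 1))))))"

lemma runs_setup:
  assumes "e \<ge> 1" "N = (length x + e) ^ e"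
  shows "runs (setup_com e) ([x, [], [], [], [], [], [], []], out) (setup_time e (length x) N)
     (ready x N, out)"
proof -
  let ?b = "length x + e"
  let ?st = "\<lambda>i. ([x, unary (N - i), [], unary (2 * i), [], unary i, [], []], out)"
  have dbl: "runs (While 1 nonempty (Pop 1 ;; Push 5 True ;; Push 3 True ;; Push 3 True)) (?st 0) (N * (7 + 2) + 1) (?st N)"
  proof (rule runs_While)
    fix i assume i: "i < N"
    show "runs (Pop 1 ;; Push 5 True ;; Push 3 True ;; Push 3 True) (?st i) 7 (?st (Suc i))"
      by (rule runs_weaken[OF runs_Seq[OF runs_Pop runs_Seq[OF runs_Push runs_Seq[OF runs_Push runs_Push]]]]) (use i in auto)
  qed auto
  have pw: "runs (seqs (replicate e mult)) ([x, unary 1, unary ?b, [], [], [], [], []], out) (e * (N * (17 * ?b + 5) + 2))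
     ([x, unary (1 * ?b ^ e), unary ?b, [], [], [], [], []], out)"
    by (rule runs_power) (use assms in auto)
  show ?thesis
    unfolding setup_com_def
    by (rule runs_weaken[OF runs_Seq[OF runs_count_input runs_Seq[OF runs_pushes runs_Seq[OF runs_Push
          runs_Seq[OF runs_start[OF _ pw] runs_Seq[OF runs_clear[of _ _ ?b] runs_Seq[OF runs_start[OF _ dbl]
          runs_move_to[of _ _ N _ 0]]]]]]]])
      (use assms in \<open>auto simp: unary_1 setup_time_def\<close>)
qed


subsection \<open>The reduction\<close>

context reduction
begin

text \<open>An input cell holds one of three symbols, and for each of them the template list is a
  constant of the program.\<close>

definition select :: "bool \<Rightarrow> com" where
  "select m = Cond 0 (\<lambda>s. s = 0) (print_es (unaryT (b0 m 0)))
     (Cond 0 (\<lambda>s. s = 1) (print_es (unaryT (b0 m 1))) (print_es (unaryT (b0 m 2))))"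

definition select_cost :: nat where
  "select_cost = (\<Sum>m\<in>UNIV. cost_es (unaryT (b0 m 0)) + cost_es (unaryT (b0 m 1)) + cost_es (unaryT (b0 m 2)))"

lemma runs_select:
  assumes "s ! 2 = []" "s ! 4 = unary c" "s ! 5 = []" "length s = 8" "c < B"
  shows "runs (select m) (s, out) (select_cost * B + 4)
     (s, out @ encs enc_edge (map (at_e 0 c) (unaryT (b0 m (top_sym (s ! 0))))))"
proof -
  let ?s' = "(s, out @ encs enc_edge (map (at_e 0 c) (unaryT (b0 m (top_sym (s ! 0))))))"
  have s2: "s ! 2 = unary 0" using assms(1) by simp
  have p: "runs (print_es (unaryT (b0 m i))) (s, out) (select_cost * B)
      (s, out @ encs enc_edge (map (at_e 0 c) (unaryT (b0 m i))))" if "i < 3" for i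
  proof (rule runs_weaken[OF runs_print_es[OF s2 assms(2-4)]])
    have "i = 0 \<or> i = 1 \<or> i = 2" using that by auto
    then have "cost_es (unaryT (b0 m i)) \<le> select_cost"
      unfolding select_cost_def UNIV_bool by (cases m) auto
    then show "cost_es (unaryT (b0 m i)) * B \<le> select_cost * B" by simp
  qed (use assms in auto)
  have top: "top_sym (s ! 0) = 0 \<or> top_sym (s ! 0) = 1 \<or> top_sym (s ! 0) = 2"
    by (cases "s ! 0") (auto simp: sym_def)
  have "runs (select m) (s, out) (select_cost * B + 2 + 2)
     ?s'"
    unfolding select_def
  proof (rule runs_Cond)
    show "runs (print_es (unaryT (b0 m 0))) (s, out) (select_cost * B + 2)
        ?s'"
      if "top_sym (fst (s, out) ! 0) = 0"
      by (rule runs_weaken[OF p[of 0]]) (use that in auto)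
    show "runs (Cond 0 (\<lambda>s. s = 1) (print_es (unaryT (b0 m 1))) (print_es (unaryT (b0 m 2)))) (s, out)
        (select_cost * B + 2) ?s'"
      if "top_sym (fst (s, out) ! 0) \<noteq> 0"
    proof (rule runs_Cond)
      show "runs (print_es (unaryT (b0 m 1))) (s, out) (select_cost * B)
          ?s'"
        if "top_sym (fst (s, out) ! 0) = 1"
        by (rule runs_weaken[OF p[of 1]]) (use that in auto)
      show "runs (print_es (unaryT (b0 m 2))) (s, out) (select_cost * B)
          ?s'"
        if "top_sym (fst (s, out) ! 0) \<noteq> 1"
        by (rule runs_weaken[OF p[of 2]]) (use that top \<open>top_sym (fst (s, out) ! 0) \<noteq> 0\<close> in auto)
    qed
  qed
  then show ?thesis by (rule runs_weaken) auto
qed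

text \<open>The columns left of the head are blank, the head column reads the first symbol, and the
  columns to its right consume the rest of the input. Register 6 preserves the counter, which bounds
  both loops.\<close>

definition start_com :: com where
  "start_com = While 1 nonempty (Pop 1 ;; print_es (unaryT (b0 False 0)) ;; Push 4 True ;; Push 6 True) ;; move_to 6 1 ;;
     select True ;; Pop 0 ;; Push 4 True ;;
     While 1 nonempty (Pop 1 ;; select False ;; Pop 0 ;; Push 4 True ;; Push 6 True) ;; move_to 6 1 ;; clear 4"

definition start_time :: "nat \<Rightarrow> nat" where
  "start_time N = N * (cost_es (unaryT (b0 False 0)) * (2 * N + 1) + 5 + 2) + 1 + (5 * N + 1 +
     (select_cost * (2 * N + 1) + 4 + (1 + (2 +
     (N * (select_cost * (2 * N + 1) + 4 + 6 + 2) + 1 + (5 * N + 1 + (3 * (2 * N + 1) + 1)))))))"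

lemma runs_start_com:
  assumes "length x \<le> N"
  shows "runs start_com (ready x N, out) (start_time N)
     (ready [] N, out @ encs enc_edge (startL N x))"
proof -
  define g where "g c = encs enc_edge (map (at_e 0 c) (unaryT (b0 (c = N) (contents x (int c - int N)))))" for c
  have g1: "encs enc_edge (map (at_e 0 c) (unaryT (b0 False 0))) = g c" if "c < N" for c
    using that by (simp add: g_def contents_def)
  have g2: "encs enc_edge (map (at_e 0 N) (unaryT (b0 True (top_sym x)))) = g N"
    using top_sym_contents[of 0 x] by (simp add: g_def)
  have g3: "encs enc_edge (map (at_e 0 (Suc N + i)) (unaryT (b0 False (top_sym (drop (Suc i) x))))) = g (Suc N + i)" for i
    unfolding top_sym_contents g_def by (simp add: algebra_simps)
  let ?B = "2 * N + 1"
  let ?s1 = "\<lambda>i. ([x, unary (N - i), [], unary (2 * N), unary i, [], unary i, []], out @ concat (map g [0..<i]))"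
  have 1: "runs (While 1 nonempty (Pop 1 ;; print_es (unaryT (b0 False 0)) ;; Push 4 True ;; Push 6 True)) (?s1 0)
      (N * (cost_es (unaryT (b0 False 0)) * ?B + 5 + 2) + 1) (?s1 N)"
  proof (rule runs_While)
    fix i assume i: "i < N"
    show "runs (Pop 1 ;; print_es (unaryT (b0 False 0)) ;; Push 4 True ;; Push 6 True) (?s1 i)
        (cost_es (unaryT (b0 False 0)) * ?B + 5) (?s1 (Suc i))"
      by (rule runs_weaken[OF runs_Seq[OF runs_Pop runs_Seq[OF runs_print_es[of _ 0 i ?B] runs_Seq[OF runs_Push runs_Push]]]])
        (use i g1[OF i] in auto)
  qed auto
  let ?out2 = "(out @ concat (map g [0..<N])) @ g N"
  let ?s2 = "\<lambda>i. ([drop (Suc i) x, unary (N - i), [], unary (2 * N), unary (Suc N + i), [], unary i, []],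
      ?out2 @ concat (map (\<lambda>i. g (Suc N + i)) [0..<i]))"
  have 2: "runs (While 1 nonempty (Pop 1 ;; select False ;; Pop 0 ;; Push 4 True ;; Push 6 True)) (?s2 0)
      (N * (select_cost * ?B + 4 + 6 + 2) + 1) (?s2 N)"
  proof (rule runs_While)
    fix i assume i: "i < N"
    show "runs (Pop 1 ;; select False ;; Pop 0 ;; Push 4 True ;; Push 6 True) (?s2 i) (select_cost * ?B + 4 + 6) (?s2 (Suc i))"
      by (rule runs_weaken[OF runs_Seq[OF runs_Pop runs_Seq[OF runs_select[of _ "Suc N + i" ?B] runs_Seq[OF runs_Pop
            runs_Seq[OF runs_Push runs_Push]]]]])
        (use i g3[of i] in \<open>auto simp: drop_Suc tl_drop\<close>)
  qed auto
  have "map (\<lambda>i. g (Suc N + i)) [0..<N] = map g [Suc N..<N + Suc N]"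
    unfolding map_add_upt[symmetric] by (simp add: add.commute)
  moreover have "[0..<2 * N + 1] = [0..<N] @ N # [Suc N..<N + Suc N]"
    using upt_add_eq_append[of 0 N "Suc N"] upt_conv_Cons[of N "N + Suc N"] by (simp add: mult_2)
  ultimately have out: "encs enc_edge (startL N x) = concat (map g [0..<N]) @ g N @ concat (map (\<lambda>i. g (Suc N + i)) [0..<N])"
    unfolding startL_def encs_concat map_map g_def[abs_def, symmetric] o_def by (simp del: upt_Suc)
  have drop: "drop (Suc N) x = []" using assms by simp
  show ?thesis
    unfolding start_com_def
    by (rule runs_weaken[OF runs_Seq[OF runs_start[OF _ 1] runs_Seq[OF runs_move_to[of _ _ N _ 0]
          runs_Seq[OF runs_select[of _ N ?B] runs_Seq[OF runs_Pop runs_Seq[OF runs_Push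
          runs_Seq[OF runs_start[OF _ 2] runs_Seq[OF runs_move_to[of _ _ N _ 0] runs_clear[of _ _ "2 * N + 1"]]]]]]]]])
      (use g2 out drop in \<open>auto simp: start_time_def drop_Suc mult_2\<close>)
qed

definition final_com :: com where
  "final_com = While 1 nonempty (Pop 1 ;; Push 2 True ;; Push 4 True) ;; print_es (unaryT bF) ;; clear 4 ;; move_to 2 1"

definition final_time :: "nat \<Rightarrow> nat" where
  "final_time N = N * (5 + 2) + 1 + (cost_es (unaryT bF) * (3 * N + 1) + (3 * N + 1 + (5 * N + 1)))"

lemma runs_final_com:
  "runs final_com (ready x N, out) (final_time N)
     (ready x N, out @ encs enc_edge (map (at_e N N) (unaryT bF)))"
proof -
  let ?st = "\<lambda>i. ([x, unary (N - i), unary i, unary (2 * N), unary i, [], [], []], out)"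
  have 1: "runs (While 1 nonempty (Pop 1 ;; Push 2 True ;; Push 4 True)) (?st 0) (N * (5 + 2) + 1) (?st N)"
  proof (rule runs_While)
    fix i assume i: "i < N"
    show "runs (Pop 1 ;; Push 2 True ;; Push 4 True) (?st i) 5 (?st (Suc i))"
      by (rule runs_weaken[OF runs_Seq[OF runs_Pop runs_Seq[OF runs_Push runs_Push]]]) (use i in auto)
  qed auto
  show ?thesis
    unfolding final_com_def
    by (rule runs_weaken[OF runs_Seq[OF runs_start[OF _ 1] runs_Seq[OF runs_print_es[of _ N N "3 * N + 1"]
          runs_Seq[OF runs_clear[of _ _ N] runs_move_to[of _ _ N _ 0]]]]])
      (auto simp: final_time_def)
qed

definition class_com :: "nat \<Rightarrow> com" where
  "class_com i = Out True ;; grid1 (print_es (cellT i)) ;; outs (if i = 0 then encs enc_edge starL else []) ;;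
     (if i = 2 then grid (print_es confT) ;; start_com ;; final_com else Skip) ;; Out False"

definition class_time :: "nat \<Rightarrow> nat \<Rightarrow> nat" where
  "class_time N i = 1 + (grid1_time N (cost_es (cellT i) * (3 * N + 1)) + (length (encs enc_edge starL) +
     (grid_time N (2 * N) (cost_es confT * (3 * N + 1)) + (start_time N + final_time N) + 1)))"

lemma runs_class_other:
  assumes "i \<noteq> 2"
  shows "runs (class_com i) (ready y N, out) (class_time N i)
     (ready y N, out @ True # enc_list enc_edge (classL N x i))"
  using assms unfolding class_com_def
  by (simp only: if_False)
    (rule runs_weaken[OF runs_Seq[OF runs_Out runs_Seq[OF runs_grid1_es runs_Seq[OF runs_outs runs_Seq[OF runs_Skip runs_Out]]]]],
      auto simp: enc_list_encs classL_def class_time_def encs_def)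

text \<open>Printing the initial row uses up register 0, the only register not restored; as no other
  class reads the input, the programs for the classes can still be chained.\<close>

lemma runs_class_2:
  assumes "length x \<le> N"
  shows "runs (class_com 2) (ready x N, out) (class_time N 2)
     (ready [] N, out @ True # enc_list enc_edge (classL N x 2))"
  unfolding class_com_def
  by (simp only: if_True refl)
    (rule runs_weaken[OF runs_Seq[OF runs_Out runs_Seq[OF runs_grid1_es runs_Seq[OF runs_outs runs_Seq[OF
        runs_Seq[OF runs_grid_es runs_Seq[OF runs_start_com[OF assms] runs_final_com]] runs_Out]]]]],
      auto simp: enc_list_encs classL_def class_time_def encs_def)

definition reduction_com :: "nat \<Rightarrow> com" where
  "reduction_com e = setup_com e ;; grid1 (print_vs vertT) ;; outs (encs enc_nat starV @ [False]) ;;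
     seqs (map class_com [0..<2]) ;; class_com 2 ;; seqs (map class_com [3..<l - 1]) ;; Out False ;;
     grid1 (incs (A * half + A - 1)) ;; print_count"

definition reduction_time :: "nat \<Rightarrow> nat \<Rightarrow> nat \<Rightarrow> nat" where
  "reduction_time e n N = setup_time e n N + (grid1_time N (cost_vs vertT * (3 * N + 1)) + (length (encs enc_nat starV) + 1 +
     (sum_list (map (class_time N) [0..<2]) + (class_time N 2 + (sum_list (map (class_time N) [3..<l - 1]) + (1 +
     (grid1_time N ((A * half + A - 1) * (10 * (budget N + (A * half + A - 1)) + 7)) + (7 * budget N + 2))))))))"

lemma runs_reduction_com:
  assumes "e \<ge> 1" "N = (length x + e) ^ e"
  shows "runs (reduction_com e) (x # replicate 7 [], []) (reduction_time e (length x) N)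
     (ready [] N, enc_inst (instance_of N x))"
proof -
  \<comment> \<open>From \<open>e \<ge> 1\<close> the whole input fits into the right half of row
    0.\<close>
  have "length x + e \<le> N"
    using assms power_increasing[of 1 e "length x + e"] by simp
  then have n: "length x \<le> N" by simp
  let ?c = "\<lambda>i. True # enc_list enc_edge (classL N x i)"
  have c: "runs (seqs (map class_com is)) (ready y N, out)
      (sum_list (map (class_time N) is))
      (ready y N, out @ concat (map ?c is))" if "2 \<notin> set is" for "is" y out
    by (rule runs_seqs, rule runs_class_other) (use that in auto)
  let ?q = "A * half + A - 1"
  have cnt: "runs (grid1 (incs ?q)) (ready [] N, out) (grid1_time N (?q * (10 * (budget N + ?q) + 7)))
     ([[], unary N, [], unary (2 * N), [], [], [], binary ((N + 1) * (2 * N + 1) * ?q)], out @ grid_list (N + 1) (2 * N + 1) (\<lambda>t c. []))"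
    for out
    by (rule runs_grid1, rule runs_weaken[OF runs_incs]) (auto simp: budget_def intro!: mult_left_mono)
  have "l - 1 = 2 + (l - 3)" using l by simp
  then have "[0..<l - 1] = [0..<2] @ [2..<l - 1]" by (simp only:) (rule upt_add_eq_append, simp)
  moreover have "[2..<l - 1] = 2 # [Suc 2..<l - 1]" by (rule upt_conv_Cons) (use l in simp)
  ultimately have split: "[0..<l - 1] = [0..<2] @ 2 # [3..<l - 1]" by (simp only: Suc_numeral semiring_norm)
  have nogrid: "grid_list n m (\<lambda>t c. []) = ([] :: bool list)" for n m
    by (simp add: grid_list_def)
  have enc: "enc_inst (instance_of N x) = encs enc_nat (grid_list (N + 1) (2 * N + 1) (\<lambda>t c. map (at_v t c) vertT)) @
      (encs enc_nat starV @ [False]) @ concat (map ?c [0..<2]) @ ?c 2 @ concat (map ?c [3..<l - 1]) @ [False] @ enc_nat (budget N)"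
    unfolding enc_inst_def instance_of_def prod.case vertL_def enc_list_encs[of enc_nat] enc_list_encs[of "enc_list enc_edge"] split
    by (simp add: encs_def o_def)
  show ?thesis
    unfolding reduction_com_def
    by (rule runs_weaken[OF runs_Seq[OF runs_start[OF _ runs_setup[OF assms]] runs_Seq[OF runs_grid1_vs runs_Seq[OF runs_outs
          runs_Seq[OF c runs_Seq[OF runs_class_2[OF n] runs_Seq[OF c runs_Seq[OF runs_Out runs_Seq[OF cnt runs_print_count]]]]]]]]])
      (auto simp: enc nogrid budget_def reduction_time_def eval_nat_numeral)
qed

end

section \<open>Polynomial bounds on the running time\<close>

definition poly_bounded :: "(nat \<Rightarrow> nat) \<Rightarrow> bool" where
  "poly_bounded f \<longleftrightarrow> (\<exists>p. \<forall>n. f n \<le> poly p n)"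

lemma poly_bounded_const: "poly_bounded (\<lambda>n. c)"
  unfolding poly_bounded_def by (intro exI[of _ "[:c:]"]) simp

lemma poly_bounded_id: "poly_bounded (\<lambda>n. n)"
  unfolding poly_bounded_def by (intro exI[of _ "[:0, 1:]"]) simp

lemma poly_bounded_add: "poly_bounded f \<Longrightarrow> poly_bounded g \<Longrightarrow> poly_bounded (\<lambda>n. f n + g n)"
  unfolding poly_bounded_def by (metis add_mono poly_add)

lemma poly_bounded_mult: "poly_bounded f \<Longrightarrow> poly_bounded g \<Longrightarrow> poly_bounded (\<lambda>n. f n * g n)"
  unfolding poly_bounded_def by (metis mult_le_mono poly_mult)

lemma poly_bounded_power: "poly_bounded f \<Longrightarrow> poly_bounded (\<lambda>n. f n ^ k)"
  by (induction k) (auto intro: poly_bounded_const poly_bounded_mult)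

lemma poly_bounded_sum_list: "(\<And>i. poly_bounded (\<lambda>n. f n i)) \<Longrightarrow> poly_bounded (\<lambda>n. sum_list (map (f n) is))"
  by (induction "is") (auto intro: poly_bounded_const poly_bounded_add)

lemmas poly_bounded_intros = poly_bounded_const poly_bounded_id poly_bounded_add poly_bounded_mult
  poly_bounded_power poly_bounded_sum_list

context reduction
begin

text \<open>The template costs and \<open>e\<close> are constants, so the bound arises from
  \<open>n\<close> and \<open>(n + e) ^ e\<close> by sums and products.\<close>

lemma poly_bounded_reduction_time: "poly_bounded (\<lambda>n. reduction_time e n ((n + e) ^ e))"
  unfolding reduction_time_def setup_time_def grid1_time_def grid_time_def class_time_def start_time_def
    final_time_def budget_def
  by (intro poly_bounded_intros)

lemma uses_reduction_com: "uses 8 (reduction_com e)"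
  by (auto simp: reduction_com_def setup_com_def count_input_def copy_bit_def mult_def move_to_def clear_def
      grid1_def grid_def class_com_def start_com_def select_def final_com_def incs_def inc_def print_count_def)

theorem polytime_instance:
  assumes "e \<ge> 1"
  shows "polytime (\<lambda>x. enc_inst (instance_of ((length x + e) ^ e) x))"
proof -
  obtain p where p: "\<And>n. reduction_time e n ((n + e) ^ e) \<le> poly p n"
    using poly_bounded_reduction_time unfolding poly_bounded_def by blast
  show ?thesis
  proof (rule polytime_com)
    show "uses (Suc 7) (reduction_com e)" using uses_reduction_com by simp
    show "\<exists>t s'. t \<le> poly p (length x) \<and> runs (reduction_com e) (x # replicate 7 [], []) t
        (s', enc_inst (instance_of ((length x + e) ^ e) x))" for x
      using runs_reduction_com[OF assms refl] p by blast
  qed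
qed

end

theorem theorem7:
  fixes l :: nat
  assumes "l \<ge> 4"
  shows "NP_hard enc_inst
           {I \<in> path_deletion_instances (l - 1). max_degree (inst_graph I) = 16}
           (colored_path_deletion (l - 1) l)"
  unfolding NP_hard_def
proof
  fix L assume "L \<in> NP"
  then obtain A bad b0 bF e where A: "A \<ge> 1" "e \<ge> 1"
    and L: "\<And>x. x \<in> L \<longleftrightarrow> grid_csp.sat A bad b0 bF ((length x + e) ^ e) x"
    using NP_grid_csp by blast
  interpret reduction A bad b0 bF l by unfold_locales (use A assms in auto)
  show "\<exists>g. polytime (\<lambda>x. enc_inst (g x)) \<and>
      (\<forall>x. g x \<in> {I \<in> path_deletion_instances (l - 1). max_degree (inst_graph I) = 16} \<and>
        (x \<in> L \<longleftrightarrow> g x \<in> colored_path_deletion (l - 1) l))"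
    using polytime_instance[OF A(2)] instance_correct L
    by (intro exI[of _ "\<lambda>x. instance_of ((length x + e) ^ e) x"]) auto
qed

end
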